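(* For every integer $t\geq 3$, \textsc{Strong $K_{1,t}$-closure} can be solved in time $2^{O(r^2)}\cdot n^{O(1)}$, where $r=k-\mu(G)$ for the input $(G,k)$ and $n=|V(G)|$.
   Context: All graphs are finite, simple and undirected. For graphs $H,F$, $H\simeq F$ means $H$ is isomorphic to $F$. Given a graph $G$ and a graph $F$, a (not necessarily induced) spanning subgraph $H$ of $G$ satisfies the $F$-closure if for every $S\subseteq V(H)$ with $H[S]\simeq F$ we have $G[S]\not\simeq F$. \textsc{Strong $F$-closure}: given a graph $G$ and a nonnegative integer $k$, decide whether $G$ has a spanning subgraph $H$ satisfying the $F$-closure with $|E(H)|\ge k$. $K_{1,t}$ is the star with $t$ leaves. $\mu(G)$ is the maximum size of a matching in $G$. *)

theory Defs
  imports Complex_Main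
begin

section \<open>Graphs\<close>

type_synonym 'a graph = "'a set \<times> 'a set set"

abbreviation verts :: "'a graph \<Rightarrow> 'a set" where
  "verts \<equiv> fst"

abbreviation edges :: "'a graph \<Rightarrow> 'a set set" where
  "edges \<equiv> snd"

definition simple_graph :: "'a graph \<Rightarrow> bool" where
  "simple_graph G \<longleftrightarrow> finite (verts G) \<and> (\<forall>e\<in>edges G. e \<subseteq> verts G \<and> card e = 2)"

definition induced :: "'a graph \<Rightarrow> 'a set \<Rightarrow> 'a graph" where
  "induced G S = (S, {e \<in> edges G. e \<subseteq> S})"

definition isomorphic :: "'a graph \<Rightarrow> 'b graph \<Rightarrow> bool" where
  "isomorphic G F \<longleftrightarrow> (\<exists>f. bij_betw f (verts G) (verts F) \<and>
     (\<forall>u\<in>verts G. \<forall>v\<in>verts G. {u, v} \<in> edges G \<longleftrightarrow> {f u, f v} \<in> edges F))"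

definition spanning_subgraph :: "'a graph \<Rightarrow> 'a graph \<Rightarrow> bool" where
  "spanning_subgraph H G \<longleftrightarrow> simple_graph H \<and> verts H = verts G \<and> edges H \<subseteq> edges G"

definition satisfies_closure :: "'b graph \<Rightarrow> 'a graph \<Rightarrow> 'a graph \<Rightarrow> bool" where
  "satisfies_closure F G H \<longleftrightarrow>
     (\<forall>S\<subseteq>verts H. isomorphic (induced H S) F \<longrightarrow> \<not> isomorphic (induced G S) F)"

definition strong_closure :: "'b graph \<Rightarrow> 'a graph \<Rightarrow> nat \<Rightarrow> bool" where
  "strong_closure F G k \<longleftrightarrow>
     (\<exists>H. spanning_subgraph H G \<and> satisfies_closure F G H \<and> k \<le> card (edges H))"

definition star :: "nat \<Rightarrow> nat graph" where
  "star t = ({0..t}, {{0, i} |i. i \<in> {1..t}})"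

definition matching :: "'a graph \<Rightarrow> 'a set set \<Rightarrow> bool" where
  "matching G M \<longleftrightarrow> M \<subseteq> edges G \<and> (\<forall>e\<in>M. \<forall>e'\<in>M. e \<noteq> e' \<longrightarrow> e \<inter> e' = {})"

definition matching_number :: "'a graph \<Rightarrow> nat" where
  "matching_number G = Max (card ` {M. matching G M})"


section \<open>Random access machines\<close>

text \<open>
  Unit-cost random access machines, presented as while-programs. A program names finitely many
  registers and has an unbounded memory that is addressed indirectly through registers; all
  cells hold natural numbers. The arithmetic instructions are addition and truncated subtraction
  only: multiplication at unit cost would make the model too powerful, whereas without it running
  times agree with those of Turing machines up to a polynomial.
\<close>

datatype prog =
    Const nat nat
  | Add nat nat nat
  | Sub nat nat nat
  | Load nat nat
  | Store nat nat
  | Seq prog prog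
  | IfNZ nat prog prog
  | WhileNZ nat prog

text \<open>A state consists of the register contents and the memory contents.\<close>

type_synonym state = "(nat \<Rightarrow> nat) \<times> (nat \<Rightarrow> nat)"

text \<open>\<open>exec p s m s'\<close>: started in \<open>s\<close>, program \<open>p\<close> halts in \<open>s'\<close> after exactly \<open>m\<close> steps;
  every instruction and every test of a branching or loop condition counts as one step.\<close>

inductive exec :: "prog \<Rightarrow> state \<Rightarrow> nat \<Rightarrow> state \<Rightarrow> bool" where
  Const: "exec (Const x c) (r, h) 1 (r(x := c), h)"
| Add: "exec (Add x y z) (r, h) 1 (r(x := r y + r z), h)"
| Sub: "exec (Sub x y z) (r, h) 1 (r(x := r y - r z), h)"
| Load: "exec (Load x y) (r, h) 1 (r(x := h (r y)), h)"
| Store: "exec (Store x y) (r, h) 1 (r, h(r x := r y))"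
| Seq: "exec p s m s' \<Longrightarrow> exec q s' m' s'' \<Longrightarrow> exec (Seq p q) s (m + m') s''"
| IfTrue: "r x \<noteq> 0 \<Longrightarrow> exec p (r, h) m s' \<Longrightarrow> exec (IfNZ x p q) (r, h) (Suc m) s'"
| IfFalse: "r x = 0 \<Longrightarrow> exec q (r, h) m s' \<Longrightarrow> exec (IfNZ x p q) (r, h) (Suc m) s'"
| WhileFalse: "r x = 0 \<Longrightarrow> exec (WhileNZ x p) (r, h) 1 (r, h)"
| WhileTrue: "r x \<noteq> 0 \<Longrightarrow> exec p (r, h) m s' \<Longrightarrow> exec (WhileNZ x p) s' m' s'' \<Longrightarrow>
    exec (WhileNZ x p) (r, h) (Suc (m + m')) s''"

inductive_cases exec_ConstE: "exec (Const x c) s m s'"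
inductive_cases exec_AddE: "exec (Add x y z) s m s'"
inductive_cases exec_SubE: "exec (Sub x y z) s m s'"
inductive_cases exec_LoadE: "exec (Load x y) s m s'"
inductive_cases exec_StoreE: "exec (Store x y) s m s'"
inductive_cases exec_SeqE: "exec (Seq p q) s m s'"
inductive_cases exec_IfNZE: "exec (IfNZ x p q) s m s'"
inductive_cases exec_WhileNZE: "exec (WhileNZ x p) s m s'"

lemma exec_deterministic:
  "exec p s m s' \<Longrightarrow> exec p s n t \<Longrightarrow> m = n \<and> s' = t"
proof (induction arbitrary: n t rule: exec.induct)
  case Const
  then show ?case by (auto elim: exec_ConstE)
next
  case Add
  then show ?case by (auto elim: exec_AddE)
next
  case Sub
  then show ?case by (auto elim: exec_SubE)
next
  case Load
  then show ?case by (auto elim: exec_LoadE)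
next
  case Store
  then show ?case by (auto elim: exec_StoreE)
next
  case (Seq p s m s' q m' s'')
  from Seq.prems obtain a b u where "exec p s a u" "exec q u b t" "n = a + b"
    by (rule exec_SeqE)
  with Seq.IH show ?case by metis
next
  case (IfTrue r x p h m s' q)
  from IfTrue.prems obtain a where "exec p (r, h) a t" "n = Suc a"
    using IfTrue.hyps by (auto elim: exec_IfNZE)
  with IfTrue.IH show ?case by metis
next
  case (IfFalse r x q h m s' p)
  from IfFalse.prems obtain a where "exec q (r, h) a t" "n = Suc a"
    using IfFalse.hyps by (auto elim: exec_IfNZE)
  with IfFalse.IH show ?case by metis
next
  case WhileFalse
  then show ?case by (auto elim: exec_WhileNZE)
next
  case (WhileTrue r x p h m s' m' s'')
  from WhileTrue.prems obtain a b u
    where "exec p (r, h) a u" "exec (WhileNZ x p) u b t" "n = Suc (a + b)"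
    using WhileTrue.hyps by (auto elim: exec_WhileNZE)
  with WhileTrue.IH show ?case by metis
qed

text \<open>An instance \<open>(G, k)\<close> with \<open>G\<close> on the vertices \<open>0, \<dots>, n - 1\<close> is presented by \<open>n\<close> in register 0,
  \<open>k\<close> in register 1 and the adjacency matrix of \<open>G\<close>, row by row, in memory cells
  \<open>0, \<dots>, n * n - 1\<close>; everything else is 0.\<close>

definition initial_state :: "nat graph \<Rightarrow> nat \<Rightarrow> state" where
  "initial_state G k =
     (let n = card (verts G) in
      ((\<lambda>_. 0)(0 := n, 1 := k),
       (\<lambda>a. if a < n * n \<and> {a div n, a mod n} \<in> edges G then 1 else 0)))"

text \<open>The answer is read off register 0.\<close>

definition decides_in_time ::
  "prog \<Rightarrow> (nat graph \<Rightarrow> nat \<Rightarrow> bool) \<Rightarrow> (nat graph \<Rightarrow> nat \<Rightarrow> real) \<Rightarrow> bool" where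
  "decides_in_time p Q T \<longleftrightarrow>
     (\<forall>G k. simple_graph G \<and> verts G = {0..<card (verts G)} \<longrightarrow>
        (\<exists>m r h. exec p (initial_state G k) m (r, h) \<and>
           r 0 = (if Q G k then 1 else 0) \<and> real m \<le> T G k))"

text \<open>Running time \<open>2\<^bsup>O(r\<^sup>2)\<^esup> \<cdot> n\<^bsup>O(1)\<^esup>\<close> for an integer-valued parameter \<open>r\<close>, with \<open>n\<close> the number
  of vertices. The constant \<open>A\<close> is the additive constant in the exponent \<open>O(r\<^sup>2)\<close>, needed at
  \<open>r = 0\<close>; \<open>max 1\<close> only matters for the graph without vertices.\<close>

definition solvable_in_time_exp_square_poly ::
  "(nat graph \<Rightarrow> nat \<Rightarrow> bool) \<Rightarrow> (nat graph \<Rightarrow> nat \<Rightarrow> int) \<Rightarrow> bool" where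
  "solvable_in_time_exp_square_poly Q param \<longleftrightarrow>
     (\<exists>p (A::real) (c::real) (d::nat). decides_in_time p Q
        (\<lambda>G k. A * 2 powr (c * (real_of_int (param G k))\<^sup>2) * real (max 1 (card (verts G))) ^ d))"

end

theory Submission imports Defs begin

text \<open>
  A spanning subgraph of maximum degree two satisfies the closure as \<open>t \<ge> 3\<close>, so one may stop as
  soon as such a subgraph with \<open>k\<close> edges is found. Local search with two moves (adding an edge between
  two vertices of degree at most one; replacing an edge \<open>ab\<close> by \<open>ac\<close> and \<open>bd\<close> for isolated
  \<open>c \<noteq> d\<close>) ends in a subgraph \<open>H\<close> in which the set \<open>X\<close> of vertices of degree two is small: charging
  the vertices covered by a matching \<open>M\<close> gives \<open>|X| \<le> 5 (|H| - |M|)\<close>. No maximum matching is ever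
  computed. Moreover the vertices outside \<open>X\<close> induce a matching.

  If \<open>|H| < k\<close> then \<open>|X| \<le> 5 r\<close>. A vertex of \<open>X\<close> has solution edges to at most \<open>t - 1\<close> of the
  components outside \<open>X\<close>, so at most \<open>(t - 1) |X|\<close> components are touched by a solution, and
  components with the same neighbourhoods in \<open>X\<close> are interchangeable. Hence the solution on \<open>X\<close>
  together with the neighbourhoods of the touched components is a certificate of \<open>O(r\<^sup>2)\<close> bits,
  and all bit strings are tried. The program is written in a language of bounded sums and loops that is compiled
  to the machine once and for all.
\<close>

section \<open>A language of bounded arithmetic\<close>

text \<open>Naming a touched component by its vertices would cost log n bits and lead to
  \<open>n ^ O(r)\<close> candidates. This loses nothing because a solution can be conjugated by
  automorphisms that exchange components of equal type; a solution minimising the sum of the first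
  vertices of its touched components uses an initial segment of each type. Untouched components need
  no bits at all, since their inner edges can be added for free. The constant 5 stems from a
  discharging argument valid for every matching, so the matching number enters the analysis only. If
  the local search already reaches k edges, r gives no control over X, and the certificate length
  must be set to 0 to save the running time. The machine neither multiplies nor divides: products
  are bounded sums, and bits are obtained by subtracting stored powers of two.\<close>

datatype exp =
    Num nat
  | Var nat
  | Plus exp exp
  | Minus exp exp
  | Ite exp exp exp
  | Arr nat exp
  | Sum nat nat exp

text \<open>Eight arrays are interleaved in one memory: entry \<open>i\<close> of array \<open>a < 8\<close> is cell \<open>8 * i + a\<close>.
  In \<open>Sum v b e\<close> the variable \<open>v\<close> is bound and runs below the value of the variable \<open>b\<close>.\<close>

definition cell :: "nat \<Rightarrow> nat \<Rightarrow> nat" where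
  "cell a i = 8 * i + a"

primrec ev :: "exp \<Rightarrow> (nat \<Rightarrow> nat) \<Rightarrow> (nat \<Rightarrow> nat) \<Rightarrow> nat" where
  "ev (Num c) \<sigma> M = c"
| "ev (Var v) \<sigma> M = \<sigma> v"
| "ev (Plus a b) \<sigma> M = ev a \<sigma> M + ev b \<sigma> M"
| "ev (Minus a b) \<sigma> M = ev a \<sigma> M - ev b \<sigma> M"
| "ev (Ite c a b) \<sigma> M = (if ev c \<sigma> M \<noteq> 0 then ev a \<sigma> M else ev b \<sigma> M)"
| "ev (Arr a e) \<sigma> M = M (cell a (ev e \<sigma> M))"
| "ev (Sum v b e) \<sigma> M = (\<Sum>i<\<sigma> b. ev e (\<sigma>(v := i)) M)"

text \<open>An upper bound rather than an exact count: \<open>Ite\<close> is charged for both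
  branches, so that no subexpression has to be evaluated to know its cost.\<close>

primrec ecost :: "exp \<Rightarrow> (nat \<Rightarrow> nat) \<Rightarrow> (nat \<Rightarrow> nat) \<Rightarrow> nat" where
  "ecost (Num c) \<sigma> M = 1"
| "ecost (Var v) \<sigma> M = 2"
| "ecost (Plus a b) \<sigma> M = ecost a \<sigma> M + ecost b \<sigma> M + 1"
| "ecost (Minus a b) \<sigma> M = ecost a \<sigma> M + ecost b \<sigma> M + 1"
| "ecost (Ite c a b) \<sigma> M = ecost c \<sigma> M + ecost a \<sigma> M + ecost b \<sigma> M + 1"
| "ecost (Arr a e) \<sigma> M = ecost e \<sigma> M + 7"
| "ecost (Sum v b e) \<sigma> M = 9 + (\<Sum>i<\<sigma> b. ecost e (\<sigma>(v := i)) M + 5)"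

datatype cmd =
    Assign nat exp
  | Upd nat exp exp
  | Then cmd cmd (infixr \<open>;;\<close> 60)
  | When exp cmd
  | For nat nat cmd

type_synonym store = "(nat \<Rightarrow> nat) \<times> (nat \<Rightarrow> nat)"

definition setv :: "nat \<Rightarrow> nat \<Rightarrow> store \<Rightarrow> store" where
  "setv v x s = ((fst s)(v := x), snd s)"

primrec den :: "cmd \<Rightarrow> store \<Rightarrow> store" where
  "den (Assign v e) s = setv v (ev e (fst s) (snd s)) s"
| "den (Upd a i e) s =
     (fst s, (snd s)(cell a (ev i (fst s) (snd s)) := ev e (fst s) (snd s)))"
| "den (c ;; d) s = den d (den c s)"
| "den (When e c) s = (if ev e (fst s) (snd s) \<noteq> 0 then den c s else s)"
| "den (For v b c) s = fold (\<lambda>i s. den c (setv v i s)) [0..<fst s b] s"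

primrec cost :: "cmd \<Rightarrow> store \<Rightarrow> nat" where
  "cost (Assign v e) s = ecost e (fst s) (snd s) + 2"
| "cost (Upd a i e) s = ecost i (fst s) (snd s) + ecost e (fst s) (snd s) + 9"
| "cost (c ;; d) s = cost c s + cost d (den c s)"
| "cost (When e c) s = ecost e (fst s) (snd s) + 2 + (if ev e (fst s) (snd s) \<noteq> 0 then cost c s else 0)"
| "cost (For v b c) s = 4 + (\<Sum>i<fst s b.
     cost c (setv v i (fold (\<lambda>i s. den c (setv v i s)) [0..<i] s)) + 6)"


section \<open>Compilation\<close>

text \<open>Variable \<open>v\<close> lives in register \<open>2 * v\<close>, register 1 holds the address at which the interleaved
  arrays start, and the registers \<open>tmp d, tmp (d + 1), \<dots>\<close> are scratch space.\<close>

definition tmp :: "nat \<Rightarrow> nat" where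
  "tmp d = 2 * d + 3"

definition rel :: "store \<Rightarrow> state \<Rightarrow> bool" where
  "rel s q \<longleftrightarrow> (\<forall>v. fst q (2 * v) = fst s v) \<and> (\<forall>x. snd q (fst q 1 + x) = snd s x)"

definition copy :: "nat \<Rightarrow> nat \<Rightarrow> prog" where
  "copy x y = Seq (Const x 0) (Add x x y)"

text \<open>Three doublings give the factor 8 of \<open>cell\<close>; register 1 then adds the base
  address.\<close>

definition addr :: "nat \<Rightarrow> nat \<Rightarrow> prog" where
  "addr d a = Seq (Add (tmp d) (tmp d) (tmp d)) (Seq (Add (tmp d) (tmp d) (tmp d))
     (Seq (Add (tmp d) (tmp d) (tmp d)) (Seq (Const (tmp (Suc d)) a)
     (Seq (Add (tmp d) (tmp d) (tmp (Suc d))) (Add (tmp d) (tmp d) 1)))))"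

primrec ecomp :: "exp \<Rightarrow> nat \<Rightarrow> prog" where
  "ecomp (Num c) d = Const (tmp d) c"
| "ecomp (Var v) d = copy (tmp d) (2 * v)"
| "ecomp (Plus a b) d = Seq (ecomp a d) (Seq (ecomp b (Suc d)) (Add (tmp d) (tmp d) (tmp (Suc d))))"
| "ecomp (Minus a b) d = Seq (ecomp a d) (Seq (ecomp b (Suc d)) (Sub (tmp d) (tmp d) (tmp (Suc d))))"
| "ecomp (Ite c a b) d = Seq (ecomp c d) (IfNZ (tmp d) (ecomp a d) (ecomp b d))"
| "ecomp (Arr a e) d = Seq (ecomp e d) (Seq (addr d a) (Load (tmp d) (tmp d)))"
| "ecomp (Sum v b e) d =
     Seq (Seq (Const (tmp d) 0) (Seq (copy (tmp (d + 1)) (2 * v)) (Seq (copy (tmp (d + 2)) (2 * b))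
       (Const (2 * v) 0))))
     (Seq (WhileNZ (tmp (d + 2)) (Seq (ecomp e (d + 3))
        (Seq (Add (tmp d) (tmp d) (tmp (d + 3))) (Seq (Const (tmp (d + 3)) 1)
        (Seq (Add (2 * v) (2 * v) (tmp (d + 3))) (Sub (tmp (d + 2)) (tmp (d + 2)) (tmp (d + 3))))))))
     (copy (2 * v) (tmp (d + 1))))"

primrec ccomp :: "cmd \<Rightarrow> nat \<Rightarrow> prog" where
  "ccomp (Assign v e) d = Seq (ecomp e d) (copy (2 * v) (tmp d))"
| "ccomp (Upd a i e) d = Seq (ecomp i d) (Seq (ecomp e (Suc d))
     (Seq (copy (tmp (d + 2)) (tmp (d + 1))) (Seq (addr d a)
       (Store (tmp d) (tmp (d + 2))))))"
| "ccomp (c ;; c') d = Seq (ccomp c d) (ccomp c' d)"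
| "ccomp (When e c) d = Seq (ecomp e d) (IfNZ (tmp d) (ccomp c d) (Const (tmp d) 0))"
| "ccomp (For v b c) d = Seq (Seq (copy (tmp d) (2 * b)) (Const (tmp (Suc d)) 0))
     (WhileNZ (tmp d) (Seq (copy (2 * v) (tmp (Suc d))) (Seq (ccomp c (d + 2))
       (Seq (Const (tmp (d + 2)) 1) (Seq (Add (tmp (Suc d)) (tmp (Suc d)) (tmp (d + 2)))
         (Sub (tmp d) (tmp d) (tmp (d + 2))))))))"

text \<open>Code without branches and loops has an explicit final state and step count, so
  simplification can replace derivations of \<open>exec\<close>.\<close>

primrec straight :: "prog \<Rightarrow> bool" where
  "straight (Const x c) = True"
| "straight (Add x y z) = True"
| "straight (Sub x y z) = True"
| "straight (Load x y) = True"
| "straight (Store x y) = True"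
| "straight (Seq p q) = (straight p \<and> straight q)"
| "straight (IfNZ x p q) = False"
| "straight (WhileNZ x p) = False"

primrec final :: "prog \<Rightarrow> state \<Rightarrow> state" where
  "final (Const x c) s = ((fst s)(x := c), snd s)"
| "final (Add x y z) s = ((fst s)(x := fst s y + fst s z), snd s)"
| "final (Sub x y z) s = ((fst s)(x := fst s y - fst s z), snd s)"
| "final (Load x y) s = ((fst s)(x := snd s (fst s y)), snd s)"
| "final (Store x y) s = (fst s, (snd s)(fst s x := fst s y))"
| "final (Seq p q) s = final q (final p s)"
| "final (IfNZ x p q) s = s"
| "final (WhileNZ x p) s = s"

primrec steps :: "prog \<Rightarrow> nat" where
  "steps (Const x c) = 1"
| "steps (Add x y z) = 1"
| "steps (Sub x y z) = 1"
| "steps (Load x y) = 1"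
| "steps (Store x y) = 1"
| "steps (Seq p q) = steps p + steps q"
| "steps (IfNZ x p q) = 0"
| "steps (WhileNZ x p) = 0"

lemma exec_straight: "straight p \<Longrightarrow> exec p s (steps p) (final p s)"
proof (induction p arbitrary: s)
  case (Seq p q)
  then have "exec p s (steps p) (final p s)" "exec q (final p s) (steps q) (final q (final p s))"
    by simp_all
  then show ?case using exec.Seq by simp
qed (case_tac [!] s, auto intro: exec.intros simp del: One_nat_def)

definition runs :: "prog \<Rightarrow> state \<Rightarrow> nat \<Rightarrow> (state \<Rightarrow> bool) \<Rightarrow> bool" where
  "runs p s T Q \<longleftrightarrow> (\<exists>m s'. exec p s m s' \<and> m \<le> T \<and> Q s')"

lemma runs_straight: "straight p \<Longrightarrow> steps p \<le> T \<Longrightarrow> Q (final p s) \<Longrightarrow> runs p s T Q"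
  unfolding runs_def using exec_straight by blast

lemma runs_Seq:
  assumes "runs p s Ta R" "\<And>s'. R s' \<Longrightarrow> runs q s' Tb Q" "Ta + Tb \<le> T"
  shows "runs (Seq p q) s T Q"
proof -
  obtain m s' where 1: "exec p s m s'" "m \<le> Ta" "R s'" using assms(1) unfolding runs_def by blast
  obtain m' s'' where 2: "exec q s' m' s''" "m' \<le> Tb" "Q s''"
    using assms(2)[OF 1(3)] unfolding runs_def by blast
  have "exec (Seq p q) s (m + m') s''" using 1 2 by (auto intro: exec.Seq)
  moreover have "m + m' \<le> T" using 1 2 assms(3) by linarith
  ultimately show ?thesis using 2 unfolding runs_def by blast
qed

lemma runs_mono: "runs p s T Q \<Longrightarrow> T \<le> T' \<Longrightarrow> (\<And>s'. Q s' \<Longrightarrow> Q' s') \<Longrightarrow> runs p s T' Q'"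
  unfolding runs_def by (meson le_trans)

lemma runs_IfNZ:
  assumes "fst s x \<noteq> 0 \<Longrightarrow> runs p s T Q" "fst s x = 0 \<Longrightarrow> runs q s T Q"
  shows "runs (IfNZ x p q) s (T + 1) Q"
proof (cases s)
  case (Pair r h)
  show ?thesis
  proof (cases "r x = 0")
    case True
    then obtain m s' where "exec q s m s'" "m \<le> T" "Q s'" using assms Pair unfolding runs_def by auto
    then show ?thesis using True Pair unfolding runs_def
      by (intro exI[of _ "Suc m"] exI[of _ s']) (auto intro: exec.IfFalse)
  next
    case False
    then obtain m s' where "exec p s m s'" "m \<le> T" "Q s'" using assms Pair unfolding runs_def by auto
    then show ?thesis using False Pair unfolding runs_def
      by (intro exI[of _ "Suc m"] exI[of _ s']) (auto intro: exec.IfTrue)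
  qed
qed

text \<open>The number N of rounds is fixed beforehand and the invariant carries the round number,
  so termination needs no separate argument. Each round pays 1 for its test, and the leading 1 pays
  for the failing test.\<close>

lemma runs_WhileNZ:
  assumes step: "\<And>i s. i < N \<Longrightarrow> I i s \<Longrightarrow> fst s x \<noteq> 0 \<and> runs p s (T i) (I (Suc i))"
    and stop: "\<And>s. I N s \<Longrightarrow> fst s x = 0" and "I 0 s"
  shows "runs (WhileNZ x p) s (1 + (\<Sum>i<N. T i + 1)) (I N)"
proof -
  have "i \<le> N \<Longrightarrow> I i s \<Longrightarrow> runs (WhileNZ x p) s (1 + (\<Sum>i=i..<N. T i + 1)) (I N)" for i s
  proof (induction "N - i" arbitrary: i s)
    case 0
    then have [simp]: "i = N" by simp
    obtain r h where s: "s = (r, h)" by (cases s)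
    have "r x = 0" using stop 0 s by fastforce
    then show ?case unfolding runs_def s using 0 s
      by (intro exI[of _ 1] exI[of _ s]) (use exec.WhileFalse in auto)
  next
    case (Suc j)
    then have i: "i < N" by simp
    obtain r h where s: "s = (r, h)" by (cases s)
    obtain m s' where 1: "exec p s m s'" "m \<le> T i" "I (Suc i) s'"
      using step[OF i Suc.prems(2)] unfolding runs_def by blast
    have "runs (WhileNZ x p) s' (1 + (\<Sum>i=Suc i..<N. T i + 1)) (I N)"
      using Suc.hyps(2) i 1(3) by (intro Suc.hyps(1)) auto
    then obtain m' s'' where 2: "exec (WhileNZ x p) s' m' s''"
      "m' \<le> 1 + (\<Sum>i=Suc i..<N. T i + 1)" "I N s''" unfolding runs_def by blast
    have "exec (WhileNZ x p) s (Suc (m + m')) s''"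
      using step[OF i Suc.prems(2)] 1 2 unfolding s by (intro exec.WhileTrue) auto
    moreover have "Suc (m + m') \<le> 1 + (\<Sum>i=i..<N. T i + 1)"
      using 1(2) 2(2) i by (simp add: sum.atLeast_Suc_lessThan)
    ultimately show ?case using 2(3) unfolding runs_def by blast
  qed
  from this[of 0 s] show ?thesis using assms(3) by (simp add: atLeast0LessThan)
qed

lemma tmp_simps [simp]:
  "tmp d \<noteq> 2 * v" "2 * v \<noteq> tmp d" "tmp d = tmp d' \<longleftrightarrow> d = d'" "tmp d \<noteq> 1" "tmp d \<noteq> Suc 0"
  "(1::nat) \<noteq> 2 * v" "2 * v \<noteq> (1::nat)" "2 * v \<noteq> Suc 0" "Suc 0 \<noteq> 2 * v" "1 \<noteq> tmp d" "Suc 0 \<noteq> tmp d"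
  unfolding tmp_def by presburger+

text \<open>Everything below \<open>tmp d\<close> is preserved, so that compiled code can be nested.\<close>

definition keeps :: "nat \<Rightarrow> state \<Rightarrow> state \<Rightarrow> bool" where
  "keeps d q q' \<longleftrightarrow> fst q' 1 = fst q 1 \<and> (\<forall>j<d. fst q' (tmp j) = fst q (tmp j))"

definition evals :: "nat \<Rightarrow> state \<Rightarrow> nat \<Rightarrow> state \<Rightarrow> bool" where
  "evals d q x q' \<longleftrightarrow> keeps d q q' \<and> (\<forall>v. fst q' (2 * v) = fst q (2 * v)) \<and> snd q' = snd q \<and>
     fst q' (tmp d) = x"

lemmas run_defs = cell_def copy_def addr_def rel_def keeps_def evals_def

lemma runs_ecomp:
  "rel (\<sigma>, M) q \<Longrightarrow> runs (ecomp e d) q (ecost e \<sigma> M) (evals d q (ev e \<sigma> M))"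
proof (induction e arbitrary: \<sigma> d q)
  case (Num c)
  then show ?case by (auto intro!: runs_straight simp: run_defs)
next
  case (Var v)
  then show ?case by (auto intro!: runs_straight simp: run_defs)
next
  case (Plus a b)
  show ?case unfolding ecomp.simps
    apply (rule runs_Seq[OF Plus.IH(1)[OF Plus.prems]])
     apply (rule runs_Seq[OF Plus.IH(2)[where \<sigma>=\<sigma>]])
    subgoal using Plus.prems by (auto simp: run_defs)
     apply (rule runs_straight[where T=1]; auto simp: run_defs)
    by auto
next
  case (Minus a b)
  show ?case unfolding ecomp.simps
    apply (rule runs_Seq[OF Minus.IH(1)[OF Minus.prems]])
     apply (rule runs_Seq[OF Minus.IH(2)[where \<sigma>=\<sigma>]])
    subgoal using Minus.prems by (auto simp: run_defs)
     apply (rule runs_straight[where T=1]; auto simp: run_defs)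
    by auto
next
  case (Ite c a b)
  let ?Q = "evals d q (ev (Ite c a b) \<sigma> M)"
  have "runs (IfNZ (tmp d) (ecomp a d) (ecomp b d)) q' (ecost a \<sigma> M + ecost b \<sigma> M + 1) ?Q"
    if q': "evals d q (ev c \<sigma> M) q'" for q'
  proof (rule runs_IfNZ)
    have r: "rel (\<sigma>, M) q'" using q' Ite.prems by (auto simp: run_defs)
    show "runs (ecomp a d) q' (ecost a \<sigma> M + ecost b \<sigma> M) ?Q" if "fst q' (tmp d) \<noteq> 0"
      using Ite.IH(2)[OF r] by (rule runs_mono) (use q' that in \<open>auto simp: run_defs\<close>)
    show "runs (ecomp b d) q' (ecost a \<sigma> M + ecost b \<sigma> M) ?Q" if "fst q' (tmp d) = 0"
      using Ite.IH(3)[OF r] by (rule runs_mono) (use q' that in \<open>auto simp: run_defs\<close>)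
  qed
  note if_runs = this
  show ?case unfolding ecomp.simps
    by (rule runs_Seq[OF Ite.IH(1)[OF Ite.prems] if_runs]) auto
next
  case (Arr a e)
  show ?case unfolding ecomp.simps
    apply (rule runs_Seq[OF Arr.IH[OF Arr.prems]])
     apply (rule runs_straight[where T=7])
    subgoal by (simp add: run_defs)
    subgoal by (simp add: run_defs)
    subgoal for s
    proof -
      assume s: "evals d q (ev e \<sigma> M) s"
      have "M (8 * ev e \<sigma> M + a) = snd q (fst q 1 + (8 * ev e \<sigma> M + a))"
        using Arr.prems by (simp add: rel_def)
      also have "fst q 1 + (8 * ev e \<sigma> M + a) = fst (final (addr d a) s) (tmp d)"
        using s by (simp add: run_defs)
      finally show ?thesis using s by (simp add: run_defs)
    qed
    by simp
next
  case (Sum v b e)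
  \<comment> \<open>After i rounds \<open>tmp d\<close> holds the partial sum,
    \<open>tmp (d + 1)\<close> the saved outer value of v and \<open>tmp (d + 2)\<close> the number
    of remaining rounds. The saved value is put back at the end, which makes evaluation free of side
    effects on variables.\<close>
  define J where "J = (\<lambda>i q'. fst q' 1 = fst q 1 \<and> (\<forall>j<d. fst q' (tmp j) = fst q (tmp j)) \<and>
    snd q' = snd q \<and> (\<forall>u. u \<noteq> v \<longrightarrow> fst q' (2 * u) = fst q (2 * u)) \<and> fst q' (2 * v) = i \<and>
    fst q' (tmp d) = (\<Sum>i<i. ev e (\<sigma>(v := i)) M) \<and> fst q' (tmp (d + 1)) = \<sigma> v \<and>
    fst q' (tmp (d + 2)) = \<sigma> b - i)"
  show ?case unfolding ecomp.simps
    apply (rule runs_Seq[where R="J 0" and Ta=6])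
      apply (rule runs_straight)
    subgoal by (simp add: run_defs)
    subgoal by (simp add: run_defs)
    subgoal using Sum.prems by (auto simp: run_defs J_def)
     apply (rule runs_Seq[where R="J (\<sigma> b)" and Tb=2])
       apply (rule runs_WhileNZ[where I=J and T="\<lambda>i. ecost e (\<sigma>(v := i)) M + 4"])
    subgoal for s' i s
      apply (rule conjI)
      subgoal by (simp add: J_def)
      apply (rule runs_Seq[OF Sum.IH[where \<sigma>="\<sigma>(v := i)"], where Tb=4])
      subgoal using Sum.prems by (auto simp: run_defs J_def)
       apply (rule runs_straight)
      subgoal by (simp add: run_defs)
      subgoal by (simp add: run_defs)
      subgoal by (auto simp: run_defs J_def fun_upd_def)
      by (simp add: fun_upd_def)
    subgoal by (simp add: J_def)
    subgoal by simp
      apply (rule runs_straight)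
    subgoal by (simp add: run_defs)
    subgoal by (simp add: run_defs)
    subgoal for s' s using Sum.prems by (auto simp: run_defs J_def)
     apply (rule order_refl)
    by (simp add: add.commute)
qed

lemma runs_ccomp:
  "rel s q \<Longrightarrow> runs (ccomp c d) q (cost c s) (\<lambda>q'. rel (den c s) q' \<and> keeps d q q')"
proof (induction c arbitrary: s d q)
  case (Assign v e)
  show ?case unfolding ccomp.simps
    apply (rule runs_Seq[OF runs_ecomp[where \<sigma>="fst s" and M="snd s"]])
    subgoal using Assign.prems by simp
     apply (rule runs_straight[where T=2])
    subgoal by (simp add: run_defs)
    subgoal by (simp add: run_defs)
    subgoal using Assign.prems by (auto simp: run_defs setv_def)
    by simp
next
  case (Upd a i e)
  show ?case unfolding ccomp.simps
    apply (rule runs_Seq[OF runs_ecomp[where \<sigma>="fst s" and M="snd s"]])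
    subgoal using Upd.prems by simp
     apply (rule runs_Seq[OF runs_ecomp[where \<sigma>="fst s" and M="snd s"]])
    subgoal using Upd.prems by (simp add: run_defs)
     apply (rule runs_straight[where T=9])
    subgoal by (simp add: run_defs)
    subgoal by (simp add: run_defs)
    subgoal using Upd.prems by (auto simp: run_defs)
     apply (rule order_refl)
    by simp
next
  case (Then c1 c2)
  show ?case unfolding ccomp.simps
    apply (rule runs_Seq[OF Then.IH(1)[OF Then.prems]])
     apply (rule runs_mono[OF Then.IH(2)[where s="den c1 s"]])
    by (auto simp: keeps_def)
next
  case (When e c)
  let ?Q = "\<lambda>q'. rel (den (When e c) s) q' \<and> keeps d q q'" and ?x = "ev e (fst s) (snd s)"
  have "runs (IfNZ (tmp d) (ccomp c d) (Const (tmp d) 0)) q' (2 + (if ?x \<noteq> 0 then cost c s else 0)) ?Q"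
    if q': "evals d q ?x q'" for q'
  proof (rule runs_mono[OF runs_IfNZ[where T="Suc (if ?x \<noteq> 0 then cost c s else 0)"]])
    have r: "rel s q'" using q' When.prems by (auto simp: run_defs)
    show "runs (ccomp c d) q' (Suc (if ?x \<noteq> 0 then cost c s else 0)) ?Q" if "fst q' (tmp d) \<noteq> 0"
      using When.IH[OF r] by (rule runs_mono) (use q' that in \<open>auto simp: run_defs\<close>)
    show "runs (Const (tmp d) 0) q' (Suc (if ?x \<noteq> 0 then cost c s else 0)) ?Q" if "fst q' (tmp d) = 0"
      by (rule runs_straight) (use q' that When.prems in \<open>auto simp: run_defs\<close>)
  qed auto
  note if_runs = this
  show ?case unfolding ccomp.simps
    by (rule runs_Seq[OF runs_ecomp[where \<sigma>="fst s" and M="snd s"] if_runs]) (use When.prems in auto)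
next
  case (For v b c)
  \<comment> \<open>\<open>S i\<close> is the store after i rounds. The round number lives in
    \<open>tmp (Suc d)\<close> and is copied to v at the start of each round, so the body may
    overwrite v and even b.\<close>
  define S where "S = (\<lambda>i. fold (\<lambda>i s. den c (setv v i s)) [0..<i] s)"
  define J where "J = (\<lambda>i q'. rel (S i) q' \<and> keeps d q q' \<and>
    fst q' (tmp d) = fst s b - i \<and> fst q' (tmp (Suc d)) = i)"
  have S: "S (Suc i) = den c (setv v i (S i))" for i by (simp add: S_def)
  show ?case unfolding ccomp.simps
    apply (rule runs_Seq[where R="J 0" and Ta=3])
      apply (rule runs_straight)
    subgoal by (simp add: run_defs)
    subgoal by (simp add: run_defs)
    subgoal using For.prems by (auto simp: run_defs J_def S_def)
     apply (rule runs_mono)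
       apply (rule runs_WhileNZ[where I=J and N="fst s b" and T="\<lambda>i. cost c (setv v i (S i)) + 5"])
    subgoal for s' i q'
      apply (rule conjI)
      subgoal by (simp add: J_def)
      apply (rule runs_Seq[where Ta=2 and Tb="cost c (setv v i (S i)) + 3"
            and R="\<lambda>q'. rel (setv v i (S i)) q' \<and> keeps d q q' \<and>
              fst q' (tmp d) = fst s b - i \<and> fst q' (tmp (Suc d)) = i"])
        apply (rule runs_straight)
      subgoal by (simp add: run_defs)
      subgoal by (simp add: run_defs)
      subgoal by (auto simp: run_defs J_def setv_def)
       apply (rule runs_Seq[OF For.IH[where s="setv v i (S i)"], where Tb=3])
      subgoal by simp
        apply (rule runs_straight)
      subgoal by (simp add: run_defs)
      subgoal by (simp add: run_defs)
      subgoal by (auto simp: run_defs J_def S)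
      by simp_all
    subgoal by (simp add: J_def)
    subgoal by simp
      apply (rule order_refl)
    by (auto simp: J_def S_def add.commute)
qed


section \<open>Static running time bounds\<close>

text \<open>Only these variables may bound sums and loops. As well-formed commands do not assign them, the running
  time is polynomial in their initial values.\<close>

definition size_vars :: "nat set" where
  "size_vars = {0, 2, 3, 4}"

primrec wf_exp :: "exp \<Rightarrow> bool" where
  "wf_exp (Num c) = True"
| "wf_exp (Var v) = True"
| "wf_exp (Plus a b) = (wf_exp a \<and> wf_exp b)"
| "wf_exp (Minus a b) = (wf_exp a \<and> wf_exp b)"
| "wf_exp (Ite c a b) = (wf_exp c \<and> wf_exp a \<and> wf_exp b)"
| "wf_exp (Arr a e) = wf_exp e"
| "wf_exp (Sum v b e) = (v \<notin> size_vars \<and> b \<in> size_vars \<and> wf_exp e)"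

primrec wf_cmd :: "cmd \<Rightarrow> bool" where
  "wf_cmd (Assign v e) = (v \<notin> size_vars \<and> wf_exp e)"
| "wf_cmd (Upd a i e) = (wf_exp i \<and> wf_exp e)"
| "wf_cmd (c ;; d) = (wf_cmd c \<and> wf_cmd d)"
| "wf_cmd (When e c) = (wf_exp e \<and> wf_cmd c)"
| "wf_cmd (For v b c) = (v \<notin> size_vars \<and> b \<in> size_vars \<and> wf_cmd c)"

definition sizes_le :: "(nat \<Rightarrow> nat) \<Rightarrow> nat \<Rightarrow> bool" where
  "sizes_le \<sigma> W \<longleftrightarrow> (\<forall>b\<in>size_vars. \<sigma> b \<le> W)"

lemma poly_weaken: "x \<le> K * (W + 1) ^ d \<Longrightarrow> K \<le> K' \<Longrightarrow> d \<le> d' \<Longrightarrow> x \<le> K' * (W + 1) ^ d'"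
  for x :: nat
  by (meson le_add2 le_trans mult_le_mono power_increasing)

lemma poly_add:
  fixes x y :: nat
  assumes "x \<le> K * (W + 1) ^ d" "y \<le> K' * (W + 1) ^ d'"
  shows "x + y \<le> (K + K') * (W + 1) ^ (d + d')"
  using poly_weaken[OF assms(1), of K "d + d'"] poly_weaken[OF assms(2), of K' "d + d'"]
  by (simp add: distrib_right)

lemma poly_sum:
  fixes f :: "nat \<Rightarrow> nat"
  assumes "\<And>i. i < N \<Longrightarrow> f i \<le> K * (W + 1) ^ d" "N \<le> W"
  shows "c + (\<Sum>i<N. f i + k) \<le> (c + K + k) * (W + 1) ^ (d + 1)"
proof -
  have "f i + k \<le> (K + k) * (W + 1) ^ d" if "i < N" for i
    using poly_add[OF assms(1)[OF that], of k k 0] by simp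
  then have "(\<Sum>i<N. f i + k) \<le> N * ((K + k) * (W + 1) ^ d)"
    using sum_bounded_above[of "{..<N}" "\<lambda>i. f i + k"] by simp
  also have "\<dots> \<le> (W + 1) * ((K + k) * (W + 1) ^ d)" using assms(2) by (intro mult_right_mono) auto
  also have "\<dots> = (K + k) * (W + 1) ^ (d + 1)" by (simp add: algebra_simps)
  finally have 1: "(\<Sum>i<N. f i + k) \<le> (K + k) * (W + 1) ^ (d + 1)" .
  have "c * 1 \<le> c * (W + 1) ^ (d + 1)" by (intro mult_le_mono) (rule order_refl, rule one_le_power, simp)
  moreover have "(c + K + k) * (W + 1) ^ (d + 1) = c * (W + 1) ^ (d + 1) + (K + k) * (W + 1) ^ (d + 1)"
    by (simp only: distrib_right add.assoc)
  ultimately show ?thesis using 1 by linarith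
qed

lemma ecost_poly:
  "wf_exp e \<Longrightarrow> \<exists>K d. \<forall>\<sigma> M W. sizes_le \<sigma> W \<longrightarrow> ecost e \<sigma> M \<le> K * (W + 1) ^ d"
proof (induction e)
  case (Num c)
  show ?case by (intro exI[of _ 1] exI[of _ 0]) auto
next
  case (Var v)
  show ?case by (intro exI[of _ 2] exI[of _ 0]) auto
next
  case (Plus a b)
  then obtain K d K' d' where
    "\<forall>\<sigma> M W. sizes_le \<sigma> W \<longrightarrow> ecost a \<sigma> M \<le> K * (W + 1) ^ d"
    "\<forall>\<sigma> M W. sizes_le \<sigma> W \<longrightarrow> ecost b \<sigma> M \<le> K' * (W + 1) ^ d'" by auto
  then have "\<forall>\<sigma> M W. sizes_le \<sigma> W \<longrightarrow> ecost (Plus a b) \<sigma> M \<le> (K + K' + 1) * (W + 1) ^ (d + d' + 0)"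
    unfolding ecost.simps by (intro allI impI poly_add) auto
  then show ?case by blast
next
  case (Minus a b)
  then obtain K d K' d' where
    "\<forall>\<sigma> M W. sizes_le \<sigma> W \<longrightarrow> ecost a \<sigma> M \<le> K * (W + 1) ^ d"
    "\<forall>\<sigma> M W. sizes_le \<sigma> W \<longrightarrow> ecost b \<sigma> M \<le> K' * (W + 1) ^ d'" by auto
  then have "\<forall>\<sigma> M W. sizes_le \<sigma> W \<longrightarrow> ecost (Minus a b) \<sigma> M \<le> (K + K' + 1) * (W + 1) ^ (d + d' + 0)"
    unfolding ecost.simps by (intro allI impI poly_add) auto
  then show ?case by blast
next
  case (Ite c a b)
  then obtain K d K' d' K'' d'' where
    "\<forall>\<sigma> M W. sizes_le \<sigma> W \<longrightarrow> ecost c \<sigma> M \<le> K * (W + 1) ^ d"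
    "\<forall>\<sigma> M W. sizes_le \<sigma> W \<longrightarrow> ecost a \<sigma> M \<le> K' * (W + 1) ^ d'"
    "\<forall>\<sigma> M W. sizes_le \<sigma> W \<longrightarrow> ecost b \<sigma> M \<le> K'' * (W + 1) ^ d''" by (auto 4 3)
  then have "\<forall>\<sigma> M W. sizes_le \<sigma> W \<longrightarrow>
      ecost (Ite c a b) \<sigma> M \<le> (K + K' + K'' + 1) * (W + 1) ^ (d + d' + d'' + 0)"
    unfolding ecost.simps by (intro allI impI poly_add) auto
  then show ?case by blast
next
  case (Arr a e)
  then obtain K d where "\<forall>\<sigma> M W. sizes_le \<sigma> W \<longrightarrow> ecost e \<sigma> M \<le> K * (W + 1) ^ d" by auto
  then have "\<forall>\<sigma> M W. sizes_le \<sigma> W \<longrightarrow> ecost (Arr a e) \<sigma> M \<le> (K + 7) * (W + 1) ^ (d + 0)"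
    unfolding ecost.simps by (intro allI impI poly_add) auto
  then show ?case by blast
next
  case (Sum v b e)
  then obtain K d where 1: "\<forall>\<sigma> M W. sizes_le \<sigma> W \<longrightarrow> ecost e \<sigma> M \<le> K * (W + 1) ^ d" by auto
  have "sizes_le (\<sigma>(v := i)) W" if "sizes_le \<sigma> W" for \<sigma> W i
    using that Sum.prems by (auto simp: sizes_le_def)
  then have "\<forall>\<sigma> M W. sizes_le \<sigma> W \<longrightarrow> ecost (Sum v b e) \<sigma> M \<le> (9 + K + 5) * (W + 1) ^ (d + 1)"
    unfolding ecost.simps using 1 Sum.prems
    by (intro allI impI poly_sum) (auto simp: sizes_le_def)
  then show ?case by blast
qed

lemma den_size_vars: "wf_cmd c \<Longrightarrow> b \<in> size_vars \<Longrightarrow> fst (den c s) b = fst s b"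
proof (induction c arbitrary: s)
  case (For v b' c)
  have "fst (fold (\<lambda>i s. den c (setv v i s)) xs s) b = fst s b" for xs
    using For by (induction xs arbitrary: s) (auto simp: setv_def)
  then show ?case by simp
qed (auto simp: setv_def)

lemma den_sizes_le: "wf_cmd c \<Longrightarrow> sizes_le (fst (den c s)) W \<longleftrightarrow> sizes_le (fst s) W"
  by (simp add: sizes_le_def den_size_vars)

lemma cost_poly:
  "wf_cmd c \<Longrightarrow> \<exists>K d. \<forall>s W. sizes_le (fst s) W \<longrightarrow> cost c s \<le> K * (W + 1) ^ d"
proof (induction c)
  case (Assign v e)
  then obtain K d where "\<forall>\<sigma> M W. sizes_le \<sigma> W \<longrightarrow> ecost e \<sigma> M \<le> K * (W + 1) ^ d"
    using ecost_poly[of e] by auto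
  then have "\<forall>s W. sizes_le (fst s) W \<longrightarrow> cost (Assign v e) s \<le> (K + 2) * (W + 1) ^ (d + 0)"
    unfolding cost.simps by (intro allI impI poly_add) auto
  then show ?case by blast
next
  case (Upd a i e)
  then obtain K d K' d' where
    "\<forall>\<sigma> M W. sizes_le \<sigma> W \<longrightarrow> ecost i \<sigma> M \<le> K * (W + 1) ^ d"
    "\<forall>\<sigma> M W. sizes_le \<sigma> W \<longrightarrow> ecost e \<sigma> M \<le> K' * (W + 1) ^ d'"
    using ecost_poly[of i] ecost_poly[of e] by auto
  then have "\<forall>s W. sizes_le (fst s) W \<longrightarrow> cost (Upd a i e) s \<le> (K + K' + 9) * (W + 1) ^ (d + d' + 0)"
    unfolding cost.simps by (intro allI impI poly_add) auto
  then show ?case by blast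
next
  case (Then c1 c2)
  then obtain K d K' d' where
    "\<forall>s W. sizes_le (fst s) W \<longrightarrow> cost c1 s \<le> K * (W + 1) ^ d"
    "\<forall>s W. sizes_le (fst s) W \<longrightarrow> cost c2 s \<le> K' * (W + 1) ^ d'" by auto
  then have "\<forall>s W. sizes_le (fst s) W \<longrightarrow> cost (c1 ;; c2) s \<le> (K + K') * (W + 1) ^ (d + d')"
    unfolding cost.simps using Then.prems den_sizes_le
    by (intro allI impI poly_add) (auto simp del: split_paired_All)
  then show ?case by blast
next
  case (When e c)
  then obtain K d K' d' where
    1: "\<forall>\<sigma> M W. sizes_le \<sigma> W \<longrightarrow> ecost e \<sigma> M \<le> K * (W + 1) ^ d" and
    2: "\<forall>s W. sizes_le (fst s) W \<longrightarrow> cost c s \<le> K' * (W + 1) ^ d'"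
    using ecost_poly[of e] by auto
  have "\<forall>s W. sizes_le (fst s) W \<longrightarrow> cost (When e c) s \<le> (K + 2 + K') * (W + 1) ^ (d + 0 + d')"
    unfolding cost.simps by (intro allI impI poly_add) (use 1 2 in auto)
  then show ?case by blast
next
  case (For v b c)
  then obtain K d where 1: "\<forall>s W. sizes_le (fst s) W \<longrightarrow> cost c s \<le> K * (W + 1) ^ d" by auto
  have setv: "sizes_le (fst (setv v i s)) W = sizes_le (fst s) W" for s i W
    using For.prems by (auto simp: sizes_le_def setv_def)
  have fold: "sizes_le (fst (fold (\<lambda>i s. den c (setv v i s)) xs s)) W = sizes_le (fst s) W" for xs s W
    using For.prems by (induction xs arbitrary: s) (auto simp: den_sizes_le setv)
  have "cost c (setv v i (fold (\<lambda>i s. den c (setv v i s)) [0..<i] s)) \<le> K * (W + 1) ^ d"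
    if "sizes_le (fst s) W" for s W i
    using that by (intro 1[rule_format]) (simp only: setv fold)
  then have "\<forall>s W. sizes_le (fst s) W \<longrightarrow> cost (For v b c) s \<le> (4 + K + 6) * (W + 1) ^ (d + 1)"
    unfolding cost.simps using For.prems
    by (intro allI impI poly_sum) (auto simp: sizes_le_def)
  then show ?case by blast
qed

section \<open>Graphs as relations\<close>

lemma sum_swap_rel:
  fixes R :: "'a \<Rightarrow> 'b \<Rightarrow> bool"
  assumes "finite A" "finite B"
  shows "(\<Sum>a\<in>A. card {b\<in>B. R a b}) = (\<Sum>b\<in>B. card {a\<in>A. R a b})"
proof -
  have "card {b\<in>B. R a b} = (\<Sum>b\<in>B. if R a b then 1 else 0)" for a
    using assms by (simp add: sum.If_cases Int_def)
  moreover have "card {a\<in>A. R a b} = (\<Sum>a\<in>A. if R a b then 1 else 0)" for b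
    using assms by (simp add: sum.If_cases Int_def)
  ultimately show ?thesis using sum.swap by simp
qed

definition deg :: "nat \<Rightarrow> (nat \<Rightarrow> nat \<Rightarrow> bool) \<Rightarrow> nat \<Rightarrow> nat" where
  "deg n R v = card {u. u < n \<and> R v u}"

text \<open>Each edge of a symmetric irreflexive R is counted at both ends. This is why edge counts
  are always compared with \<open>2 * k\<close>.\<close>

definition total :: "nat \<Rightarrow> (nat \<Rightarrow> nat \<Rightarrow> bool) \<Rightarrow> nat" where
  "total n R = (\<Sum>v<n. deg n R v)"

definition rel_graph :: "nat \<Rightarrow> (nat \<Rightarrow> nat \<Rightarrow> bool) \<Rightarrow> nat graph" where
  "rel_graph n R = ({0..<n}, {{u, v} |u v. u < n \<and> v < n \<and> R u v})"

definition adj :: "nat graph \<Rightarrow> nat \<Rightarrow> nat \<Rightarrow> bool" where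
  "adj G u v \<longleftrightarrow> {u, v} \<in> edges G"

definition star_free :: "nat \<Rightarrow> nat \<Rightarrow> (nat \<Rightarrow> nat \<Rightarrow> bool) \<Rightarrow> (nat \<Rightarrow> nat \<Rightarrow> bool) \<Rightarrow> bool" where
  "star_free t n E R \<longleftrightarrow> \<not> (\<exists>v<n. \<exists>U\<subseteq>{..<n}. card U = t \<and> (\<forall>u\<in>U. R v u) \<and>
     (\<forall>u\<in>U. \<forall>w\<in>U. \<not> E u w))"

definition local_opt :: "nat \<Rightarrow> (nat \<Rightarrow> nat \<Rightarrow> bool) \<Rightarrow> (nat \<Rightarrow> nat \<Rightarrow> bool) \<Rightarrow> bool" where
  "local_opt n E R \<longleftrightarrow>
     (\<forall>a<n. \<forall>b<n. E a b \<and> deg n R a \<le> 1 \<and> deg n R b \<le> 1 \<longrightarrow> R a b) \<and>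
     (\<forall>a<n. \<forall>b<n. \<forall>c<n. \<forall>d<n. \<not> (R a b \<and> c \<noteq> d \<and> deg n R c = 0 \<and> deg n R d = 0 \<and> E a c \<and> E b d))"

lemma card_rel_graph:
  assumes R: "\<And>u v. R u v \<Longrightarrow> R v u" "\<And>u. \<not> R u u"
  shows "2 * card (edges (rel_graph n R)) = total n R"
proof -
  let ?E = "edges (rel_graph n R)"
  have fin: "finite ?E"
    by (rule finite_subset[of _ "Pow {..<n}"]) (auto simp: rel_graph_def)
  have "total n R = (\<Sum>v<n. card {e \<in> ?E. v \<in> e})"
    unfolding total_def
  proof (rule sum.cong)
    fix v assume v: "v \<in> {..<n}"
    have "bij_betw (\<lambda>u. {v, u}) {u. u < n \<and> R v u} {e \<in> ?E. v \<in> e}"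
    proof (rule bij_betw_imageI)
      show "inj_on (\<lambda>u. {v, u}) {u. u < n \<and> R v u}" by (auto simp: inj_on_def doubleton_eq_iff)
      show "(\<lambda>u. {v, u}) ` {u. u < n \<and> R v u} = {e \<in> ?E. v \<in> e}"
        using v R(1) by (fastforce simp: rel_graph_def image_iff insert_commute)
    qed
    then show "deg n R v = card {e \<in> ?E. v \<in> e}" unfolding deg_def by (rule bij_betw_same_card)
  qed simp
  also have "\<dots> = (\<Sum>e\<in>?E. card {v \<in> {..<n}. v \<in> e})"
    by (rule sum_swap_rel) (use fin in auto)
  also have "\<dots> = (\<Sum>e\<in>?E. 2)"
  proof (rule sum.cong)
    fix e assume "e \<in> ?E"
    then obtain u v where e: "e = {u, v}" "u < n" "v < n" "R u v" by (auto simp: rel_graph_def)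
    then have "u \<noteq> v" using R(2) by auto
    moreover have "{v \<in> {..<n}. v \<in> e} = {u, v}" using e by auto
    ultimately show "card {v \<in> {..<n}. v \<in> e} = 2" by simp
  qed simp
  finally show ?thesis by simp
qed

lemma induced_star_iff:
  assumes t: "t \<ge> 2" and S: "finite S" and irr: "\<forall>e\<in>edges G. card e = 2"
  shows "isomorphic (induced G S) (star t) \<longleftrightarrow>
    (\<exists>v U. S = insert v U \<and> v \<notin> U \<and> card U = t \<and> (\<forall>u\<in>U. {v, u} \<in> edges G) \<and>
      (\<forall>u\<in>U. \<forall>w\<in>U. {u, w} \<notin> edges G))" (is "?L \<longleftrightarrow> ?R")
proof
  assume ?L
  then obtain f where f: "bij_betw f S {0..t}" and
    e: "\<And>u v. u \<in> S \<Longrightarrow> v \<in> S \<Longrightarrow> {u, v} \<in> edges G \<longleftrightarrow> {f u, f v} \<in> edges (star t)"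
    unfolding isomorphic_def induced_def star_def by auto
  obtain v where v: "v \<in> S" "f v = 0" using f by (metis atLeastAtMost_iff bij_betw_imp_surj_on imageE le0)
  define U where "U = S - {v}"
  have inj: "inj_on f S" using f by (rule bij_betw_imp_inj_on)
  have fU: "f u \<in> {1..t}" if "u \<in> U" for u
  proof -
    have "f u \<noteq> 0" using that v inj unfolding U_def by (metis DiffD1 DiffD2 inj_onD singletonI)
    moreover have "f u \<le> t" using f that unfolding U_def bij_betw_def by auto
    ultimately show ?thesis by auto
  qed
  have "card S = t + 1" using bij_betw_same_card[OF f] by simp
  then have "card U = t" using v S by (simp add: U_def)
  moreover have "{v, u} \<in> edges G" if "u \<in> U" for u
    using e[of v u] v that fU[OF that] by (auto simp: U_def star_def)
  moreover have "{u, w} \<notin> edges G" if "u \<in> U" "w \<in> U" for u w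
    using e[of u w] that fU[OF that(1)] fU[OF that(2)] by (auto simp: U_def star_def doubleton_eq_iff)
  ultimately show ?R using v by (intro exI[of _ v] exI[of _ U]) (auto simp: U_def)
next
  assume ?R
  then obtain v U where U: "S = insert v U" "v \<notin> U" "card U = t" "\<And>u. u \<in> U \<Longrightarrow> {v, u} \<in> edges G"
     "\<And>u w. u \<in> U \<Longrightarrow> w \<in> U \<Longrightarrow> {u, w} \<notin> edges G" by blast
  obtain g where g: "bij_betw g U {1..t}"
    using U S by (metis card_atLeastAtMost diff_Suc_1 finite_atLeastAtMost finite_insert finite_same_card_bij)
  define f where "f = g(v := 0)"
  have fU: "f u = g u" "g u \<in> {1..t}" if "u \<in> U" for u
    using that U(2) g unfolding f_def bij_betw_def by auto
  have "bij_betw f U {1..t}" using g U(2) by (subst bij_betw_cong[of _ _ g]) (auto simp: f_def)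
  then have "bij_betw f S (insert 0 {1..t})"
    unfolding U(1) using U(2) bij_betw_combine[of f U "{1..t}" "{v}" "{0}"]
    by (simp add: f_def bij_betw_def)
  moreover have "insert 0 {1..t} = {0..t}" by auto
  moreover have "{u, w} \<in> edges G \<longleftrightarrow> {f u, f w} \<in> edges (star t)" if uw: "u \<in> S" "w \<in> S" for u w
  proof -
    have no: "{v} \<notin> edges G" using irr by auto
    have "f v = 0" by (simp add: f_def)
    have f0: "g x \<noteq> 0" "g x \<le> t" "f x = g x" if "x \<in> U" for x using fU[OF that] by auto
    have star: "{x, y} \<in> edges (star t) \<longleftrightarrow> x = 0 \<and> 0 < y \<and> y \<le> t \<or> y = 0 \<and> 0 < x \<and> x \<le> t" for x y
      by (auto simp: star_def doubleton_eq_iff)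
    consider "u = v" "w = v" | "u = v" "w \<in> U" | "u \<in> U" "w = v" | "u \<in> U" "w \<in> U"
      using uw U(1) by auto
    then show ?thesis
    proof cases
      case 1
      then show ?thesis using no \<open>f v = 0\<close> star[of 0 0] by simp
    next
      case 2
      then show ?thesis using U(4) f0[of w] \<open>f v = 0\<close> by (simp add: star)
    next
      case 3
      then show ?thesis using U(4) f0[of u] \<open>f v = 0\<close> by (simp add: star insert_commute)
    next
      case 4
      then show ?thesis using U(5) f0[of u] f0[of w] by (simp add: star)
    qed
  qed
  ultimately show ?L unfolding isomorphic_def induced_def star_def
    by (auto intro!: exI[of _ f])
qed

text \<open>A set that induces a star in both graphs has the same centre in both. Otherwise, as t is
  at least 2, the star of R has a leaf u other than the centre in G; then u and the centre v of the
  star of R are both leaves in G, hence not adjacent there, although \<open>R v u\<close> is an edge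
  of G. So a violation is a vertex with t neighbours in R that are independent in G.\<close>

lemma closure_iff:
  assumes G: "simple_graph G" and t: "t \<ge> 2"
    and R: "\<And>u v. R u v \<Longrightarrow> R v u" "\<And>u v. R u v \<Longrightarrow> adj G u v"
  shows "satisfies_closure (star t) G (rel_graph n R) \<longleftrightarrow> star_free t n (adj G) R"
proof -
  have c2: "\<forall>e\<in>edges G. card e = 2" using G by (auto simp: simple_graph_def)
  have cR: "\<forall>e\<in>edges (rel_graph n R). card e = 2"
    using R(2) c2 by (auto simp: rel_graph_def adj_def)
  have eR: "{u, v} \<in> edges (rel_graph n R) \<longleftrightarrow> u < n \<and> v < n \<and> R u v" for u v
    using R(1) by (auto simp: rel_graph_def doubleton_eq_iff)
  have vR: "verts (rel_graph n R) = {0..<n}" by (simp add: rel_graph_def)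
  show ?thesis
  proof
    assume L: "satisfies_closure (star t) G (rel_graph n R)"
    show "star_free t n (adj G) R" unfolding star_free_def
    proof (intro notI, elim exE conjE)
      fix v U assume v: "v < n" "U \<subseteq> {..<n}" "card U = t" "\<forall>u\<in>U. R v u" "\<forall>u\<in>U. \<forall>w\<in>U. \<not> adj G u w"
      have fin: "finite (insert v U)" using v(2) finite_subset[of U "{..<n}"] by simp
      have "v \<notin> U" using v(4) R(2)[of v v] bspec[OF c2, of "{v}"] by (auto simp: adj_def)
      then have "isomorphic (induced (rel_graph n R) (insert v U)) (star t)"
        unfolding induced_star_iff[OF t fin cR] using v R(2) \<open>v \<notin> U\<close>
        by (intro exI[of _ v] exI[of _ U]) (auto simp: eR subset_iff, blast)
      moreover have "isomorphic (induced G (insert v U)) (star t)"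
        unfolding induced_star_iff[OF t fin c2] using v R(2) \<open>v \<notin> U\<close>
        by (intro exI[of _ v] exI[of _ U]) (auto simp: adj_def)
      moreover have "insert v U \<subseteq> verts (rel_graph n R)" using v by (auto simp: vR)
      ultimately show False using L unfolding satisfies_closure_def by blast
    qed
  next
    assume f: "star_free t n (adj G) R"
    show "satisfies_closure (star t) G (rel_graph n R)" unfolding satisfies_closure_def
    proof (intro allI impI notI)
      fix S assume S: "S \<subseteq> verts (rel_graph n R)" and i1: "isomorphic (induced (rel_graph n R) S) (star t)"
        and i2: "isomorphic (induced G S) (star t)"
      have fin: "finite S" using S by (auto simp: vR intro: finite_subset)
      obtain v U where 1: "S = insert v U" "v \<notin> U" "card U = t" "\<And>u. u \<in> U \<Longrightarrow> R v u"
        using i1 induced_star_iff[OF t fin cR] by (auto simp: eR)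
      obtain v' U' where 2: "S = insert v' U'" "v' \<notin> U'" "card U' = t" "\<And>u. u \<in> U' \<Longrightarrow> {v', u} \<in> edges G"
         "\<And>u w. u \<in> U' \<Longrightarrow> w \<in> U' \<Longrightarrow> {u, w} \<notin> edges G" using i2 induced_star_iff[OF t fin c2] by auto
      have "v = v'"
      proof (rule ccontr)
        assume "v \<noteq> v'"
        have "card (U - {v'}) \<ge> 1" using 1 t card_Diff_subset[of "{v'}" U] by (auto simp: card_Diff_singleton_if)
        then obtain u where u: "u \<in> U" "u \<noteq> v'" by (metis DiffE card.empty ex_in_conv not_one_le_zero singletonI)
        then have "u \<in> U'" "v \<in> U'" using 1 2 \<open>v \<noteq> v'\<close> by auto
        then show False using 1(4)[OF u(1)] R(2) 2(5) by (auto simp: adj_def)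
      qed
      then have "insert v U = insert v U'" "v \<notin> U'" using 1(1) 2(1,2) by simp_all
      then have "U = U'" using 1(2) by (simp add: insert_ident)
      then have "\<forall>u\<in>U. \<forall>w\<in>U. \<not> adj G u w" using 2(5) by (auto simp: adj_def)
      moreover have "v < n" "U \<subseteq> {..<n}" using S 1(1) by (auto simp: vR)
      ultimately show False using f 1(3,4) unfolding star_free_def by blast
    qed
  qed
qed

text \<open>Here \<open>p\<close> is the partner function of a matching that covers \<open>B\<close>. A covered vertex of degree 0 is
  charged to its partner, which has degree 2; the set \<open>F\<close> of vertices charged in this way is independent
  by the second part of local optimality.\<close>

lemma local_opt_bound:
  assumes E: "\<And>u v. E u v \<Longrightarrow> E v u" 
    and R: "\<And>u v. R u v \<Longrightarrow> R v u" "\<And>u. \<not> R u u" and d2: "\<And>v. v < n \<Longrightarrow> deg n R v \<le> 2"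
    and opt: "local_opt n E R"
    and B: "B \<subseteq> {..<n}" and pr: "\<And>v. v \<in> B \<Longrightarrow> p v \<in> B \<and> p (p v) = v \<and> p v \<noteq> v \<and> E v (p v)"
  shows "card {v. v < n \<and> deg n R v = 2} * 2 + 5 * card B \<le> 5 * total n R"
proof -
  define X where "X = {v. v < n \<and> deg n R v = 2}"
  define D1 where "D1 = {v. v < n \<and> deg n R v = 1}"
  define D0 where "D0 = {v. v < n \<and> deg n R v = 0}"
  define F where "F = {v \<in> X \<inter> B. p v \<in> D0}"
  define Z where "Z = X - F"
  define Y where "Y = {y\<in>D1. \<exists>f\<in>F. R f y}"
  have fin: "finite X" "finite D1" "finite D0" "finite F" "finite Z" "finite Y" "finite B"
    using B by (auto simp: X_def D1_def D0_def F_def Z_def Y_def intro: finite_subset)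
  have un: "{..<n} = X \<union> D1 \<union> D0" unfolding X_def D1_def D0_def using d2 by force
  have dis: "X \<inter> D1 = {}" "X \<inter> D0 = {}" "D1 \<inter> D0 = {}" unfolding X_def D1_def D0_def by auto
  have optA: "R a b" if "E a b" "a \<in> D1 \<union> D0" "b \<in> D1 \<union> D0" for a b
    using opt that unfolding local_opt_def D1_def D0_def by auto
  have tot: "total n R = 2 * card X + card D1"
  proof -
    have "total n R = (\<Sum>v\<in>X. deg n R v) + (\<Sum>v\<in>D1. deg n R v) + (\<Sum>v\<in>D0. deg n R v)"
      unfolding total_def un using fin dis by (subst sum.union_disjoint; auto)+
    also have "\<dots> = 2 * card X + card D1" by (simp add: X_def D1_def D0_def)
    finally show ?thesis .
  qed
  have D0: "\<not> R a b" "\<not> R b a" if "a \<in> D0" "b < n" for a b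
    using that R(1) by (auto simp: D0_def deg_def)
  have pD0: "p d \<in> F" if "d \<in> D0 \<inter> B" for d
  proof -
    have b: "p d \<in> B" "p (p d) = d" "E d (p d)" using pr that by auto
    moreover have "p d \<in> X"
    proof (rule ccontr)
      assume "p d \<notin> X"
      then have "p d \<in> D1 \<union> D0" using un b B by blast
      then have "R d (p d)" using optA b that by blast
      then show False using D0(1)[of d "p d"] that b B by auto
    qed
    ultimately show ?thesis using that unfolding F_def by auto
  qed
  have c0: "card (D0 \<inter> B) \<le> card F"
  proof (rule card_inj_on_le[where f=p])
    show "inj_on p (D0 \<inter> B)" by (rule inj_on_inverseI[where g=p]) (use pr in auto)
  qed (use pD0 fin in auto)
  define U where "U = D1 - B"
  have cB: "card B \<le> card X + card (D1 \<inter> B) + card (D0 \<inter> B)"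
  proof -
    have "B \<subseteq> X \<union> (D1 \<inter> B) \<union> (D0 \<inter> B)" using un B by auto
    then have "card B \<le> card (X \<union> (D1 \<inter> B) \<union> (D0 \<inter> B))" using fin by (intro card_mono) auto
    then show ?thesis using card_Un_le[of "X \<union> (D1 \<inter> B)" "D0 \<inter> B"] card_Un_le[of X "D1 \<inter> B"] by linarith
  qed
  have cD1: "card D1 = card (D1 \<inter> B) + card U"
    using fin card_Int_Diff[of D1 B] unfolding U_def by simp
  have cX: "card X = card F + card Z"
    unfolding Z_def using card_Diff_subset[of F X] card_mono[of X F] fin by (auto simp: F_def)
  \<comment> \<open>If two vertices of F were joined by R, the edge could be replaced by edges to
    their partners, which are distinct and isolated; \<open>local_opt\<close> excludes this.
    Isolated vertices are no neighbours, so only Z and Y remain.\<close>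
  have nbr: "{u. u < n \<and> R f u} \<subseteq> Z \<union> Y" if f: "f \<in> F" for f
  proof
    fix u assume u: "u \<in> {u. u < n \<and> R f u}"
    have "u \<notin> F"
    proof
      assume uF: "u \<in> F"
      have "p f \<noteq> p u" using pr f uF u R(2) unfolding F_def by (metis (mono_tags, lifting) IntE mem_Collect_eq)
      moreover have "E f (p f)" "E u (p u)" "p f \<in> D0" "p u \<in> D0" using f uF pr unfolding F_def by auto
      moreover have "f < n" "u < n" using f u unfolding F_def X_def by auto
      ultimately show False using opt u unfolding local_opt_def D0_def by blast
    qed
    moreover have "u \<notin> D0" using D0 u f by (auto simp: F_def X_def)
    ultimately show "u \<in> Z \<union> Y" using un u f unfolding Z_def Y_def by auto
  qed
  \<comment> \<open>The R-edges leaving F are counted at both ends: every vertex of F sends 2, a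
    vertex of Z receives at most 2 and a vertex of Y at most 1.\<close>
  have "2 * card F = (\<Sum>f\<in>F. card {u\<in>Z \<union> Y. R f u})"
  proof -
    have "card {u\<in>Z \<union> Y. R f u} = 2" if "f \<in> F" for f
    proof -
      have "{u\<in>Z \<union> Y. R f u} = {u. u < n \<and> R f u}"
        using nbr[OF that] unfolding Z_def Y_def X_def D1_def by auto
      then show ?thesis using that by (simp add: F_def X_def deg_def)
    qed
    then show ?thesis by simp
  qed
  also have "\<dots> = (\<Sum>u\<in>Z \<union> Y. card {f\<in>F. R f u})" by (rule sum_swap_rel) (use fin in auto)
  also have "\<dots> \<le> (\<Sum>u\<in>Z \<union> Y. deg n R u)"
    unfolding deg_def by (rule sum_mono, rule card_mono) (use R in \<open>auto simp: F_def X_def\<close>)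
  also have "\<dots> = (\<Sum>u\<in>Z. deg n R u) + (\<Sum>u\<in>Y. deg n R u)"
    by (rule sum.union_disjoint) (use fin dis in \<open>auto simp: Z_def Y_def\<close>)
  also have "\<dots> = 2 * card Z + card Y" by (simp add: Z_def X_def Y_def D1_def)
  finally have cF: "2 * card F \<le> 2 * card Z + card Y" .
  \<comment> \<open>The only R-edge of y goes to F. If the partner of y were not heavy,
    \<open>optA\<close> would force a second R-edge at y. The partner is not in F either, because
    its own partner y is not isolated.\<close>
  have "Y \<inter> B \<subseteq> {y. p y \<in> Z}"
  proof
    fix y assume y: "y \<in> Y \<inter> B"
    then obtain f where f: "f \<in> F" "R f y" by (auto simp: Y_def)
    have b: "p y \<in> B" "p (p y) = y" "E y (p y)" using pr y by auto
    have "p y \<in> X"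
    proof (rule ccontr)
      assume "p y \<notin> X"
      then have "p y \<in> D1 \<union> D0" using un b B by blast
      then have 1: "R y (p y)" using optA b y by (auto simp: Y_def)
      have 2: "R y f" using f R by auto
      have "f < n" "p y < n" "f \<noteq> p y" using f b B \<open>p y \<notin> X\<close> by (auto simp: F_def X_def)
      then have "card {f, p y} \<le> deg n R y" unfolding deg_def using 1 2 by (intro card_mono) auto
      then show False using y \<open>f \<noteq> p y\<close> by (simp add: Y_def D1_def)
    qed
    moreover have "p y \<notin> F" using b y dis by (auto simp: F_def Y_def)
    ultimately show "y \<in> {y. p y \<in> Z}" by (simp add: Z_def)
  qed
  then have "card (Y \<inter> B) \<le> card Z"
    by (intro card_inj_on_le[where f=p]) (use pr fin in \<open>auto intro!: inj_on_inverseI[where g=p]\<close>)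
  moreover have "card Y \<le> card (Y \<inter> B) + card U"
    using card_Int_Diff[of Y B] fin card_mono[of U "Y - B"] by (auto simp: U_def Y_def)
  \<comment> \<open>Origin of the 5: the bounds give
    \<open>total n R - card B \<ge> card Z + card U\<close>, whereas \<open>2 * card F \<le> 2 *
    card Z + card Y \<le> 3 * card Z + card U\<close>, so that
    \<open>2 * card X \<le> 5 * card Z + card U\<close>.\<close>
  ultimately have "card X * 2 + 5 * card B \<le> 5 * total n R"
    using tot c0 cB cD1 cX cF by linarith
  then show ?thesis unfolding X_def .
qed


section \<open>Exchanging components outside the heavy vertices\<close>

definition sym_sub :: "(nat \<Rightarrow> nat \<Rightarrow> bool) \<Rightarrow> (nat \<Rightarrow> nat \<Rightarrow> bool) \<Rightarrow> bool" where
  "sym_sub E R \<longleftrightarrow> (\<forall>u v. R u v \<longrightarrow> R v u \<and> E u v)"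

text \<open>No assumptions are made here, so that the expressions of the program can be identified
  with these notions for an arbitrary memory content. The assumptions follow in
  \<open>near_matching\<close>.\<close>

locale marked_graph =
  fixes n :: nat and E :: "nat \<Rightarrow> nat \<Rightarrow> bool" and X :: "nat set"
begin

definition mate :: "nat \<Rightarrow> nat \<Rightarrow> bool" where
  "mate u m \<longleftrightarrow> u \<notin> X \<and> m \<notin> X \<and> E u m"

text \<open>Under \<open>near_matching\<close> a component outside X is a vertex or an edge; its
  smaller vertex represents it.\<close>

definition first :: "nat \<Rightarrow> bool" where
  "first a \<longleftrightarrow> a < n \<and> a \<notin> X \<and> \<not> (\<exists>m<a. mate a m)"

text \<open>Equality of types as ordered pairs: first vertex is compared with first vertex and mate
  with mate, in accordance with the layers of a certificate.\<close>

definition same :: "nat \<Rightarrow> nat \<Rightarrow> bool" where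
  "same a b \<longleftrightarrow> (\<forall>x\<in>X. E a x \<longleftrightarrow> E b x) \<and>
     (\<forall>x\<in>X. (\<exists>m. mate a m \<and> E m x) \<longleftrightarrow> (\<exists>m. mate b m \<and> E m x)) \<and>
     ((\<exists>m. mate a m) \<longleftrightarrow> (\<exists>m. mate b m))"

definition touched :: "(nat \<Rightarrow> nat \<Rightarrow> bool) \<Rightarrow> nat \<Rightarrow> bool" where
  "touched R a \<longleftrightarrow> (\<exists>w. (w = a \<or> mate a w) \<and> (\<exists>x\<in>X. R w x))"

definition heads :: "(nat \<Rightarrow> nat \<Rightarrow> bool) \<Rightarrow> nat set" where
  "heads R = {a. first a \<and> touched R a}"

end

locale near_matching = marked_graph +
  assumes E_sym: "E u v \<Longrightarrow> E v u" and E_irrefl: "\<not> E u u" and E_less: "E u v \<Longrightarrow> u < n"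
    and X_less: "x \<in> X \<Longrightarrow> x < n"
    and E_unique: "u \<notin> X \<Longrightarrow> v \<notin> X \<Longrightarrow> w \<notin> X \<Longrightarrow> E u v \<Longrightarrow> E u w \<Longrightarrow> v = w"
begin

lemma mate_sym: "mate u v \<Longrightarrow> mate v u"
  by (auto simp: mate_def E_sym)

lemma mate_unique: "mate u v \<Longrightarrow> mate u w \<Longrightarrow> v = w"
  using E_unique by (auto simp: mate_def)

lemma mate_neq: "mate u v \<Longrightarrow> u \<noteq> v"
  using E_irrefl by (auto simp: mate_def)

lemma mate_less: "mate u v \<Longrightarrow> u < n \<and> v < n"
  using E_less E_sym by (auto simp: mate_def)

lemma first_mate_less: "first a \<Longrightarrow> mate a b \<Longrightarrow> a < b"
  using mate_neq by (metis first_def linorder_neqE_nat)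

lemma first_mate_not_first: "first a \<Longrightarrow> mate a b \<Longrightarrow> \<not> first b"
  using first_mate_less mate_sym less_asym by blast

lemma finite_X: "finite X"
  using X_less by (meson finite_nat_set_iff_bounded)

lemma finite_heads: "finite (heads R)"
  by (rule finite_subset[of _ "{..<n}"]) (auto simp: heads_def first_def)

text \<open>The neighbours of a vertex of \<open>X\<close> in different components of the rest are independent.\<close>

lemma card_heads:
  assumes R: "sym_sub E R" and free: "star_free t n E R" and t: "t \<ge> 1"
  shows "card (heads R) \<le> (t - 1) * card X"
proof -
  define A where "A = (\<lambda>x. {a. first a \<and> (\<exists>w. (w = a \<or> mate a w) \<and> R w x)})"
  have "card (A x) \<le> t - 1" if x: "x \<in> X" for x
  proof (rule ccontr)
    assume "\<not> card (A x) \<le> t - 1"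
    then have "t \<le> card (A x)" using t by linarith
    then obtain B where B: "B \<subseteq> A x" "card B = t" by (rule obtain_subset_with_card_n)
    have "\<forall>a\<in>B. \<exists>w. (w = a \<or> mate a w) \<and> R w x" using B by (auto simp: A_def)
    from bchoice[OF this] obtain w where w: "\<And>a. a \<in> B \<Longrightarrow> (w a = a \<or> mate a (w a)) \<and> R (w a) x"
      by blast
    have Rw: "R x (w a)" "w a < n" if "a \<in> B" for a
    proof -
      have "R (w a) x" using w[OF that] by simp
      then have "R x (w a)" "E (w a) x" using R by (simp_all add: sym_sub_def)
      then show "R x (w a)" "w a < n" using E_less by simp_all
    qed
    have fst: "first a" if "a \<in> B" for a using B that by (auto simp: A_def)
    have nX: "a \<notin> X" "w a \<notin> X" if "a \<in> B" for a
      using w[OF that] fst[OF that] by (auto simp: mate_def first_def)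
    \<comment> \<open>Chosen vertices that coincide or are adjacent lie in one component, and a
      component has only one first vertex.\<close>
    have sep: "a = b" if ab: "a \<in> B" "b \<in> B" "w a = w b \<or> mate (w a) (w b)" for a b
    proof (rule ccontr)
      assume "a \<noteq> b"
      have nm: "\<not> mate a b" "\<not> mate b a"
        using fst[OF ab(1)] fst[OF ab(2)] first_mate_not_first by blast+
      consider "w a = a" "w b = b" | "w a = a" "mate b (w b)" | "mate a (w a)" "w b = b"
        | "mate a (w a)" "mate b (w b)" using w ab by blast
      then show False
      proof cases
        case 1
        then show ?thesis using ab(3) \<open>a \<noteq> b\<close> nm by simp
      next
        case 2
        then have "mate (w b) b" "mate a (w b) \<Longrightarrow> mate (w b) a" using mate_sym by blast+
        then show ?thesis using 2 ab(3) \<open>a \<noteq> b\<close> nm mate_unique[of "w b" a b] by auto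
      next
        case 3
        then have "mate (w a) a" using mate_sym by blast
        then show ?thesis using 3 ab(3) \<open>a \<noteq> b\<close> nm mate_unique[of "w a" a b] by auto
      next
        case 4
        then have "mate (w a) a" "mate (w b) b" using mate_sym by blast+
        then show ?thesis using 4 ab(3) \<open>a \<noteq> b\<close> nm mate_unique[of "w a" a b]
          mate_unique[of "w a" a "w b"] by auto
      qed
    qed
    have "inj_on w B" using sep by (auto simp: inj_on_def)
    then have "card (w ` B) = t" using B by (simp add: card_image)
    moreover have "w ` B \<subseteq> {..<n}" using Rw by auto
    moreover have "\<forall>u\<in>w ` B. R x u" using Rw by auto
    moreover have "\<not> E u v" if "u \<in> w ` B" "v \<in> w ` B" for u v
    proof
      assume uv: "E u v"
      obtain a b where ab: "a \<in> B" "b \<in> B" "u = w a" "v = w b"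
        using \<open>u \<in> w ` B\<close> \<open>v \<in> w ` B\<close> by auto
      then have "mate (w a) (w b)" using uv nX by (simp add: mate_def)
      then have "a = b" using sep ab by blast
      then show False using uv ab E_irrefl by simp
    qed
    ultimately have "\<exists>v<n. \<exists>U\<subseteq>{..<n}. card U = t \<and> (\<forall>u\<in>U. R v u) \<and> (\<forall>u\<in>U. \<forall>w\<in>U. \<not> E u w)"
      using X_less[OF x] by (intro exI[of _ x] conjI exI[of _ "w ` B"]) simp_all
    then show False using free by (simp add: star_free_def)
  qed
  then have "(\<Sum>x\<in>X. card (A x)) \<le> (\<Sum>x\<in>X. t - 1)" by (rule sum_mono)
  moreover have "heads R \<subseteq> (\<Union>x\<in>X. A x)" by (auto simp: heads_def touched_def A_def)
  moreover have "finite (\<Union>x\<in>X. A x)"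
    by (rule finite_subset[of _ "{..<n}"]) (auto simp: A_def first_def)
  ultimately have "card (heads R) \<le> card (\<Union>x\<in>X. A x)" "(\<Sum>x\<in>X. card (A x)) \<le> (t - 1) * card X"
    by (auto intro!: card_mono simp: mult.commute)
  then show ?thesis using card_UN_le[OF finite_X, of A] by linarith
qed

text \<open>Exchanging the components of a and a' is an automorphism of E that fixes X pointwise,
  because the types agree. The solution conjugated by it has the same size and is still star-free,
  and among its heads a is replaced by the smaller a'.\<close>

lemma swap_heads:
  assumes R: "sym_sub E R" "star_free t n E R"
    and a: "a \<in> heads R" and a': "first a'" "same a a'" "a' < a" "a' \<notin> heads R"
  shows "\<exists>R'. sym_sub E R' \<and> star_free t n E R' \<and> total n R' = total n R \<and> \<Sum>(heads R') < \<Sum>(heads R)"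
proof -
  have fa: "first a" and ta: "touched R a" and nta: "\<not> touched R a'" using a a' by (auto simp: heads_def)
  \<comment> \<open>The value a stands for a missing mate, so vertices and edges are treated alike
    and \<open>b \<noteq> a\<close> says that there is a mate.\<close>
  define b where "b = (if \<exists>m. mate a m then SOME m. mate a m else a)"
  define b' where "b' = (if \<exists>m. mate a' m then SOME m. mate a' m else a')"
  have ex: "(\<exists>m. mate a m) \<longleftrightarrow> (\<exists>m. mate a' m)" using a'(2) by (auto simp: same_def)
  have b: "mate a u \<longleftrightarrow> b \<noteq> a \<and> u = b" for u
    unfolding b_def using someI[of "mate a"] mate_unique mate_neq by (smt (verit))
  have b': "mate a' u \<longleftrightarrow> b' \<noteq> a' \<and> u = b'" for u
    unfolding b'_def using someI[of "mate a'"] mate_unique mate_neq by (smt (verit))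
  have bb: "b \<noteq> a \<longleftrightarrow> b' \<noteq> a'" using ex b b' by auto
  have neq: "a \<noteq> a'" "b \<noteq> a'" "b' \<noteq> a"
    using a' fa b b' first_mate_not_first by auto
  have neq2: "b \<noteq> b'"
    using b[of b] b'[of b'] bb neq mate_sym mate_unique by (metis )
  have nX: "a \<notin> X" "a' \<notin> X" "b \<notin> X" "b' \<notin> X"
    using fa a' b[of b] b'[of b'] by (auto simp: first_def mate_def)
  have lt: "a < n" "a' < n" "b < n" "b' < n"
    using fa a' b[of b] b'[of b'] mate_less by (auto simp: first_def)
  define \<pi> where "\<pi> u = (if u = a then a' else if u = a' then a else if u = b then b' else if u = b' then b else u)" for u
  have inv: "\<pi> (\<pi> u) = u" for u unfolding \<pi>_def using neq neq2 bb by auto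
  have piX: "\<pi> u \<in> X \<longleftrightarrow> u \<in> X" "u \<in> X \<Longrightarrow> \<pi> u = u" for u unfolding \<pi>_def using nX by auto
  have pilt: "\<pi> u < n \<longleftrightarrow> u < n" for u unfolding \<pi>_def using lt by auto
  have type_a: "E a x \<longleftrightarrow> E a' x" if "x \<in> X" for x using a'(2) that by (auto simp: same_def)
  have type_b: "E b x \<longleftrightarrow> E b' x" if "x \<in> X" for x
    using a'(2) that bb b b' type_a[OF that] unfolding same_def by metis
  have E_X: "E (\<pi> u) x \<longleftrightarrow> E u x" if "x \<in> X" for u x
    unfolding \<pi>_def using type_a[OF that] type_b[OF that] by auto
  have mate_pi: "mate (\<pi> u) (\<pi> v)" if m: "mate u v" for u v
  proof -
    consider "u = a" | "u = a'" | "u = b" "b \<noteq> a" | "u = b'" "b' \<noteq> a'" | "u \<notin> {a, a', b, b'}" using bb by auto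
    then show ?thesis
    proof cases
      case 1
      then show ?thesis using m b b' bb neq unfolding \<pi>_def by auto
    next
      case 2
      then show ?thesis using m b b' bb neq neq2 unfolding \<pi>_def by auto
    next
      case 3
      then have "v = a" using m b[of b] mate_sym mate_unique by blast
      then show ?thesis using 3 m b[of b] b'[of b'] bb neq neq2 mate_sym unfolding \<pi>_def by auto
    next
      case 4
      then have "v = a'" using m b'[of b'] mate_sym mate_unique by blast
      then show ?thesis using 4 m b[of b] b'[of b'] bb neq neq2 mate_sym unfolding \<pi>_def by auto
    next
      case 5
      have "v \<noteq> a" "v \<noteq> a'" using 5 m mate_sym b b' by blast+
      moreover have "v \<noteq> b" if "b \<noteq> a" using 5 m that mate_sym mate_unique b[of b] by blast
      moreover have "v \<noteq> b'" if "b' \<noteq> a'" using 5 m that mate_sym mate_unique b'[of b'] by blast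
      ultimately show ?thesis using 5 m bb unfolding \<pi>_def by auto
    qed
  qed
  have mate_pi_iff: "mate (\<pi> u) (\<pi> v) \<longleftrightarrow> mate u v" for u v
    using mate_pi[of u v] mate_pi[of "\<pi> u" "\<pi> v"] by (auto simp: inv)
  \<comment> \<open>Edges with an end in X are preserved by equality of types; the edges outside X
    are exactly the mate pairs.\<close>
  have E_pi: "E (\<pi> u) (\<pi> v) \<longleftrightarrow> E u v" for u v
  proof (cases "u \<in> X \<or> v \<in> X")
    case True
    then show ?thesis using E_X E_sym piX by metis
  next
    case False
    then show ?thesis using mate_pi_iff[of u v] piX unfolding mate_def by auto
  qed
  define R' where "R' u v = R (\<pi> u) (\<pi> v)" for u v
  have bij: "bij_betw \<pi> {..<n} {..<n}"
    by (rule bij_betw_byWitness[where f'=\<pi>]) (auto simp: inv pilt)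
  have inj: "inj \<pi>" by (rule inj_on_inverseI[where g=\<pi>]) (rule inv)
  have "sym_sub E R'" using R(1) E_pi unfolding sym_sub_def R'_def by blast
  moreover have "star_free t n E R'" unfolding star_free_def
  proof (intro notI, elim exE conjE)
    fix v U assume *: "v < n" "U \<subseteq> {..<n}" "card U = t" "\<forall>u\<in>U. R' v u" "\<forall>u\<in>U. \<forall>w\<in>U. \<not> E u w"
    have "card (\<pi> ` U) = t" using * inj by (simp add: card_image inj_on_subset)
    moreover have "\<pi> ` U \<subseteq> {..<n}" "\<pi> v < n" using * pilt by auto
    moreover have "\<forall>u\<in>\<pi> ` U. R (\<pi> v) u" "\<forall>u\<in>\<pi> ` U. \<forall>w\<in>\<pi> ` U. \<not> E u w"
      using * E_pi by (auto simp: R'_def)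
    ultimately show False using R(2) unfolding star_free_def by blast
  qed
  moreover have "total n R' = total n R"
  proof -
    have "deg n R' v = deg n R (\<pi> v)" for v
      unfolding deg_def R'_def
      by (rule bij_betw_same_card[where f=\<pi>], rule bij_betw_byWitness[where f'=\<pi>]) (auto simp: inv pilt)
    then show ?thesis unfolding total_def using sum.reindex_bij_betw[OF bij, of "deg n R"] by simp
  qed
  moreover have "\<Sum>(heads R') < \<Sum>(heads R)"
  proof -
    have tch: "touched R' u \<longleftrightarrow> touched R (\<pi> u)" for u
    proof -
      have "touched R' u \<longleftrightarrow> (\<exists>w. (w = u \<or> mate u w) \<and> (\<exists>x\<in>X. R (\<pi> w) x))"
        unfolding touched_def R'_def using piX by auto
      also have "\<dots> \<longleftrightarrow> (\<exists>w. (\<pi> w = u \<or> mate u (\<pi> w)) \<and> (\<exists>x\<in>X. R w x))" using inv by metis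
      also have "\<dots> \<longleftrightarrow> (\<exists>w. (w = \<pi> u \<or> mate (\<pi> u) w) \<and> (\<exists>x\<in>X. R w x))" using inv mate_pi_iff by metis
      finally show ?thesis unfolding touched_def .
    qed
    have other: "\<pi> c = c" if "first c" "c \<noteq> a" "c \<noteq> a'" for c
      using that b[of b] b'[of b'] first_mate_not_first fa a'(1) unfolding \<pi>_def by metis
    have "c \<in> heads R' \<longleftrightarrow> c \<in> insert a' (heads R - {a})" for c
    proof -
      consider "c = a" | "c = a'" | "c \<noteq> a" "c \<noteq> a'" by blast
      then show ?thesis
      proof cases
        case 1
        then show ?thesis using tch[of a] nta neq by (simp add: heads_def \<pi>_def)
      next
        case 2
        then show ?thesis using tch[of a'] ta neq a'(1) by (simp add: heads_def \<pi>_def)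
      next
        case 3
        then show ?thesis using tch[of c] other[of c] by (auto simp: heads_def)
      qed
    qed
    then have "heads R' = insert a' (heads R - {a})" by blast
    then have "\<Sum>(heads R') = a' + \<Sum>(heads R - {a})" using a'(4) finite_heads by simp
    also have "\<dots> < a + \<Sum>(heads R - {a})" using a'(3) by simp
    also have "\<dots> = \<Sum>(heads R)" using a finite_heads by (simp add: sum.remove)
    finally show ?thesis .
  qed
  ultimately show ?thesis by blast
qed

lemma touched_mate: "mate u v \<Longrightarrow> touched R u \<Longrightarrow> touched R v"
  unfolding touched_def using mate_sym mate_unique by metis

text \<open>Among the solutions at least as large as R, one with the least sum of heads admits no
  further exchange, hence its heads are closed downwards within each type. Adding the inner edges of
  all untouched components then changes no head. These two properties are what lets a certificate
  omit names and untouched components.\<close>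

lemma canonical_solution:
  assumes R: "sym_sub E R" "star_free t n E R" and t: "t \<ge> 2"
  shows "\<exists>R'. sym_sub E R' \<and> star_free t n E R' \<and> total n R \<le> total n R' \<and>
    (\<forall>u v. mate u v \<and> \<not> R' u v \<longrightarrow> touched R' u) \<and>
    (\<forall>a a'. a \<in> heads R' \<and> first a' \<and> same a a' \<and> a' < a \<longrightarrow> a' \<in> heads R')"
proof -
  define good where "good R' \<longleftrightarrow> sym_sub E R' \<and> star_free t n E R' \<and> total n R \<le> total n R'" for R'
  have "good R" using R by (simp add: good_def)
  from ex_has_least_nat[of good R "\<lambda>R. \<Sum>(heads R)", OF this]
  obtain Q where Q: "good Q" "\<And>R'. good R' \<Longrightarrow> \<Sum>(heads Q) \<le> \<Sum>(heads R')" by blast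
  have down: "a' \<in> heads Q" if a: "a \<in> heads Q" "first a'" "same a a'" "a' < a" for a a'
  proof (rule ccontr)
    assume "a' \<notin> heads Q"
    then obtain R' where "sym_sub E R'" "star_free t n E R'" "total n R' = total n Q"
      "\<Sum>(heads R') < \<Sum>(heads Q)"
      using swap_heads[of Q t a a'] Q(1) a unfolding good_def by auto
    then show False using Q(1) Q(2)[of R'] by (simp add: good_def)
  qed
  \<comment> \<open>Only edges between vertices outside X are added, so the same components are
    touched by S and by Q.\<close>
  define S where "S u v \<longleftrightarrow> Q u v \<or> (mate u v \<and> \<not> touched Q u)" for u v
  have SX: "S u x \<longleftrightarrow> Q u x" if "x \<in> X" for u x using that by (auto simp: S_def mate_def)
  have tS: "touched S = touched Q" unfolding touched_def using SX by auto
  then have hS: "heads S = heads Q" by (simp add: heads_def)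
  have "sym_sub E S" unfolding sym_sub_def
  proof (intro allI impI)
    fix u v assume "S u v"
    then consider "Q u v" | "mate u v" "\<not> touched Q u" by (auto simp: S_def)
    then show "S v u \<and> E u v"
    proof cases
      case 1
      then show ?thesis using Q(1) by (simp add: good_def sym_sub_def S_def)
    next
      case 2
      then show ?thesis using touched_mate[of v u Q] mate_sym[of u v] by (auto simp: S_def mate_def)
    qed
  qed
  moreover have "star_free t n E S" unfolding star_free_def
  proof (intro notI, elim exE conjE)
    fix v U assume *: "v < n" "U \<subseteq> {..<n}" "card U = t" "\<forall>u\<in>U. S v u" "\<forall>u\<in>U. \<forall>w\<in>U. \<not> E u w"
    show False
    proof (cases "\<forall>u\<in>U. Q v u")
      case True
      then have "\<exists>v<n. \<exists>U\<subseteq>{..<n}. card U = t \<and> (\<forall>u\<in>U. Q v u) \<and> (\<forall>u\<in>U. \<forall>w\<in>U. \<not> E u w)"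
        using * by (intro exI[of _ v] conjI exI[of _ U])
      then show False using Q(1) by (simp add: good_def star_free_def)
    next
      \<comment> \<open>A star using an added edge has its centre v in an untouched component. All
        S-neighbours of v are then its unique mate, fewer than t vertices.\<close>
      case False
      then obtain u where u: "mate v u" "\<not> touched Q v" using * by (auto simp: S_def)
      have "w = u" if "w \<in> U" for w
      proof -
        have Sw: "S v w" using * that by blast
        have "\<not> Q v w" if "w \<in> X" using that u by (auto simp: touched_def)
        then have "w \<notin> X" using Sw by (auto simp: S_def mate_def)
        moreover have "E v w" using Sw \<open>sym_sub E S\<close> by (auto simp: sym_sub_def)
        ultimately have "mate v w" using u by (simp add: mate_def)
        then show ?thesis using u mate_unique by blast
      qed
      then have "U \<subseteq> {u}" by blast
      then have "card U \<le> 1" using card_mono[of "{u}" U] by simp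
      then show False using * t by simp
    qed
  qed
  moreover have "total n R \<le> total n S"
  proof -
    have "deg n Q v \<le> deg n S v" for v unfolding deg_def by (rule card_mono) (auto simp: S_def)
    then have "total n Q \<le> total n S" unfolding total_def by (rule sum_mono)
    then show ?thesis using Q(1) by (simp add: good_def)
  qed
  ultimately show ?thesis using down hS tS by (intro exI[of _ S]) (auto simp: S_def)
qed

end

section \<open>Variables and arrays left unchanged by a command\<close>

primrec assigned :: "cmd \<Rightarrow> nat set" where
  "assigned (Assign v e) = {v}"
| "assigned (Upd a i e) = {}"
| "assigned (c ;; d) = assigned c \<union> assigned d"
| "assigned (When e c) = assigned c"
| "assigned (For v b c) = insert v (assigned c)"

primrec updated :: "cmd \<Rightarrow> nat set" where
  "updated (Assign v e) = {}"
| "updated (Upd a i e) = {a}"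
| "updated (c ;; d) = updated c \<union> updated d"
| "updated (When e c) = updated c"
| "updated (For v b c) = updated c"

lemma den_For_induct:
  assumes "I 0 s" "\<And>i s. i < N \<Longrightarrow> I i s \<Longrightarrow> I (Suc i) (den c (setv v i s))" "N = fst s b"
  shows "I N (den (For v b c) s)"
proof -
  have "i \<le> N \<Longrightarrow> I i (fold (\<lambda>i s. den c (setv v i s)) [0..<i] s)" for i
    by (induction i) (use assms in auto)
  then show ?thesis using assms(3) by simp
qed

lemma setv_simps [simp]:
  "fst (setv v x s) = (fst s)(v := x)" "snd (setv v x s) = snd s"
  by (simp_all add: setv_def)

lemma den_not_assigned: "v \<notin> assigned c \<Longrightarrow> fst (den c s) v = fst s v"
proof (induction c arbitrary: s)
  case (For u b c)
  show ?case
    by (rule den_For_induct[where I="\<lambda>i s'. fst s' v = fst s v"]) (use For in auto)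
qed auto

lemma cell_eq_iff [simp]: "a < 8 \<Longrightarrow> b < 8 \<Longrightarrow> cell a i = cell b j \<longleftrightarrow> a = b \<and> i = j"
  unfolding cell_def by presburger

lemma den_not_updated:
  "a \<notin> updated c \<Longrightarrow> updated c \<subseteq> {..<8} \<Longrightarrow> a < 8 \<Longrightarrow> snd (den c s) (cell a i) = snd s (cell a i)"
proof (induction c arbitrary: s)
  case (For u b c)
  show ?case
    by (rule den_For_induct[where I="\<lambda>j s'. snd s' (cell a i) = snd s (cell a i)"]) (use For in auto)
qed auto


section \<open>Derived expressions\<close>

definition tr :: "exp \<Rightarrow> (nat \<Rightarrow> nat) \<Rightarrow> (nat \<Rightarrow> nat) \<Rightarrow> bool" where
  "tr e \<sigma> M \<longleftrightarrow> ev e \<sigma> M \<noteq> 0"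

definition "Neg a = Ite a (Num 0) (Num 1)"
definition "Conj a b = Ite a b (Num 0)"
definition "Disj a b = Ite a (Num 1) b"
definition "Iff a b = Ite a b (Neg b)"
definition "Less a b = Minus b a"
definition "Equ a b = Neg (Plus (Minus a b) (Minus b a))"
definition "Exi v b e = Sum v b e"
definition "Univ v b e = Neg (Sum v b (Neg e))"
definition "Count v b e = Sum v b (Ite e (Num 1) (Num 0))"

text \<open>The first factor is truncated at the value of variable 0, which keeps the running time static.\<close>

definition "Mul a b = Sum 15 0 (Ite (Less (Var 15) a) b (Num 0))"

primrec times :: "nat \<Rightarrow> exp \<Rightarrow> exp" where
  "times 0 e = Num 0"
| "times (Suc c) e = Plus e (times c e)"

lemma ev_times [simp]: "ev (times c e) \<sigma> M = c * ev e \<sigma> M"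
  by (induction c) auto

lemma tr_simps [simp]:
  "tr (Neg a) \<sigma> M \<longleftrightarrow> \<not> tr a \<sigma> M"
  "tr (Conj a b) \<sigma> M \<longleftrightarrow> tr a \<sigma> M \<and> tr b \<sigma> M"
  "tr (Disj a b) \<sigma> M \<longleftrightarrow> tr a \<sigma> M \<or> tr b \<sigma> M"
  "tr (Iff a b) \<sigma> M \<longleftrightarrow> (tr a \<sigma> M \<longleftrightarrow> tr b \<sigma> M)"
  "tr (Less c d) \<sigma> M \<longleftrightarrow> ev c \<sigma> M < ev d \<sigma> M"
  "tr (Equ c d) \<sigma> M \<longleftrightarrow> ev c \<sigma> M = ev d \<sigma> M"
  "tr (Exi v u a) \<sigma> M \<longleftrightarrow> (\<exists>i<\<sigma> u. tr a (\<sigma>(v := i)) M)"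
  "tr (Univ v u a) \<sigma> M \<longleftrightarrow> (\<forall>i<\<sigma> u. tr a (\<sigma>(v := i)) M)"
  "tr (Ite a b c) \<sigma> M \<longleftrightarrow> (if tr a \<sigma> M then tr b \<sigma> M else tr c \<sigma> M)"
  "tr (Num x) \<sigma> M \<longleftrightarrow> x \<noteq> 0"
  "tr (Arr x c) \<sigma> M \<longleftrightarrow> M (cell x (ev c \<sigma> M)) \<noteq> 0"
  unfolding tr_def Neg_def Conj_def Disj_def Iff_def Less_def Equ_def Exi_def Univ_def by auto

lemma ev_Ite_tr: "ev (Ite c a b) \<sigma> M = (if tr c \<sigma> M then ev a \<sigma> M else ev b \<sigma> M)"
  by (simp add: tr_def)

lemma ev_Neg [simp]: "ev (Neg a) \<sigma> M = (if tr a \<sigma> M then 0 else 1)"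
  by (simp add: Neg_def tr_def)

lemma ev_Count [simp]: "ev (Count v b e) \<sigma> M = card {i. i < \<sigma> b \<and> tr e (\<sigma>(v := i)) M}"
proof -
  have "ev (Count v b e) \<sigma> M = (\<Sum>i<\<sigma> b. if tr e (\<sigma>(v := i)) M then 1 else 0)"
    by (simp add: Count_def tr_def cong: if_cong)
  also have "\<dots> = card {i. i < \<sigma> b \<and> tr e (\<sigma>(v := i)) M}"
    by (simp add: sum.If_cases Int_def)
  finally show ?thesis .
qed

lemma ev_Mul:
  assumes "\<And>i. ev a (\<sigma>(15 := i)) M = ev a \<sigma> M" "\<And>i. ev b (\<sigma>(15 := i)) M = ev b \<sigma> M"
  shows "ev (Mul a b) \<sigma> M = min (ev a \<sigma> M) (\<sigma> 0) * ev b \<sigma> M"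
proof -
  have "ev (Mul a b) \<sigma> M = (\<Sum>i<\<sigma> 0. if i < ev a \<sigma> M then ev b \<sigma> M else 0)"
    unfolding Mul_def by (auto simp: Less_def assms intro!: sum.cong)
  also have "\<dots> = (\<Sum>i\<in>{i. i < \<sigma> 0 \<and> i < ev a \<sigma> M}. ev b \<sigma> M)"
    by (rule sum.mono_neutral_cong_right) auto
  also have "{i. i < \<sigma> 0 \<and> i < ev a \<sigma> M} = {..<min (ev a \<sigma> M) (\<sigma> 0)}" by auto
  finally show ?thesis by simp
qed

lemma wf_simps [simp]:
  "wf_exp (Neg a) = wf_exp a"
  "wf_exp (Conj a b) = (wf_exp a \<and> wf_exp b)"
  "wf_exp (Disj a b) = (wf_exp a \<and> wf_exp b)"
  "wf_exp (Iff a b) = (wf_exp a \<and> wf_exp b)"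
  "wf_exp (Less a b) = (wf_exp a \<and> wf_exp b)"
  "wf_exp (Equ a b) = (wf_exp a \<and> wf_exp b)"
  "wf_exp (Exi v u a) = (v \<notin> size_vars \<and> u \<in> size_vars \<and> wf_exp a)"
  "wf_exp (Univ v u a) = (v \<notin> size_vars \<and> u \<in> size_vars \<and> wf_exp a)"
  "wf_exp (Count v u a) = (v \<notin> size_vars \<and> u \<in> size_vars \<and> wf_exp a)"
  "wf_exp (Mul a b) = (wf_exp a \<and> wf_exp b)"
  unfolding Neg_def Conj_def Disj_def Iff_def Less_def Equ_def Exi_def Univ_def Count_def Mul_def
  by (auto simp: size_vars_def)

lemma wf_times [simp]: "wf_exp e \<Longrightarrow> wf_exp (times c e)"
  by (induction c) auto


definition "index u v = Plus (Mul (Var u) (Var 0)) (Var v)"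

text \<open>The guards keep the row number in the range where the truncated \<open>Mul\<close> is
  exact, and they make indices beyond n non-adjacent, as in \<open>rel_of\<close>.\<close>

definition Cell :: "nat \<Rightarrow> nat \<Rightarrow> nat \<Rightarrow> exp" where
  "Cell a u v = Conj (Less (Var u) (Var 0)) (Conj (Less (Var v) (Var 0)) (Arr a (index u v)))"

definition rel_of :: "nat \<Rightarrow> (nat \<Rightarrow> nat) \<Rightarrow> nat \<Rightarrow> nat \<Rightarrow> nat \<Rightarrow> bool" where
  "rel_of n M a u v \<longleftrightarrow> u < n \<and> v < n \<and> M (cell a (u * n + v)) \<noteq> 0"

lemma ev_index: "u \<noteq> 15 \<Longrightarrow> \<sigma> u < \<sigma> 0 \<Longrightarrow> ev (index u v) \<sigma> M = \<sigma> u * \<sigma> 0 + \<sigma> v"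
  by (simp add: index_def ev_Mul)

lemma tr_Cell [simp]: "u \<noteq> 15 \<Longrightarrow> tr (Cell a u v) \<sigma> M \<longleftrightarrow> rel_of (\<sigma> 0) M a (\<sigma> u) (\<sigma> v)"
  unfolding Cell_def rel_of_def using ev_index[of u \<sigma> v M] by auto

lemma wf_index [simp]: "wf_exp (index u v)" "wf_exp (Cell a u v)"
  by (simp_all add: index_def Cell_def)

definition "Deg u = Count 16 0 (Cell 1 u 16)"

lemma ev_Deg [simp]:
  "u \<noteq> 15 \<Longrightarrow> u \<noteq> 16 \<Longrightarrow> ev (Deg u) \<sigma> M = deg (\<sigma> 0) (rel_of (\<sigma> 0) M 1) (\<sigma> u)"
  by (simp add: Deg_def deg_def)

lemma wf_Deg [simp]: "wf_exp (Deg u)"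
  by (simp add: Deg_def size_vars_def)

lemma rel_of_upd:
  assumes "u < n" "v < n" "a < 8" "b < 8"
  shows "rel_of n (M(cell b (u * n + v) := x)) a =
    (\<lambda>u' v'. if a = b \<and> u' = u \<and> v' = v then x \<noteq> 0 else rel_of n M a u' v')"
proof -
  have "u' * n + v' = u * n + v \<longleftrightarrow> u' = u \<and> v' = v" if "u' < n" "v' < n" for u' v'
  proof
    assume h: "u' * n + v' = u * n + v"
    have "(u' * n + v') div n = u'" "(u * n + v) div n = u" "(u' * n + v') mod n = v'" "(u * n + v) mod n = v"
      using that assms by auto
    then show "u' = u \<and> v' = v" using h by metis
  qed simp
  then show ?thesis using assms by (auto simp: rel_of_def fun_eq_iff)
qed


section \<open>Local search\<close>

definition link :: "(nat \<Rightarrow> nat \<Rightarrow> bool) \<Rightarrow> nat \<Rightarrow> nat \<Rightarrow> nat \<Rightarrow> nat \<Rightarrow> bool" where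
  "link R a b = (\<lambda>u v. R u v \<or> u = a \<and> v = b \<or> u = b \<and> v = a)"

definition unlink :: "(nat \<Rightarrow> nat \<Rightarrow> bool) \<Rightarrow> nat \<Rightarrow> nat \<Rightarrow> nat \<Rightarrow> nat \<Rightarrow> bool" where
  "unlink R a b = (\<lambda>u v. R u v \<and> \<not> (u = a \<and> v = b \<or> u = b \<and> v = a))"

definition can_add :: "nat \<Rightarrow> (nat \<Rightarrow> nat \<Rightarrow> bool) \<Rightarrow> (nat \<Rightarrow> nat \<Rightarrow> bool) \<Rightarrow> nat \<Rightarrow> nat \<Rightarrow> bool" where
  "can_add n E R a b \<longleftrightarrow> E a b \<and> \<not> R a b \<and> deg n R a < 2 \<and> deg n R b < 2"

definition can_swap ::
  "nat \<Rightarrow> (nat \<Rightarrow> nat \<Rightarrow> bool) \<Rightarrow> (nat \<Rightarrow> nat \<Rightarrow> bool) \<Rightarrow> nat \<Rightarrow> nat \<Rightarrow> nat \<Rightarrow> nat \<Rightarrow> bool" where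
  "can_swap n E R a b c d \<longleftrightarrow>
     R a b \<and> c \<noteq> d \<and> deg n R c = 0 \<and> deg n R d = 0 \<and> E a c \<and> E b d"

definition stuck where
  "stuck n E R a b c d \<longleftrightarrow> \<not> can_add n E R a b \<and> \<not> can_swap n E R a b c d"

text \<open>The swap is tested on the relation after a possible addition, since the program performs
  the two tests one after the other.\<close>

definition move where
  "move n E R a b c d =
     (let R1 = if can_add n E R a b then link R a b else R
      in if can_swap n E R1 a b c d then link (link (unlink R1 a b) a c) b d else R1)"

definition valid :: "nat \<Rightarrow> (nat \<Rightarrow> nat \<Rightarrow> bool) \<Rightarrow> (nat \<Rightarrow> nat \<Rightarrow> bool) \<Rightarrow> bool" where
  "valid n E R \<longleftrightarrow> sym_sub E R \<and> (\<forall>v. deg n R v \<le> 2)"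

lemma deg_link:
  assumes "a < n" "b < n" "a \<noteq> b" "\<not> R a b" "\<not> R b a"
  shows "deg n (link R a b) v = deg n R v + (if v = a \<or> v = b then 1 else 0)"
proof -
  have "{u. u < n \<and> link R a b v u} = {u. u < n \<and> R v u} \<union> (if v = a then {b} else if v = b then {a} else {})"
    using assms by (auto simp: link_def)
  then show ?thesis using assms by (auto simp: deg_def)
qed

lemma total_link:
  assumes "a < n" "b < n" "a \<noteq> b" "\<not> R a b" "\<not> R b a"
  shows "total n (link R a b) = total n R + 2"
proof -
  have "total n (link R a b) = total n R + (\<Sum>v<n. if v = a \<or> v = b then 1 else 0)"
    by (simp add: total_def deg_link[OF assms] sum.distrib)
  also have "(\<Sum>v<n. if v = a \<or> v = b then 1 else 0) = card {a, b}"
  proof -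
    have "{..<n} \<inter> {v. v = a \<or> v = b} = {a, b}" using assms by auto
    then show ?thesis by (simp add: sum.If_cases)
  qed
  finally show ?thesis using assms by simp
qed

lemma deg_0_iff: "deg n R v = 0 \<longleftrightarrow> (\<forall>u<n. \<not> R v u)"
  by (auto simp: deg_def)

definition graph_on :: "nat \<Rightarrow> (nat \<Rightarrow> nat \<Rightarrow> bool) \<Rightarrow> bool" where
  "graph_on n E \<longleftrightarrow> (\<forall>u v. E u v \<longrightarrow> E v u \<and> u \<noteq> v \<and> u < n)"

context
  fixes n :: nat and E :: "nat \<Rightarrow> nat \<Rightarrow> bool"
  assumes E: "graph_on n E"
begin

lemma E_sym: "E u v \<Longrightarrow> E v u" and E_irrefl: "\<not> E u u" and E_less: "E u v \<Longrightarrow> u < n"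
  using E by (auto simp: graph_on_def)

lemma valid_add:
  assumes "valid n E R" "can_add n E R a b"
  shows "valid n E (link R a b) \<and> total n (link R a b) = total n R + 2"
proof -
  have ab: "a < n" "b < n" "a \<noteq> b" "E a b" "E b a" "\<not> R a b" "\<not> R b a"
    using assms E_less E_sym E_irrefl unfolding can_add_def valid_def sym_sub_def by blast+
  have "deg n (link R a b) v \<le> 2" for v
    using assms deg_link[OF ab(1-3,6,7), of v] unfolding can_add_def valid_def by (auto simp: less_2_cases_iff)
  moreover have "sym_sub E (link R a b)" using assms ab unfolding valid_def sym_sub_def link_def by blast
  ultimately show ?thesis using total_link ab by (simp add: valid_def)
qed

text \<open>Being isolated, c and d differ from a and b. These keep their degrees, c and d get
  degree 1, and one edge is traded for two.\<close>

lemma valid_swap: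
  assumes "valid n E R" "can_swap n E R a b c d"
  shows "valid n E (link (link (unlink R a b) a c) b d) \<and>
    total n (link (link (unlink R a b) a c) b d) = total n R + 2"
proof -
  let ?R0 = "unlink R a b" 
  let ?R1 = "link ?R0 a c"
  have sub: "R u v \<Longrightarrow> R v u \<and> E u v" for u v using assms by (auto simp: valid_def sym_sub_def)
  have R: "R a b" "R b a" "E a c" "E b d" "c \<noteq> d" using assms sub by (auto simp: can_swap_def)
  have lt: "a < n" "b < n" "c < n" "d < n" using R sub E_less E_sym by blast+
  have c0: "\<not> R u c" "\<not> R u d" "\<not> R c u" "\<not> R d u" if "u < n" for u
    using assms(2) that sub unfolding can_swap_def deg_0_iff by blast+
  have ne: "a \<noteq> b" "a \<noteq> c" "a \<noteq> d" "b \<noteq> c" "b \<noteq> d"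
    using R c0 lt sub E_irrefl by blast+
  \<comment> \<open>Viewing R as the reduced relation with the edge put back lets
    \<open>deg_link\<close> and \<open>total_link\<close> account for the removal too.\<close>
  have R0: "R = link ?R0 a b" using R by (auto simp: link_def unlink_def fun_eq_iff)
  have "\<not> ?R0 a b" "\<not> ?R0 b a" by (auto simp: unlink_def)
  note d0 = deg_link[OF lt(1,2) ne(1) this, folded R0] total_link[OF lt(1,2) ne(1) this, folded R0]
  have "\<not> ?R0 a c" "\<not> ?R0 c a" using c0 lt by (auto simp: unlink_def)
  note d1 = deg_link[OF lt(1,3) ne(2) this] total_link[OF lt(1,3) ne(2) this]
  have "\<not> ?R1 b d" "\<not> ?R1 d b" using c0 lt ne by (auto simp: unlink_def link_def)
  note d2 = deg_link[OF lt(2,4) ne(5) this] total_link[OF lt(2,4) ne(5) this]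
  have "deg n (link ?R1 b d) v \<le> 2" for v
  proof -
    have "deg n R v \<le> 2" using assms by (auto simp: valid_def)
    moreover have "deg n R c = 0" "deg n R d = 0" using assms by (auto simp: can_swap_def)
    ultimately show ?thesis using d0(1)[of v] d1(1)[of v] d2(1)[of v] ne R(5) by (auto split: if_splits)
  qed
  moreover have "sym_sub E (link ?R1 b d)"
    using sub R E_sym unfolding sym_sub_def link_def unlink_def by blast
  moreover have "total n (link ?R1 b d) = total n R + 2" using d0(2) d1(2) d2(2) by simp
  ultimately show ?thesis by (simp add: valid_def)
qed

lemma move_cases:
  assumes "valid n E R"
  shows "valid n E (move n E R a b c d)"
    and "stuck n E R a b c d \<Longrightarrow> move n E R a b c d = R"
    and "\<not> stuck n E R a b c d \<Longrightarrow> total n R < total n (move n E R a b c d)"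
proof -
  define R1 where "R1 = (if can_add n E R a b then link R a b else R)"
  have R1: "valid n E R1" "total n R \<le> total n R1" "can_add n E R a b \<Longrightarrow> total n R < total n R1"
    using assms valid_add by (auto simp: R1_def)
  have m: "move n E R a b c d = (if can_swap n E R1 a b c d then link (link (unlink R1 a b) a c) b d else R1)"
    by (simp add: move_def R1_def Let_def)
  have 2: "can_swap n E R1 a b c d \<Longrightarrow> valid n E (move n E R a b c d) \<and> total n R < total n (move n E R a b c d)"
    using valid_swap[OF R1(1), of a b c d] R1(2) m by auto
  show "valid n E (move n E R a b c d)" using 2 R1 m by auto
  show "stuck n E R a b c d \<Longrightarrow> move n E R a b c d = R" by (simp add: stuck_def move_def)
  show "\<not> stuck n E R a b c d \<Longrightarrow> total n R < total n (move n E R a b c d)"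
    using 2 R1 m by (cases "can_add n E R a b") (auto simp: stuck_def R1_def)
qed

lemma stuck_local_opt:
  assumes "\<forall>a<n. \<forall>b<n. \<forall>c<n. \<forall>d<n. stuck n E R a b c d"
  shows "local_opt n E R"
proof -
  have "\<not> can_add n E R a b" if "a < n" "b < n" for a b
    using assms that unfolding stuck_def by blast
  moreover have "\<not> can_swap n E R a b c d" if "a < n" "b < n" "c < n" "d < n" for a b c d
    using assms that unfolding stuck_def by blast
  ultimately show ?thesis
    unfolding local_opt_def can_add_def can_swap_def by (metis less_Suc_eq_le numeral_2_eq_2 One_nat_def)
qed

lemma total_le: "valid n E R \<Longrightarrow> total n R \<le> 2 * n"
  using sum_bounded_above[of "{..<n}" "deg n R" 2] by (simp add: total_def valid_def)

end

definition put :: "nat \<Rightarrow> nat \<Rightarrow> nat \<Rightarrow> cmd" where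
  "put u v x = (Upd 1 (index u v) (Num x) ;; Upd 1 (index v u) (Num x))"

definition Add_cond :: exp where
  "Add_cond = Conj (Cell 0 10 11) (Conj (Neg (Cell 1 10 11))
     (Conj (Less (Deg 10) (Num 2)) (Less (Deg 11) (Num 2))))"

definition Swap_cond :: exp where
  "Swap_cond = Conj (Cell 1 10 11) (Conj (Neg (Equ (Var 12) (Var 13))) (Conj (Equ (Deg 12) (Num 0))
     (Conj (Equ (Deg 13) (Num 0)) (Conj (Cell 0 10 12) (Cell 0 11 13)))))"

definition Move :: cmd where
  "Move = (When Add_cond (put 10 11 1) ;; When Swap_cond (put 10 11 0 ;; put 10 12 1 ;; put 11 13 1))"

definition Sweep :: cmd where
  "Sweep = For 10 0 (For 11 0 (For 12 0 (For 13 0 Move)))"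

definition Search :: cmd where
  "Search = For 14 4 Sweep"

lemma When_tr: "den (When e c) s = (if tr e (fst s) (snd s) then den c s else s)"
  by (simp add: tr_def)

lemma den_put:
  assumes "u \<noteq> 15" "v \<noteq> 15" "fst s u < fst s 0" "fst s v < fst s 0"
  shows "fst (den (put u v x) s) = fst s"
    "rel_of (fst s 0) (snd (den (put u v x) s)) 1 =
      (if x = 0 then unlink (rel_of (fst s 0) (snd s) 1) (fst s u) (fst s v)
       else link (rel_of (fst s 0) (snd s) 1) (fst s u) (fst s v))"
    "rel_of (fst s 0) (snd (den (put u v x) s)) 0 = rel_of (fst s 0) (snd s) 0"
  using assms
  by (simp_all add: put_def ev_index rel_of_upd) (auto simp: link_def unlink_def fun_eq_iff)

lemma den_Move:
  assumes "s = (\<sigma>, M)" "\<sigma> 0 = n" "\<sigma> 10 = a" "\<sigma> 11 = b" "\<sigma> 12 = c" "\<sigma> 13 = d" "a < n" "b < n" "c < n" "d < n"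
  shows "fst (den Move s) = \<sigma>"
    "rel_of n (snd (den Move s)) 0 = rel_of n M 0"
    "rel_of n (snd (den Move s)) 1 = move n (rel_of n M 0) (rel_of n M 1) a b c d"
proof -
  define s1 where "s1 = den (When Add_cond (put 10 11 1)) s"
  have A: "tr Add_cond \<sigma> M \<longleftrightarrow> can_add n (rel_of n M 0) (rel_of n M 1) a b"
    using assms by (simp add: Add_cond_def can_add_def)
  have s1: "fst s1 = \<sigma>" "rel_of n (snd s1) 0 = rel_of n M 0" 
    "rel_of n (snd s1) 1 = (if can_add n (rel_of n M 0) (rel_of n M 1) a b then link (rel_of n M 1) a b else rel_of n M 1)"
    using den_put[of 10 11 s 1] assms A unfolding s1_def When_tr by auto
  have B: "tr Swap_cond (fst s1) (snd s1) \<longleftrightarrow> can_swap n (rel_of n (snd s1) 0) (rel_of n (snd s1) 1) a b c d"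
    using assms s1 by (simp add: Swap_cond_def can_swap_def)
  let ?s2 = "den (put 10 11 0) s1" and ?s3 = "den (put 10 12 1) (den (put 10 11 0) s1)"
  have s2: "fst ?s2 = \<sigma>" "rel_of n (snd ?s2) 0 = rel_of n M 0" "rel_of n (snd ?s2) 1 = unlink (rel_of n (snd s1) 1) a b"
    using den_put[of 10 11 s1 0] assms s1 by auto
  have s3: "fst ?s3 = \<sigma>" "rel_of n (snd ?s3) 0 = rel_of n M 0"
    "rel_of n (snd ?s3) 1 = link (unlink (rel_of n (snd s1) 1) a b) a c"
    using den_put[of 10 12 ?s2 1] assms s2 by auto
  have s4: "fst (den (put 11 13 1) ?s3) = \<sigma>" "rel_of n (snd (den (put 11 13 1) ?s3)) 0 = rel_of n M 0"
    "rel_of n (snd (den (put 11 13 1) ?s3)) 1 = link (link (unlink (rel_of n (snd s1) 1) a b) a c) b d"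
    using den_put[of 11 13 ?s3 1] assms s3 by auto
  have M: "den Move s = (if can_swap n (rel_of n M 0) (rel_of n (snd s1) 1) a b c d then den (put 11 13 1) ?s3 else s1)"
  proof -
    have "den Move s = den (When Swap_cond (put 10 11 0 ;; put 10 12 1 ;; put 11 13 1)) s1"
      by (simp only: Move_def den.simps(3) s1_def)
    then show ?thesis using B s1(2) by (simp only: When_tr den.simps(3))
  qed
  show "fst (den Move s) = \<sigma>" "rel_of n (snd (den Move s)) 0 = rel_of n M 0"
    "rel_of n (snd (den Move s)) 1 = move n (rel_of n M 0) (rel_of n M 1) a b c d"
    unfolding M using s1 s4 by (simp_all add: move_def)
qed

text \<open>F collects the quadruples found stuck so far. As long as nothing has changed, F speaks
  about the current relation; after a change F is given up for strict progress. The record that R0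
  was not optimal serves the next sweeps: an optimal relation is never left again.\<close>

definition sweeping :: "nat \<Rightarrow> (nat \<Rightarrow> nat \<Rightarrow> bool) \<Rightarrow> (nat \<Rightarrow> nat \<Rightarrow> bool) \<Rightarrow> bool \<Rightarrow> store \<Rightarrow> bool" where
  "sweeping n E R0 F s \<longleftrightarrow> fst s 0 = n \<and> rel_of n (snd s) 0 = E \<and>
     (let R = rel_of n (snd s) 1 in valid n E R \<and>
       (total n R0 < total n R \<and> \<not> (\<forall>a<n. \<forall>b<n. \<forall>c<n. \<forall>d<n. stuck n E R0 a b c d) \<or> R = R0 \<and> F))"

lemma sweeping_For:
  assumes body: "\<And>j F s. j < n \<Longrightarrow> sweeping n E R0 F s \<Longrightarrow> C (fst s) \<Longrightarrow> fst s v = j \<Longrightarrow>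
      sweeping n E R0 (F \<and> q j) (den c s) \<and> C (fst (den c s))"
    and C: "\<And>\<sigma> x. C \<sigma> \<Longrightarrow> C (\<sigma>(v := x))" and v: "v \<noteq> 0"
    and s: "sweeping n E R0 F s" "C (fst s)"
  shows "sweeping n E R0 (F \<and> (\<forall>j<n. q j)) (den (For v 0 c) s) \<and> C (fst (den (For v 0 c) s))"
proof (rule den_For_induct[where I="\<lambda>i s. sweeping n E R0 (F \<and> (\<forall>j<i. q j)) s \<and> C (fst s)"])
  fix i s assume i: "i < n" and s: "sweeping n E R0 (F \<and> (\<forall>j<i. q j)) s \<and> C (fst s)"
  have "sweeping n E R0 (F \<and> (\<forall>j<i. q j)) (setv v i s)" using s v by (simp add: sweeping_def)
  moreover have "(F \<and> (\<forall>j<i. q j)) \<and> q i \<longleftrightarrow> F \<and> (\<forall>j<Suc i. q j)" by (auto simp: less_Suc_eq)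
  ultimately show "sweeping n E R0 (F \<and> (\<forall>j<Suc i. q j)) (den c (setv v i s)) \<and> C (fst (den c (setv v i s)))"
    using body[OF i, of "F \<and> (\<forall>j<i. q j)" "setv v i s"] s C by simp
qed (use s in \<open>auto simp: sweeping_def\<close>)

lemma sweeping_Sweep:
  assumes E: "graph_on n E"
    and s: "sweeping n E R0 True s"
  shows "sweeping n E R0 (\<forall>a<n. \<forall>b<n. \<forall>c<n. \<forall>d<n. stuck n E R0 a b c d) (den Sweep s)"
proof -
  have move: "sweeping n E R0 (F \<and> stuck n E R0 a b c d) (den Move s) \<and> fst (den Move s) = fst s"
    if "sweeping n E R0 F s" "a < n" "b < n" "c < n" "d < n"
      "fst s 10 = a" "fst s 11 = b" "fst s 12 = c" "fst s 13 = d" for a b c d F and s :: store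
  proof -
    obtain \<sigma> M where sM: "s = (\<sigma>, M)" by (cases s)
    have n: "\<sigma> 0 = n" "rel_of n M 0 = E" using that(1) sM by (auto simp: sweeping_def)
    note D = den_Move[OF sM n(1), of a b c d]
    have D: "fst (den Move s) = \<sigma>" "rel_of n (snd (den Move s)) 0 = E"
      "rel_of n (snd (den Move s)) 1 = move n E (rel_of n M 1) a b c d"
      using D that n sM by auto
    have v: "valid n E (rel_of n M 1)" using that(1) sM by (auto simp: sweeping_def Let_def)
    note mc = move_cases[OF E v, where a=a and b=b and c=c and d=d]
    have tot: "total n (rel_of n M 1) \<le> total n (move n E (rel_of n M 1) a b c d)"
      using mc by (cases "stuck n E (rel_of n M 1) a b c d") auto
    show ?thesis
    proof (cases "total n R0 < total n (rel_of n M 1) \<and> \<not> (\<forall>a<n. \<forall>b<n. \<forall>c<n. \<forall>d<n. stuck n E R0 a b c d)")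
      case True
      then show ?thesis using D tot mc(1) n sM unfolding sweeping_def Let_def by auto
    next
      case False
      then have F: "rel_of n M 1 = R0" "F" using that(1) sM by (auto simp: sweeping_def Let_def)
      show ?thesis
      proof (cases "stuck n E R0 a b c d")
        case True
        then show ?thesis using D mc F n sM unfolding sweeping_def Let_def by auto
      next
        case False
        then have "\<not> (\<forall>a<n. \<forall>b<n. \<forall>c<n. \<forall>d<n. stuck n E R0 a b c d)" using that(2-5) by blast
        then show ?thesis using D mc F n sM False unfolding sweeping_def Let_def by auto
      qed
    qed
  qed
  have 4: "sweeping n E R0 (F \<and> (\<forall>d<n. stuck n E R0 a b c d)) (den (For 13 0 Move) s) \<and>
      (fst (den (For 13 0 Move) s) 10 = a \<and> fst (den (For 13 0 Move) s) 11 = b \<and> fst (den (For 13 0 Move) s) 12 = c)"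
    if "sweeping n E R0 F s" "a < n" "b < n" "c < n" "fst s 10 = a \<and> fst s 11 = b \<and> fst s 12 = c" for a b c F and s :: store
    by (rule sweeping_For[where C="\<lambda>\<sigma>. \<sigma> 10 = a \<and> \<sigma> 11 = b \<and> \<sigma> 12 = c"])
      (use move that in auto)
  have 3: "sweeping n E R0 (F \<and> (\<forall>c<n. \<forall>d<n. stuck n E R0 a b c d)) (den (For 12 0 (For 13 0 Move)) s) \<and>
      (fst (den (For 12 0 (For 13 0 Move)) s) 10 = a \<and> fst (den (For 12 0 (For 13 0 Move)) s) 11 = b)"
    if "sweeping n E R0 F s" "a < n" "b < n" "fst s 10 = a \<and> fst s 11 = b" for a b F and s :: store
    by (rule sweeping_For[where C="\<lambda>\<sigma>. \<sigma> 10 = a \<and> \<sigma> 11 = b"])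
      (use 4 that in \<open>auto simp del: den.simps\<close>)
  have 2: "sweeping n E R0 (F \<and> (\<forall>b<n. \<forall>c<n. \<forall>d<n. stuck n E R0 a b c d)) (den (For 11 0 (For 12 0 (For 13 0 Move))) s) \<and>
      (fst (den (For 11 0 (For 12 0 (For 13 0 Move))) s) 10 = a)"
    if "sweeping n E R0 F s" "a < n" "fst s 10 = a" for a F and s :: store
    by (rule sweeping_For[where C="\<lambda>\<sigma>. \<sigma> 10 = a"]) (use 3 that in \<open>auto simp del: den.simps\<close>)
  have "sweeping n E R0 (True \<and> (\<forall>a<n. \<forall>b<n. \<forall>c<n. \<forall>d<n. stuck n E R0 a b c d)) (den Sweep s) \<and> True"
    unfolding Sweep_def
    by (rule sweeping_For[where C="\<lambda>\<sigma>. True"]) (use 2 s in \<open>auto simp del: den.simps\<close>)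
  then show ?thesis by simp
qed

text \<open>Until an optimum is reached, every sweep raises \<open>total\<close>, so after i sweeps
  it is at least i. It never exceeds \<open>2 * n\<close>, hence \<open>2 * n + 1\<close> sweeps
  suffice and no test for termination is required.\<close>

lemma den_Search:
  assumes E: "graph_on n E"
    and s: "fst s 0 = n" "fst s 4 = 2 * n + 1" "rel_of n (snd s) 0 = E" "valid n E (rel_of n (snd s) 1)"
  shows "rel_of n (snd (den Search s)) 0 = E" "valid n E (rel_of n (snd (den Search s)) 1)"
    "local_opt n E (rel_of n (snd (den Search s)) 1)"
proof -
  define opt where "opt R \<longleftrightarrow> (\<forall>a<n. \<forall>b<n. \<forall>c<n. \<forall>d<n. stuck n E R a b c d)" for R
  define I where "I i s \<longleftrightarrow> fst s 0 = n \<and> rel_of n (snd s) 0 = E \<and> valid n E (rel_of n (snd s) 1) \<and>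
    (i \<le> total n (rel_of n (snd s) 1) \<or> opt (rel_of n (snd s) 1))" for i and s :: store
  have "I (2 * n + 1) (den Search s)" unfolding Search_def
  proof (rule den_For_induct[where I=I])
    show "I 0 s" using s by (simp add: I_def)
    show "2 * n + 1 = fst s 4" using s by simp
    fix i s assume "I i s"
    define R0 where "R0 = rel_of n (snd s) 1"
    have "sweeping n E R0 True (setv 14 i s)"
      using \<open>I i s\<close> by (simp add: sweeping_def I_def R0_def)
    from sweeping_Sweep[OF E this, folded opt_def] \<open>I i s\<close>
    show "I (Suc i) (den Sweep (setv 14 i s))"
      unfolding sweeping_def I_def Let_def R0_def[symmetric] opt_def[symmetric] by auto
  qed
  then have *: "rel_of n (snd (den Search s)) 0 = E" "valid n E (rel_of n (snd (den Search s)) 1)"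
    "2 * n + 1 \<le> total n (rel_of n (snd (den Search s)) 1) \<or> opt (rel_of n (snd (den Search s)) 1)"
    by (simp_all add: I_def)
  show "rel_of n (snd (den Search s)) 0 = E" "valid n E (rel_of n (snd (den Search s)) 1)" by fact+
  have "opt (rel_of n (snd (den Search s)) 1)" using * total_le[OF E *(2)] by simp
  then show "local_opt n E (rel_of n (snd (den Search s)) 1)"
    using stuck_local_opt[OF E] unfolding opt_def by blast
qed

lemma wf_Search: "wf_cmd Search"
  by (simp add: Search_def Sweep_def Move_def put_def Add_cond_def Swap_cond_def size_vars_def)

lemma assigned_Search: "assigned Search = {10, 11, 12, 13, 14}" "updated Search = {1}"
  by (auto simp: Search_def Sweep_def Move_def put_def)

section \<open>Certificates\<close>

context marked_graph
begin

definition idx :: "nat \<Rightarrow> nat" where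
  "idx x = card {w \<in> X. w < x}"

text \<open>Slot \<open>s\<close> of a certificate describes a component outside \<open>X\<close>. The layers 0 and 1 hold the
  neighbourhoods in \<open>X\<close> of its first and its second vertex in the graph, the layers 2 and 3 those
  in the solution; layer 4 tells whether there is a second vertex and layer 5 whether the edge
  inside the component is dropped. Layer 6 holds the solution on \<open>X\<close>. The slot is filled by the
  least matching component that no earlier slot has taken; \<open>pick s\<close> is its first vertex plus one,
  or 0 if there is none.\<close>

definition good :: "nat \<Rightarrow> (nat \<Rightarrow> nat \<Rightarrow> nat \<Rightarrow> bool) \<Rightarrow> (nat \<Rightarrow> nat) \<Rightarrow> nat \<Rightarrow> nat \<Rightarrow> bool" where
  "good P cert pick a s \<longleftrightarrow> first a \<and>
     (\<forall>x\<in>X. (E a x \<longleftrightarrow> cert 0 s (idx x)) \<and> ((\<exists>m. mate a m \<and> E m x) \<longleftrightarrow> cert 1 s (idx x))) \<and>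
     ((\<exists>m. mate a m) \<longleftrightarrow> cert 4 s 0) \<and> (\<forall>s'<P. s' < s \<longrightarrow> pick s' \<noteq> a + 1)"

text \<open>The least good vertex is expressed by a sum with at most one nonzero term, the form in
  which the program computes it.\<close>

definition picks :: "nat \<Rightarrow> (nat \<Rightarrow> nat \<Rightarrow> nat \<Rightarrow> bool) \<Rightarrow> (nat \<Rightarrow> nat) \<Rightarrow> bool" where
  "picks P cert pick \<longleftrightarrow> (\<forall>s<P. pick s =
     (\<Sum>a<n. if good P cert pick a s \<and> \<not> (\<exists>a'<n. a' < a \<and> good P cert pick a' s) then a + 1 else 0))"

definition half :: "nat \<Rightarrow> (nat \<Rightarrow> nat \<Rightarrow> nat \<Rightarrow> bool) \<Rightarrow> (nat \<Rightarrow> nat) \<Rightarrow> nat \<Rightarrow> nat \<Rightarrow> bool" where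
  "half P cert pick u v \<longleftrightarrow> v \<in> X \<and>
     (if u \<in> X then cert 6 (idx u) (idx v)
      else (\<exists>s<P. pick s = u + 1 \<and> cert 2 s (idx v)) \<or>
        (\<exists>s<P. \<exists>m. mate u m \<and> pick s = m + 1 \<and> cert 3 s (idx v)))"

text \<open>The conjunct \<open>E u v\<close> and the symmetric use of \<open>half\<close> turn
  every bit string into a symmetric subrelation of E, so a wrong guess does no harm. Inner edges are
  present by default: components that no slot describes keep them, as in a canonical
  solution.\<close>

definition decode :: "nat \<Rightarrow> (nat \<Rightarrow> nat \<Rightarrow> nat \<Rightarrow> bool) \<Rightarrow> (nat \<Rightarrow> nat) \<Rightarrow> nat \<Rightarrow> nat \<Rightarrow> bool" where
  "decode P cert pick u v \<longleftrightarrow> E u v \<and> (half P cert pick u v \<or> half P cert pick v u \<or>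
     (u \<notin> X \<and> v \<notin> X \<and> \<not> (\<exists>s<P. (pick s = u + 1 \<or> pick s = v + 1) \<and> cert 5 s 0)))"

end

context near_matching
begin

lemma decode_sym_sub: "sym_sub E (decode P cert pick)"
  using E_sym unfolding sym_sub_def decode_def by blast

lemma idx_mono: "x \<in> X \<Longrightarrow> x < y \<Longrightarrow> idx x < idx y"
  unfolding idx_def using finite_X by (intro psubset_card_mono) auto

lemma inj_idx: "inj_on idx X"
  using idx_mono by (metis inj_onI less_irrefl linorder_neqE_nat)

lemma idx_less: "x \<in> X \<Longrightarrow> idx x < card X"
  unfolding idx_def using finite_X by (intro psubset_card_mono) auto

lemma picks_least:
  assumes "picks P cert pick" "s < P" "a < n" "good P cert pick a s" "\<And>a'. a' < a \<Longrightarrow> \<not> good P cert pick a' s"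
  shows "pick s = a + 1"
proof -
  have iff: "good P cert pick b s \<and> \<not> (\<exists>a'<n. a' < b \<and> good P cert pick a' s) \<longleftrightarrow> b = a" if "b < n" for b
    using assms(3-5) that by (metis linorder_neqE_nat)
  have "pick s = (\<Sum>b<n. if good P cert pick b s \<and> \<not> (\<exists>a'<n. a' < b \<and> good P cert pick a' s) then b + 1 else 0)"
    using assms(1,2) unfolding picks_def by blast
  also have "\<dots> = (\<Sum>b<n. if b = a then b + 1 else 0)" by (rule sum.cong) (simp_all only: iff lessThan_iff)
  also have "\<dots> = a + 1" using assms(3) by simp
  finally show ?thesis .
qed

lemma first_ex: "u < n \<Longrightarrow> u \<notin> X \<Longrightarrow> \<exists>a. first a \<and> (a = u \<or> mate a u)"
proof (cases "first u")
  case False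
  assume "u < n" "u \<notin> X"
  then obtain m where m: "m < u" "mate u m" using False by (auto simp: first_def)
  then have "first m" using mate_less[of u m] mate_unique[OF mate_sym[OF m(2)]]
    by (auto simp: first_def mate_def[of u m])
  then show ?thesis using m mate_sym by blast
qed auto

text \<open>Slot s finds exactly the s-th head in increasing order. Slots beyond the heads may pick
  any component, but \<open>b2\<close>, \<open>b3\<close> and \<open>b5\<close>, required for all
  slots, clear their solution bits, so such a pick has no effect.\<close>

lemma decode_canonical:
  assumes R: "sym_sub E R"
    and full: "\<And>u v. mate u v \<Longrightarrow> \<not> R u v \<Longrightarrow> touched R u"
    and down: "\<And>a a'. a \<in> heads R \<Longrightarrow> first a' \<Longrightarrow> same a a' \<Longrightarrow> a' < a \<Longrightarrow> a' \<in> heads R"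
    and hs: "hs = sorted_list_of_set (heads R)" "length hs \<le> P"
    and b0: "\<And>s x. s < length hs \<Longrightarrow> x \<in> X \<Longrightarrow> cert 0 s (idx x) \<longleftrightarrow> E (hs ! s) x"
    and b1: "\<And>s x. s < length hs \<Longrightarrow> x \<in> X \<Longrightarrow> cert 1 s (idx x) \<longleftrightarrow> (\<exists>m. mate (hs ! s) m \<and> E m x)"
    and b2: "\<And>s x. s < P \<Longrightarrow> x \<in> X \<Longrightarrow> cert 2 s (idx x) \<longleftrightarrow> s < length hs \<and> R (hs ! s) x"
    and b3: "\<And>s x. s < P \<Longrightarrow> x \<in> X \<Longrightarrow> cert 3 s (idx x) \<longleftrightarrow>
      s < length hs \<and> (\<exists>m. mate (hs ! s) m \<and> R m x)"
    and b4: "\<And>s. s < length hs \<Longrightarrow> cert 4 s 0 \<longleftrightarrow> (\<exists>m. mate (hs ! s) m)"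
    and b5: "\<And>s. s < P \<Longrightarrow> cert 5 s 0 \<longleftrightarrow> s < length hs \<and> (\<exists>m. mate (hs ! s) m \<and> \<not> R (hs ! s) m)"
    and b6: "\<And>u x. u \<in> X \<Longrightarrow> x \<in> X \<Longrightarrow> cert 6 (idx u) (idx x) \<longleftrightarrow> R u x"
    and pick: "picks P cert pick"
  shows "decode P cert pick = R"
proof -
  have set_hs: "set hs = heads R" and dist: "distinct hs" and sorted: "sorted_wrt (<) hs"
    using finite_heads hs(1) by simp_all
  have head: "first (hs ! s)" "hs ! s \<in> heads R" if "s < length hs" for s
    using set_hs nth_mem[OF that] by (auto simp: heads_def)
  have pick_hs: "pick s = hs ! s + 1" if "s < length hs" for s
    using that
  proof (induction s rule: less_induct)
    case (less s)
    have "good P cert pick (hs ! s) s" unfolding good_def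
    proof (intro conjI ballI allI impI)
      fix s' assume "s' < P" "s' < s"
      then show "pick s' \<noteq> hs ! s + 1"
        using less.IH[of s'] less.prems dist by (simp add: nth_eq_iff_index_eq)
    qed (use head b0 b1 b4 less.prems in auto)
    \<comment> \<open>A smaller candidate has the type of \<open>hs ! s\<close>, hence is itself a
      head by \<open>down\<close>. Being smaller it occurs earlier in hs, and by induction an
      earlier slot has taken it.\<close>
    moreover have "\<not> good P cert pick a' s" if a': "a' < hs ! s" for a'
    proof
      assume g: "good P cert pick a' s"
      have "same (hs ! s) a'"
        using g b0[OF less.prems] b1[OF less.prems] b4[OF less.prems] unfolding good_def same_def by blast
      then have "a' \<in> heads R" using down[OF head(2)[OF less.prems] _ _ a'] g by (simp add: good_def)
      then obtain j where j: "j < length hs" "hs ! j = a'" using set_hs by (metis in_set_conv_nth)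
      have "j < s"
      proof (rule ccontr)
        assume "\<not> j < s"
        then have "hs ! s \<le> hs ! j"
          using sorted_wrt_nth_less[OF sorted, of s j] j(1) by (cases "s = j") auto
        then show False using a' j(2) by simp
      qed
      then show False using g less.IH[of j] j less.prems hs(2) by (auto simp: good_def)
    qed
    moreover have "hs ! s < n" using head(1)[OF less.prems] by (simp add: first_def)
    ultimately show ?case using picks_least[OF pick] less.prems hs(2) by simp
  qed
  have in_heads: "\<exists>s<length hs. hs ! s = a" if "first a" "touched R a" for a
    using set_hs that by (metis (mono_tags) heads_def in_set_conv_nth mem_Collect_eq)
  have R_E: "E u v" "R v u" if "R u v" for u v using R that by (auto simp: sym_sub_def)
  have out: "half P cert pick u x \<longleftrightarrow> R u x" if x: "x \<in> X" and u: "u \<notin> X" for u x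
  proof
    assume "half P cert pick u x"
    then consider s where "s < P" "pick s = u + 1" "cert 2 s (idx x)"
      | s m where "s < P" "mate u m" "pick s = m + 1" "cert 3 s (idx x)"
      using u unfolding half_def by auto
    then show "R u x"
    proof cases
      case 1
      then show ?thesis using b2[OF 1(1) x] pick_hs[of s] by simp
    next
      case 2
      then obtain m' where "mate m m'" "R m' x" using b3[OF 2(1) x] pick_hs[of s] by auto
      then show ?thesis using mate_unique mate_sym[OF 2(2)] by blast
    qed
  next
    assume Ru: "R u x"
    then have "u < n" using R_E E_less by blast
    then obtain a where a: "first a" "a = u \<or> mate a u" using first_ex u by blast
    then have "touched R a" using Ru x by (auto simp: touched_def)
    then obtain s where s: "s < length hs" "hs ! s = a" using in_heads a(1) by blast
    then have sP: "s < P" using hs(2) by simp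
    show "half P cert pick u x"
    proof (cases "a = u")
      case True
      then have "pick s = u + 1 \<and> cert 2 s (idx x)" using b2[OF sP x] pick_hs[OF s(1)] s Ru by simp
      then show ?thesis using x u sP unfolding half_def by auto
    next
      case False
      then have "mate a u" using a by simp
      then have "mate u a \<and> pick s = a + 1 \<and> cert 3 s (idx x)"
        using b3[OF sP x] pick_hs[OF s(1)] s Ru mate_sym by auto
      then show ?thesis using x u sP unfolding half_def by auto
    qed
  qed
  have inner: "decode P cert pick u v \<longleftrightarrow> R u v" if u: "u \<notin> X" and v: "v \<notin> X" for u v
  proof
    assume d: "decode P cert pick u v"
    then have m: "mate u v" and nos: "\<And>s. s < P \<Longrightarrow> pick s = u + 1 \<or> pick s = v + 1 \<Longrightarrow> \<not> cert 5 s 0"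
      using u v unfolding decode_def half_def mate_def by auto
    show "R u v"
    proof (rule ccontr)
      assume nR: "\<not> R u v"
      then have t: "touched R u" "touched R v" using full[OF m] touched_mate[OF m] by auto
      obtain a where a: "first a" "a = u \<or> mate a u" using first_ex[of u] u mate_less[OF m] by blast
      then have "a = u \<or> a = v" using mate_unique[OF m, of a] mate_sym[of a u] by auto
      then have a': "touched R a" "\<exists>m. mate a m \<and> \<not> R a m" "pick s = a + 1 \<Longrightarrow> pick s = u + 1 \<or> pick s = v + 1" for s
        using t m mate_sym[OF m] nR R_E(2) by auto
      obtain s where s: "s < length hs" "hs ! s = a" using in_heads[OF a(1) a'(1)] by blast
      then have "s < P" "pick s = a + 1" using hs(2) pick_hs by auto
      moreover have "cert 5 s 0" using b5[OF \<open>s < P\<close>] a'(2) s by simp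
      ultimately show False using nos a'(3) by blast
    qed
  next
    assume Ru: "R u v"
    have m: "mate u v" using R_E(1)[OF Ru] u v by (simp add: mate_def)
    have "\<not> cert 5 s 0" if s: "s < P" "pick s = u + 1 \<or> pick s = v + 1" for s
    proof
      assume b: "cert 5 s 0"
      then obtain m' where m': "s < length hs" "mate (hs ! s) m'" "\<not> R (hs ! s) m'" using b5[OF s(1)] by auto
      then have "hs ! s = u \<or> hs ! s = v" using s(2) pick_hs by auto
      then show False using m' m mate_unique mate_sym[OF m] Ru R_E(2) by blast
    qed
    then show "decode P cert pick u v" using R_E(1)[OF Ru] u v unfolding decode_def by blast
  qed
  have "decode P cert pick u v \<longleftrightarrow> R u v" for u v
  proof -
    consider "u \<in> X" "v \<in> X" | "u \<notin> X" "v \<in> X" | "u \<in> X" "v \<notin> X" | "u \<notin> X" "v \<notin> X" by blast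
    then show ?thesis
    proof cases
      case 1
      then have "half P cert pick u v \<longleftrightarrow> R u v" "half P cert pick v u \<longleftrightarrow> R v u"
        using b6 by (simp_all add: half_def)
      then show ?thesis using 1 R_E unfolding decode_def by blast
    next
      case 2
      then have "\<not> half P cert pick v u" by (simp add: half_def)
      then show ?thesis using out[OF 2(2,1)] 2 R_E unfolding decode_def by blast
    next
      case 3
      then have "\<not> half P cert pick u v" by (simp add: half_def)
      then show ?thesis using out[OF 3(1,2)] 3 R_E unfolding decode_def by blast
    next
      case 4
      then show ?thesis by (rule inner)
    qed
  qed
  then show ?thesis by (simp add: fun_eq_iff)
qed

end

section \<open>Bit strings as numbers\<close>

lemma exists_code: "\<exists>c<2 ^ L. \<forall>i<L. (c div 2 ^ i) mod 2 = (of_bool (B i) :: nat)" for L :: nat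
proof (induction L)
  case (Suc L)
  then obtain c where c: "c < 2 ^ L" "\<forall>i<L. (c div 2 ^ i) mod 2 = (of_bool (B i) :: nat)" by blast
  define c' where "c' = c + of_bool (B L) * 2 ^ L"
  have "c' < 2 ^ Suc L" using c(1) by (simp add: c'_def)
  moreover have "(c' div 2 ^ i) mod 2 = (of_bool (B i) :: nat)" if "i < Suc L" for i
  proof (cases "i = L")
    case True
    then show ?thesis using c(1) by (simp add: c'_def)
  next
    case False
    then have i: "i < L" using that by simp
    \<comment> \<open>Divided by \<open>2 ^ i\<close>, the new top digit contributes an even number,
      so the lower digits do not change.\<close>
    define k where "k = L - i - 1"
    have "(2::nat) ^ L = 2 ^ i * (2 * 2 ^ k)" using i by (simp add: k_def flip: power_add power_Suc)
    then have "c' = c + 2 ^ i * (2 * (of_bool (B L) * 2 ^ k))" by (simp add: c'_def)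
    then have "c' div 2 ^ i = c div 2 ^ i + 2 * (of_bool (B L) * 2 ^ k)" by simp
    then show ?thesis using c(2) i by simp
  qed
  ultimately show ?case by blast
qed simp

context near_matching
begin

text \<open>The claim covers every cert that agrees with the digits of c in the relevant range.
  Outside it the program reads cells about which nothing is asserted.\<close>

lemma exists_certificate:
  assumes R: "sym_sub E R" "star_free t n E R" and t: "t \<ge> 2" and P: "P = (t - 1) * card X"
  shows "\<exists>c<(2::nat) ^ (7 * (card X * P)). \<forall>cert pick.
    (\<forall>l<7. \<forall>s<P. \<forall>j<card X. cert l s j \<longleftrightarrow> (c div 2 ^ (7 * (j * P + s) + l)) mod 2 = 1) \<and>
      picks P cert pick \<longrightarrow>
    star_free t n E (decode P cert pick) \<and> total n R \<le> total n (decode P cert pick)"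
proof -
  obtain S where S: "sym_sub E S" "star_free t n E S" "total n R \<le> total n S"
    and full: "\<And>u v. mate u v \<Longrightarrow> \<not> S u v \<Longrightarrow> touched S u"
    and down: "\<And>a a'. a \<in> heads S \<Longrightarrow> first a' \<Longrightarrow> same a a' \<Longrightarrow> a' < a \<Longrightarrow> a' \<in> heads S"
    using canonical_solution[OF R t] by blast
  define hs where "hs = sorted_list_of_set (heads S)"
  have len: "length hs \<le> P"
    using card_heads[OF S(1,2)] t P by (simp add: hs_def)
  define g where "g = the_inv_into X idx"
  have g: "g (idx x) = x" if "x \<in> X" for x unfolding g_def using the_inv_into_f_f[OF inj_idx that] .
  define W where "W l s j \<longleftrightarrow>
      (if l = 6 then S (g s) (g j) else s < length hs \<and>
       (if l = 0 then E (hs ! s) (g j) else if l = 1 then (\<exists>m. mate (hs ! s) m \<and> E m (g j))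
        else if l = 2 then S (hs ! s) (g j) else if l = 3 then (\<exists>m. mate (hs ! s) m \<and> S m (g j))
        else if l = 4 then (\<exists>m. mate (hs ! s) m)
        else (\<exists>m. mate (hs ! s) m \<and> \<not> S (hs ! s) m)))" for l s j :: nat
  \<comment> \<open>Inverse of the mixed radix address \<open>7 * (j * P + s) + l\<close> with l
    below 7 and s below P.\<close>
  define B where "B i = W (i mod 7) (i div 7 mod P) (i div 7 div P)" for i
  obtain c where c: "c < 2 ^ (7 * (card X * P))"
    "\<forall>i<7 * (card X * P). (c div 2 ^ i) mod 2 = (of_bool (B i) :: nat)"
    using exists_code by blast
  have code: "(c div 2 ^ (7 * (j * P + s) + l)) mod 2 = 1 \<longleftrightarrow> W l s j"
    if "l < 7" "s < P" "j < card X" for l s j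
  proof -
    have "j * P + s < (j + 1) * P" using that by simp
    also have "\<dots> \<le> card X * P" using that by (intro mult_le_mono1) simp
    finally have "7 * Suc (j * P + s) \<le> 7 * (card X * P)" by (intro mult_le_mono2) simp
    then have "7 * (j * P + s) + l < 7 * (card X * P)" using that(1) by simp
    then have "(c div 2 ^ (7 * (j * P + s) + l)) mod 2 = (of_bool (B (7 * (j * P + s) + l)) :: nat)"
      using c(2) by blast
    moreover have digits: "(7 * x + l) mod 7 = l" "(7 * x + l) div 7 = x" for x
      using that(1) by presburger+
    have "B (7 * (j * P + s) + l) = W l s j" unfolding B_def digits using that(2) by simp
    ultimately show ?thesis by (simp only: of_bool_eq_1_iff)
  qed
  show ?thesis
  proof (intro exI[of _ c] conjI c(1) allI impI)
    fix cert pick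
    assume *: "(\<forall>l<7. \<forall>s<P. \<forall>j<card X. cert l s j \<longleftrightarrow> (c div 2 ^ (7 * (j * P + s) + l)) mod 2 = 1) \<and>
      picks P cert pick"
    then have cert: "cert l s j \<longleftrightarrow> W l s j" if "l < 7" "s < P" "j < card X" for l s j
      using code[OF that] that by blast
    \<comment> \<open>The flags of layers 4 and 5 are stored in column 0, which exists only if X is
      nonempty. The next fact, from t at least 2, makes room for layer 6, where the rank of a heavy
      vertex serves as slot number.\<close>
    have q: "0 < card X" if "s < P" for s using that P by (cases "card X") auto
    have qP: "card X \<le> P" unfolding P using t by (cases "t - 1") auto
    have "decode P cert pick = S"
    proof (rule decode_canonical[OF S(1) full down hs_def len])
      show "cert 6 (idx u) (idx x) \<longleftrightarrow> S u x" if "u \<in> X" "x \<in> X" for u x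
        using cert[of 6 "idx u" "idx x"] idx_less[OF that(1)] idx_less[OF that(2)] qP g that by (simp add: W_def)
      show "picks P cert pick" using * by blast
      show "cert 0 s (idx x) \<longleftrightarrow> E (hs ! s) x" "cert 1 s (idx x) \<longleftrightarrow> (\<exists>m. mate (hs ! s) m \<and> E m x)"
        if "s < length hs" "x \<in> X" for s x
        using cert[of 0 s "idx x"] cert[of 1 s "idx x"] idx_less[OF that(2)] len g that by (simp_all add: W_def)
      show "cert 2 s (idx x) \<longleftrightarrow> s < length hs \<and> S (hs ! s) x"
        "cert 3 s (idx x) \<longleftrightarrow> s < length hs \<and> (\<exists>m. mate (hs ! s) m \<and> S m x)"
        if "s < P" "x \<in> X" for s x
        using cert[of 2 s "idx x"] cert[of 3 s "idx x"] idx_less[OF that(2)] g that by (simp_all add: W_def)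
      show "cert 4 s 0 \<longleftrightarrow> (\<exists>m. mate (hs ! s) m)" if "s < length hs" for s
        using cert[of 4 s 0] q[of s] len that by (simp add: W_def)
      show "cert 5 s 0 \<longleftrightarrow> s < length hs \<and> (\<exists>m. mate (hs ! s) m \<and> \<not> S (hs ! s) m)" if "s < P" for s
        using cert[of 5 s 0] q[of s] that by (simp add: W_def)
    qed
    then show "star_free t n E (decode P cert pick)" "total n R \<le> total n (decode P cert pick)"
      using S by simp_all
  qed
qed

end

section \<open>The program\<close>

text \<open>Variables: 0 number of vertices, 1 requested number of edges, 2 number of slots, 3 length of a
  certificate, 4 number of sweeps, 5 number of certificates, 6 answer, 7 current certificate; the
  others are bound or temporary. Arrays: 0 graph, 1 local search subgraph, 2 bits of the current
  certificate, 3 components picked by the slots, 4 powers of two.\<close>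

definition heavy :: "nat \<Rightarrow> (nat \<Rightarrow> nat \<Rightarrow> bool) \<Rightarrow> nat set" where
  "heavy n R = {u. u < n \<and> deg n R u = 2}"

abbreviation EM :: "(nat \<Rightarrow> nat) \<Rightarrow> (nat \<Rightarrow> nat) \<Rightarrow> nat \<Rightarrow> nat \<Rightarrow> bool" where
  "EM \<sigma> M \<equiv> rel_of (\<sigma> 0) M 0"

abbreviation XM :: "(nat \<Rightarrow> nat) \<Rightarrow> (nat \<Rightarrow> nat) \<Rightarrow> nat set" where
  "XM \<sigma> M \<equiv> heavy (\<sigma> 0) (rel_of (\<sigma> 0) M 1)"

text \<open>The minimum reflects the truncation in \<open>Mul\<close>. It has no effect on columns
  below \<open>card X\<close>, which is at most n.\<close>

definition certs :: "nat \<Rightarrow> nat \<Rightarrow> (nat \<Rightarrow> nat) \<Rightarrow> nat \<Rightarrow> nat \<Rightarrow> nat \<Rightarrow> bool" where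
  "certs n P M l s j \<longleftrightarrow> M (cell 2 (7 * (min j n * P + s) + l)) \<noteq> 0"

definition picked :: "(nat \<Rightarrow> nat) \<Rightarrow> nat \<Rightarrow> nat" where
  "picked M s = M (cell 3 s)"

definition "In_heavy u = Conj (Less (Var u) (Var 0)) (Equ (Deg u) (Num 2))"
definition "Mate u m = Conj (Neg (In_heavy u)) (Conj (Neg (In_heavy m)) (Cell 0 u m))"
definition "First a = Conj (Less (Var a) (Var 0)) (Conj (Neg (In_heavy a))
   (Neg (Exi 18 0 (Conj (Less (Var 18) (Var a)) (Mate a 18)))))"
definition "Idx x = Count 17 0 (Conj (Less (Var 17) (Var x)) (In_heavy 17))"
definition "Cert l s j = Arr 2 (Plus (times 7 (Plus (Mul j (Var 2)) s)) (Num l))"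
definition "Pick s u = Equ (Arr 3 (Var s)) (Plus (Var u) (Num 1))"

definition "Good a s = Conj (First a) (Conj
   (Univ 21 0 (Disj (Neg (In_heavy 21)) (Conj
      (Iff (Cell 0 a 21) (Cert 0 (Var s) (Idx 21)))
      (Iff (Exi 18 0 (Conj (Mate a 18) (Cell 0 18 21))) (Cert 1 (Var s) (Idx 21))))))
   (Conj (Iff (Exi 18 0 (Mate a 18)) (Cert 4 (Var s) (Num 0)))
     (Univ 23 2 (Disj (Neg (Less (Var 23) (Var s))) (Neg (Pick 23 a))))))"

definition "Half u v = Conj (In_heavy v) (Ite (In_heavy u) (Cert 6 (Idx u) (Idx v))
   (Disj (Exi 20 2 (Conj (Pick 20 u) (Cert 2 (Var 20) (Idx v))))
     (Exi 20 2 (Exi 18 0 (Conj (Mate u 18) (Conj (Pick 20 18) (Cert 3 (Var 20) (Idx v))))))))"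

definition "Decode u v = Conj (Cell 0 u v) (Disj (Half u v) (Disj (Half v u)
   (Conj (Neg (In_heavy u)) (Conj (Neg (In_heavy v))
     (Neg (Exi 20 2 (Conj (Disj (Pick 20 u) (Pick 20 v)) (Cert 5 (Var 20) (Num 0)))))))))"

lemma tr_In_heavy [simp]:
  "u \<noteq> 15 \<Longrightarrow> u \<noteq> 16 \<Longrightarrow> tr (In_heavy u) \<sigma> M \<longleftrightarrow> \<sigma> u \<in> XM \<sigma> M"
  by (simp add: In_heavy_def heavy_def)

lemma tr_Mate [simp]:
  "u \<noteq> 15 \<Longrightarrow> u \<noteq> 16 \<Longrightarrow> m \<noteq> 15 \<Longrightarrow> m \<noteq> 16 \<Longrightarrow>
    tr (Mate u m) \<sigma> M \<longleftrightarrow> marked_graph.mate (EM \<sigma> M) (XM \<sigma> M) (\<sigma> u) (\<sigma> m)"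
  by (simp add: Mate_def marked_graph.mate_def)

lemma mate_rel_of_less: "marked_graph.mate (rel_of n M a) X u m \<Longrightarrow> u < n \<and> m < n"
  by (simp add: marked_graph.mate_def rel_of_def)

lemma tr_First [simp]:
  "u \<notin> {15, 16, 18} \<Longrightarrow> u \<noteq> 0 \<Longrightarrow>
    tr (First u) \<sigma> M \<longleftrightarrow> marked_graph.first (\<sigma> 0) (EM \<sigma> M) (XM \<sigma> M) (\<sigma> u)"
  by (auto simp: First_def marked_graph.first_def dest: mate_rel_of_less)

lemma ev_Idx [simp]:
  "u \<notin> {15, 16, 17} \<Longrightarrow> ev (Idx u) \<sigma> M = marked_graph.idx (XM \<sigma> M) (\<sigma> u)"
proof -
  assume u: "u \<notin> {15, 16, 17}"
  have "{i. i < \<sigma> 0 \<and> tr (Conj (Less (Var 17) (Var u)) (In_heavy 17)) (\<sigma>(17 := i)) M} =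
      {w \<in> XM \<sigma> M. w < \<sigma> u}"
    using u by (auto simp: heavy_def)
  then show ?thesis by (simp only: Idx_def ev_Count marked_graph.idx_def)
qed

lemma tr_Cert:
  assumes "\<And>i. ev j (\<sigma>(15 := i)) M = ev j \<sigma> M"
  shows "tr (Cert l s j) \<sigma> M \<longleftrightarrow> certs (\<sigma> 0) (\<sigma> 2) M l (ev s \<sigma> M) (ev j \<sigma> M)"
proof -
  have "ev (Mul j (Var 2)) \<sigma> M = min (ev j \<sigma> M) (\<sigma> 0) * \<sigma> 2"
    using ev_Mul[of j \<sigma> M "Var 2"] assms by simp
  then show ?thesis by (simp add: Cert_def certs_def)
qed

lemma tr_Cert_Num [simp]: "tr (Cert l s (Num x)) \<sigma> M \<longleftrightarrow> certs (\<sigma> 0) (\<sigma> 2) M l (ev s \<sigma> M) x"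
  by (simp add: tr_Cert)

lemma tr_Cert_Idx [simp]:
  "u \<notin> {15, 16, 17} \<Longrightarrow>
    tr (Cert l s (Idx u)) \<sigma> M \<longleftrightarrow> certs (\<sigma> 0) (\<sigma> 2) M l (ev s \<sigma> M) (marked_graph.idx (XM \<sigma> M) (\<sigma> u))"
  by (simp add: tr_Cert)

lemma tr_Pick [simp]: "tr (Pick s u) \<sigma> M \<longleftrightarrow> picked M (\<sigma> s) = \<sigma> u + 1"
  by (simp add: Pick_def picked_def)

lemma ball_heavy: "(\<forall>x\<in>heavy n R. Q x) \<longleftrightarrow> (\<forall>x<n. x \<notin> heavy n R \<or> Q x)"
  by (auto simp: heavy_def)

lemma ex_mate:
  "(\<exists>m. marked_graph.mate (rel_of n M a) X u m \<and> Q m) \<longleftrightarrow>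
   (\<exists>m<n. marked_graph.mate (rel_of n M a) X u m \<and> Q m)"
  "(\<exists>m. marked_graph.mate (rel_of n M a) X u m) \<longleftrightarrow>
   (\<exists>m<n. marked_graph.mate (rel_of n M a) X u m)"
  using mate_rel_of_less by blast+

lemma tr_Good [simp]:
  "a \<ge> 24 \<Longrightarrow> s \<notin> {15, 16, 17, 18, 21, 23} \<Longrightarrow> s \<noteq> 0 \<Longrightarrow> s \<noteq> 2 \<Longrightarrow>
    tr (Good a s) \<sigma> M \<longleftrightarrow> marked_graph.good (\<sigma> 0) (EM \<sigma> M) (XM \<sigma> M) (\<sigma> 2)
      (certs (\<sigma> 0) (\<sigma> 2) M) (picked M) (\<sigma> a) (\<sigma> s)"
  unfolding Good_def marked_graph.good_def ball_heavy ex_mate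
  by simp

lemma tr_Half [simp]:
  "u \<ge> 24 \<Longrightarrow> v \<ge> 24 \<Longrightarrow>
    tr (Half u v) \<sigma> M \<longleftrightarrow> marked_graph.half (EM \<sigma> M) (XM \<sigma> M) (\<sigma> 2)
      (certs (\<sigma> 0) (\<sigma> 2) M) (picked M) (\<sigma> u) (\<sigma> v)"
  unfolding Half_def marked_graph.half_def ex_mate by simp

lemma tr_Decode [simp]:
  "u \<ge> 24 \<Longrightarrow> v \<ge> 24 \<Longrightarrow>
    tr (Decode u v) \<sigma> M \<longleftrightarrow> marked_graph.decode (EM \<sigma> M) (XM \<sigma> M) (\<sigma> 2)
      (certs (\<sigma> 0) (\<sigma> 2) M) (picked M) (\<sigma> u) (\<sigma> v)"
  unfolding Decode_def marked_graph.decode_def by simp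

lemma wf_macros [simp]:
  "wf_exp (In_heavy u)" "wf_exp (Mate u m)" "wf_exp (First u)" "wf_exp (Idx u)"
  "wf_exp s \<Longrightarrow> wf_exp j \<Longrightarrow> wf_exp (Cert l s j)" "wf_exp (Pick u v)"
  by (simp_all add: In_heavy_def Mate_def First_def Idx_def Cert_def Pick_def size_vars_def)

lemma wf_Good [simp]: "wf_exp (Good a s)" "wf_exp (Half u v)" "wf_exp (Decode u v)"
  by (simp_all add: Good_def Half_def Decode_def size_vars_def)

text \<open>\<open>Tuple m us\<close> extends the vertices in the variables \<open>us\<close> by \<open>m\<close> further pairwise non-adjacent
  neighbours of the vertex in variable 24.\<close>

primrec Apart :: "nat \<Rightarrow> nat list \<Rightarrow> exp" where
  "Apart w [] = Num 1"
| "Apart w (u # us) = Conj (Conj (Neg (Equ (Var u) (Var w))) (Conj (Neg (Cell 0 u w)) (Neg (Cell 0 w u))))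
     (Apart w us)"

primrec Tuple :: "nat \<Rightarrow> nat list \<Rightarrow> exp" where
  "Tuple 0 us = Num 1"
| "Tuple (Suc m) us = Exi (40 + m) 0 (Conj (Decode 24 (40 + m)) (Conj (Neg (Cell 0 (40 + m) (40 + m)))
     (Conj (Apart (40 + m) us) (Tuple m ((40 + m) # us)))))"

lemma tr_Apart: "w \<ge> 24 \<Longrightarrow> \<forall>u\<in>set us. u \<ge> 24 \<Longrightarrow> tr (Apart w us) \<sigma> M \<longleftrightarrow>
    (\<forall>u\<in>set us. \<sigma> u \<noteq> \<sigma> w \<and> \<not> EM \<sigma> M (\<sigma> u) (\<sigma> w) \<and> \<not> EM \<sigma> M (\<sigma> w) (\<sigma> u))"
  by (induction us) auto

lemma wf_Apart [simp]: "wf_exp (Apart w us)"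
  by (induction us) auto

lemma wf_Tuple [simp]: "wf_exp (Tuple m us)"
  by (induction m arbitrary: us) (auto simp: size_vars_def)

text \<open>Two valuations are needed: descending through the nested quantifiers changes \<tau>, but
  the decoded relation depends on variables 0 and 2 only and stays the one given by
  \<sigma>.\<close>

lemma tr_Tuple:
  fixes \<sigma> M
  defines "D \<equiv> marked_graph.decode (EM \<sigma> M) (XM \<sigma> M) (\<sigma> 2) (certs (\<sigma> 0) (\<sigma> 2) M) (picked M)"
  assumes "\<tau> 0 = \<sigma> 0" "\<tau> 2 = \<sigma> 2" "\<tau> 24 = v" "\<forall>u\<in>set us. u \<ge> 40 + m"
  shows "tr (Tuple m us) \<tau> M \<longleftrightarrow> (\<exists>U\<subseteq>{..<\<sigma> 0}. card U = m \<and> (\<forall>u\<in>U. D v u) \<and>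
    (\<forall>u\<in>U. \<forall>w\<in>U. \<not> EM \<sigma> M u w) \<and>
    (\<forall>x\<in>set us. \<forall>u\<in>U. \<tau> x \<noteq> u \<and> \<not> EM \<sigma> M (\<tau> x) u \<and> \<not> EM \<sigma> M u (\<tau> x)))"
  using assms(2-)
proof (induction m arbitrary: us \<tau>)
  case 0
  then show ?case by (auto intro!: exI[of _ "{}"])
next
  case (Suc m)
  let ?E = "EM \<sigma> M"
  let ?w = "40 + m"
  let ?A = "\<lambda>us \<tau> U. \<forall>x\<in>set us. \<forall>u\<in>U. \<tau> x \<noteq> u \<and> \<not> ?E (\<tau> x) u \<and> \<not> ?E u (\<tau> x)"
  let ?U = "\<lambda>m U. U \<subseteq> {..<\<sigma> 0} \<and> card U = m \<and> (\<forall>u\<in>U. D v u) \<and> (\<forall>u\<in>U. \<forall>w\<in>U. \<not> ?E u w)"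
  have us: "\<forall>u\<in>set us. u \<ge> 24" "?w \<notin> set us" using Suc.prems by auto
  have upd: "(\<tau>(?w := i)) x = \<tau> x" if "x \<in> set us" for i x using us that by auto
  have "tr (Tuple (Suc m) us) \<tau> M \<longleftrightarrow> (\<exists>i<\<sigma> 0. D v i \<and> \<not> ?E i i \<and>
      (\<forall>u\<in>set us. \<tau> u \<noteq> i \<and> \<not> ?E (\<tau> u) i \<and> \<not> ?E i (\<tau> u)) \<and>
      tr (Tuple m (?w # us)) (\<tau>(?w := i)) M)"
    using Suc.prems us upd by (simp add: tr_Apart D_def del: fun_upd_apply) (simp)
  also have "\<dots> \<longleftrightarrow> (\<exists>i<\<sigma> 0. D v i \<and> \<not> ?E i i \<and>
      (\<forall>u\<in>set us. \<tau> u \<noteq> i \<and> \<not> ?E (\<tau> u) i \<and> \<not> ?E i (\<tau> u)) \<and>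
      (\<exists>U. ?U m U \<and> ?A (?w # us) (\<tau>(?w := i)) U))"
  proof -
    have "tr (Tuple m (?w # us)) (\<tau>(?w := i)) M \<longleftrightarrow> (\<exists>U. ?U m U \<and> ?A (?w # us) (\<tau>(?w := i)) U)" for i
    proof -
      have prems: "(\<tau>(?w := i)) 0 = \<sigma> 0" "(\<tau>(?w := i)) 2 = \<sigma> 2" "(\<tau>(?w := i)) 24 = v"
        "\<forall>u\<in>set (?w # us). 40 + m \<le> u" using Suc.prems by auto
      show ?thesis by (simp only: Suc.IH[OF prems] conj_assoc)
    qed
    then show ?thesis by (simp only:)
  qed
  also have "\<dots> \<longleftrightarrow> (\<exists>U. ?U (Suc m) U \<and> ?A us \<tau> U)"
  proof
    assume "\<exists>i<\<sigma> 0. D v i \<and> \<not> ?E i i \<and>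
      (\<forall>u\<in>set us. \<tau> u \<noteq> i \<and> \<not> ?E (\<tau> u) i \<and> \<not> ?E i (\<tau> u)) \<and>
      (\<exists>U. ?U m U \<and> ?A (?w # us) (\<tau>(?w := i)) U)"
    then obtain i U where i: "i < \<sigma> 0" "D v i" "\<not> ?E i i"
      "\<forall>u\<in>set us. \<tau> u \<noteq> i \<and> \<not> ?E (\<tau> u) i \<and> \<not> ?E i (\<tau> u)" and U: "?U m U"
      and A: "?A (?w # us) (\<tau>(?w := i)) U" by blast
    have A1: "\<forall>u\<in>U. i \<noteq> u \<and> \<not> ?E i u \<and> \<not> ?E u i" using A by simp
    have A2: "?A us \<tau> U" using A upd by auto
    have "finite U" using U finite_subset by blast
    then have "?U (Suc m) (insert i U)" using U i A1 by auto
    moreover have "?A us \<tau> (insert i U)" using A2 i by auto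
    ultimately show "\<exists>U. ?U (Suc m) U \<and> ?A us \<tau> U" by blast
  next
    assume "\<exists>U. ?U (Suc m) U \<and> ?A us \<tau> U"
    then obtain U where U: "?U (Suc m) U" "?A us \<tau> U" by blast
    then obtain i U' where i: "U = insert i U'" "i \<notin> U'" "card U' = m"
      by (metis card_Suc_eq)
    have "?U m U'" using U i by auto
    moreover have "?A (?w # us) (\<tau>(?w := i)) U'" using U i upd by auto
    moreover have "i < \<sigma> 0" "D v i" "\<not> ?E i i"
      "\<forall>u\<in>set us. \<tau> u \<noteq> i \<and> \<not> ?E (\<tau> u) i \<and> \<not> ?E i (\<tau> u)" using U i by auto
    ultimately show "\<exists>i<\<sigma> 0. D v i \<and> \<not> ?E i i \<and>
      (\<forall>u\<in>set us. \<tau> u \<noteq> i \<and> \<not> ?E (\<tau> u) i \<and> \<not> ?E i (\<tau> u)) \<and>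
      (\<exists>U. ?U m U \<and> ?A (?w # us) (\<tau>(?w := i)) U)" by blast
  qed
  finally show ?case by (simp only: conj_assoc)
qed

definition Total :: "(nat \<Rightarrow> nat \<Rightarrow> exp) \<Rightarrow> exp" where
  "Total R = Sum 24 0 (Count 25 0 (R 24 25))"

lemma ev_Total:
  assumes "\<And>i j. i < \<sigma> 0 \<Longrightarrow> j < \<sigma> 0 \<Longrightarrow> tr (R 24 25) (\<sigma>(24 := i, 25 := j)) M \<longleftrightarrow> Q i j"
  shows "ev (Total R) \<sigma> M = total (\<sigma> 0) Q"
proof -
  have "{j. j < \<sigma> 0 \<and> tr (R 24 25) (\<sigma>(24 := i, 25 := j)) M} = {u. u < \<sigma> 0 \<and> Q i u}" if "i < \<sigma> 0" for i
    using assms that by auto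
  then show ?thesis by (simp add: Total_def total_def deg_def)
qed

definition "Enough R = Neg (Less (Total R) (Plus (Var 1) (Var 1)))"

text \<open>Repeated doubling leaves in variable 5 the number of certificates to be tried.\<close>

definition Powers :: cmd where
  "Powers = (Assign 5 (Num 1) ;; For 9 3 (Upd 4 (Var 9) (Var 5) ;; Assign 5 (Plus (Var 5) (Var 5))))"

text \<open>Without division the bits are found from the top: compare the remainder in variable 8
  with the stored power and subtract it if it fits.\<close>

definition Unpack :: cmd where
  "Unpack = (Assign 8 (Var 7) ;; For 9 3 (Assign 19 (Minus (Minus (Var 3) (Num 1)) (Var 9)) ;;
     Upd 2 (Var 19) (Neg (Less (Var 8) (Arr 4 (Var 19)))) ;;
     When (Arr 2 (Var 19)) (Assign 8 (Minus (Var 8) (Arr 4 (Var 19))))))"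

definition Fill :: cmd where
  "Fill = For 22 2 (Upd 3 (Var 22) (Sum 30 0 (Ite (Conj (Good 30 22)
     (Neg (Exi 31 0 (Conj (Less (Var 31) (Var 30)) (Good 31 22))))) (Plus (Var 30) (Num 1)) (Num 0))))"

definition Check :: "nat \<Rightarrow> cmd" where
  "Check t = When (Conj (Neg (Exi 24 0 (Tuple t []))) (Enough Decode)) (Assign 6 (Num 1))"

definition Try :: "nat \<Rightarrow> cmd" where
  "Try t = (Unpack ;; Fill ;; Check t)"

text \<open>If the local search subgraph is large enough, the answer is already known and the
  certificate length becomes 0. The main loop then runs once, which cannot reset the answer; trying
  all certificates would not be covered by the time bound.\<close>

definition Prepare :: "nat \<Rightarrow> cmd" where
  "Prepare t = (Assign 4 (Plus (Plus (Var 0) (Var 0)) (Num 1)) ;; Search ;;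
     Assign 2 (times (t - 1) (Count 24 0 (In_heavy 24))) ;;
     Assign 3 (Ite (Enough (Cell 1)) (Num 0) (times 7 (Mul (Count 24 0 (In_heavy 24)) (Var 2)))) ;;
     Powers ;; Assign 6 (Enough (Cell 1)))"

definition Main :: "nat \<Rightarrow> cmd" where
  "Main t = (Prepare t ;; For 7 5 (Try t))"

section \<open>Correctness of the program\<close>

lemma den_Powers:
  "fst (den Powers s) 5 = 2 ^ fst s 3"
  "i < fst s 3 \<Longrightarrow> snd (den Powers s) (cell 4 i) = 2 ^ i"
proof -
  define I where "I i s' \<longleftrightarrow> fst s' 5 = 2 ^ i \<and> (\<forall>j<i. snd s' (cell 4 j) = 2 ^ j)" for i and s' :: store
  have "I (fst s 3) (den (For 9 3 (Upd 4 (Var 9) (Var 5) ;; Assign 5 (Plus (Var 5) (Var 5)))) (setv 5 1 s))"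
    by (rule den_For_induct[where I=I]) (auto simp: I_def less_Suc_eq)
  then show "fst (den Powers s) 5 = 2 ^ fst s 3"
    "i < fst s 3 \<Longrightarrow> snd (den Powers s) (cell 4 i) = 2 ^ i"
    by (simp_all add: Powers_def I_def del: den.simps(5))
qed

lemma den_Unpack:
  assumes pw: "\<And>i. i < fst s 3 \<Longrightarrow> snd s (cell 4 i) = 2 ^ i" and c: "fst s 7 < 2 ^ fst s 3" and i: "i < fst s 3"
  shows "snd (den Unpack s) (cell 2 i) = (fst s 7 div 2 ^ i) mod 2"
proof -
  define L c where "L = fst s 3" and "c = fst s 7"
  define body where "body = (Assign 19 (Minus (Minus (Var 3) (Num 1)) (Var 9)) ;;
     Upd 2 (Var 19) (Neg (Less (Var 8) (Arr 4 (Var 19)))) ;;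
     When (Arr 2 (Var 19)) (Assign 8 (Minus (Var 8) (Arr 4 (Var 19)))))"
  define I where "I i s' \<longleftrightarrow> fst s' 3 = L \<and> fst s' 8 = c mod 2 ^ (L - i) \<and>
    (\<forall>j<L. snd s' (cell 4 j) = 2 ^ j) \<and> (\<forall>j<L. L - i \<le> j \<longrightarrow> snd s' (cell 2 j) = (c div 2 ^ j) mod 2)"
    for i and s' :: store
  have "I L (den (For 9 3 body) (setv 8 c s))"
  proof (rule den_For_induct[where I=I])
    show "I 0 (setv 8 c s)" using pw c by (simp add: I_def L_def c_def)
    show "L = fst (setv 8 c s) 3" by (simp add: L_def)
    fix i s' assume i: "i < L" and I: "I i s'"
    define j where "j = L - Suc i"
    have j: "L - Suc 0 - i = j" "L - i = Suc j" "j < L" using i by (auto simp: j_def)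
    have r: "c mod 2 ^ Suc j = 2 ^ j * (c div 2 ^ j mod 2) + c mod 2 ^ j"
      using mod_mult2_eq[of c "2 ^ j" 2] by (simp add: mult.commute)
    have lt: "c mod 2 ^ j < 2 ^ j" by simp
    have b: "c mod 2 ^ Suc j < 2 ^ j \<longleftrightarrow> c div 2 ^ j mod 2 = 0"
      using r lt by (cases "c div 2 ^ j mod 2 = 0") auto
    have two: "c div 2 ^ j mod 2 \<noteq> 0 \<Longrightarrow> c div 2 ^ j mod 2 = 1" by simp
    show "I (Suc i) (den body (setv 9 i s'))"
    proof (cases "c div 2 ^ j mod 2 = 0")
      case True
      then have lt2: "c mod 2 ^ Suc j < 2 ^ j" and m: "c mod 2 ^ Suc j = c mod 2 ^ j" using b r by auto
      have "den body (setv 9 i s') = ((fst s')(9 := i, 19 := j), (snd s')(cell 2 j := 0))"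
        using I j lt2 by (simp add: body_def I_def setv_def)
      then show ?thesis using I j True m
        by (auto simp: I_def j_def[symmetric] le_Suc_eq Suc_le_eq order_le_less)
    next
      case False
      then have lt2: "\<not> c mod 2 ^ Suc j < 2 ^ j" and m: "c mod 2 ^ Suc j - 2 ^ j = c mod 2 ^ j"
        using b r two by auto
      have "den body (setv 9 i s') = ((fst s')(9 := i, 19 := j, 8 := c mod 2 ^ j), (snd s')(cell 2 j := 1))"
        using I j lt2 m by (simp add: body_def I_def setv_def)
      then show ?thesis using I j two[OF False]
        by (auto simp: I_def j_def[symmetric] le_Suc_eq Suc_le_eq order_le_less)
    qed
  qed
  moreover have "den Unpack s = den (For 9 3 body) (setv 8 c s)"
    unfolding Unpack_def body_def[symmetric] by (simp add: c_def del: den.simps(5))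
  ultimately show ?thesis using i by (simp add: I_def L_def c_def del: den.simps(5))
qed

lemma rel_of_cong: "(\<And>i. M (cell a i) = M' (cell a i)) \<Longrightarrow> rel_of n M a = rel_of n M' a"
  by (simp add: rel_of_def fun_eq_iff)

lemma certs_cong: "(\<And>i. M (cell 2 i) = M' (cell 2 i)) \<Longrightarrow> certs n P M = certs n P M'"
  by (simp add: certs_def fun_eq_iff)

text \<open>Slot s consults earlier slots only. Hence later writes do not invalidate earlier
  entries, and \<open>picks\<close>, a condition on the finished array, can be established by
  filling it in place.\<close>

lemma good_cong:
  "(\<And>s'. s' < s \<Longrightarrow> pick s' = pick' s') \<Longrightarrow>
    marked_graph.good n E X P cert pick a s = marked_graph.good n E X P cert pick' a s"
  by (auto simp: marked_graph.good_def)

lemma updated_Fill: "updated Fill = {3}" "assigned Fill = {22}"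
  by (simp_all add: Fill_def)

lemma den_Fill:
  assumes s: "fst s 0 = n" "fst s 2 = P"
  defines "M \<equiv> snd (den Fill s)"
  shows "marked_graph.picks n (rel_of n M 0) (heavy n (rel_of n M 1)) P (certs n P M) (picked M)"
proof -
  let ?pick = "\<lambda>M s. \<Sum>a<n. if marked_graph.good n (rel_of n M 0) (heavy n (rel_of n M 1)) P (certs n P M) (picked M) a s \<and>
     \<not> (\<exists>a'<n. a' < a \<and> marked_graph.good n (rel_of n M 0) (heavy n (rel_of n M 1)) P (certs n P M) (picked M) a' s)
     then a + 1 else 0"
  define body where "body = Upd 3 (Var 22) (Sum 30 0 (Ite (Conj (Good 30 22)
     (Neg (Exi 31 0 (Conj (Less (Var 31) (Var 30)) (Good 31 22))))) (Plus (Var 30) (Num 1)) (Num 0)))"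
  define I where "I i s' \<longleftrightarrow> fst s' 0 = n \<and> fst s' 2 = P \<and> (\<forall>j<i. picked (snd s') j = ?pick (snd s') j)"
    for i and s' :: store
  have "I P (den (For 22 2 body) s)"
  proof (rule den_For_induct[where I=I])
    fix i s' assume i: "i < P" and I: "I i s'"
    let ?M = "snd s'" and ?s = "den body (setv 22 i s')"
    have s': "fst s' 0 = n" "fst s' 2 = P" using I by (simp_all add: I_def)
    have "ev (Sum 30 0 (Ite (Conj (Good 30 22)
     (Neg (Exi 31 0 (Conj (Less (Var 31) (Var 30)) (Good 31 22))))) (Plus (Var 30) (Num 1)) (Num 0)))
      ((fst s')(22 := i)) ?M = ?pick ?M i"
      using s' by (simp add: ev_Ite_tr del: ev.simps(5) cong: if_cong conj_cong)
    then have s: "fst ?s = (fst s')(22 := i)" "snd ?s = ?M(cell 3 i := ?pick ?M i)"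
      by (simp_all add: body_def)
    have same: "rel_of n (snd ?s) 0 = rel_of n ?M 0" "rel_of n (snd ?s) 1 = rel_of n ?M 1"
      "certs n P (snd ?s) = certs n P ?M" unfolding s by (auto intro!: rel_of_cong certs_cong)
    have old: "picked (snd ?s) j = picked ?M j" if "j < i" for j using that unfolding s by (simp add: picked_def)
    have "?pick (snd ?s) j = ?pick ?M j" if "j \<le> i" for j
    proof -
      have "marked_graph.good n E X P C (picked (snd ?s)) a j = marked_graph.good n E X P C (picked ?M) a j" for E X C a
        by (rule good_cong) (use old that in auto)
      then show ?thesis unfolding same by simp
    qed
    moreover have "picked (snd ?s) i = ?pick ?M i" unfolding s by (simp add: picked_def)
    ultimately have "picked (snd ?s) j = ?pick (snd ?s) j" if "j < Suc i" for j
      using that old[of j] I by (cases "j = i") (auto simp: I_def)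
    then show "I (Suc i) ?s" using s(1) s' by (simp add: I_def)
  qed (use s in \<open>auto simp: I_def\<close>)
  then show ?thesis unfolding marked_graph.picks_def M_def Fill_def body_def[symmetric] I_def by blast
qed

lemma tr_Check:
  fixes \<sigma> M n P
  assumes "n = \<sigma> 0" "P = \<sigma> 2"
  defines "D \<equiv> marked_graph.decode (rel_of n M 0) (heavy n (rel_of n M 1)) P (certs n P M) (picked M)"
  shows "tr (Conj (Neg (Exi 24 0 (Tuple t []))) (Enough Decode)) \<sigma> M \<longleftrightarrow>
    star_free t n (rel_of n M 0) D \<and> 2 * \<sigma> 1 \<le> total n D"
proof -
  have "tr (Tuple t []) (\<sigma>(24 := v)) M \<longleftrightarrow> (\<exists>U\<subseteq>{..<n}. card U = t \<and> (\<forall>u\<in>U. D v u) \<and>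
      (\<forall>u\<in>U. \<forall>w\<in>U. \<not> rel_of n M 0 u w))" for v
    using tr_Tuple[of "\<sigma>(24 := v)" \<sigma> v "[]" t M] assms by simp
  moreover have "ev (Total Decode) \<sigma> M = total n D"
    unfolding assms(1) by (rule ev_Total) (simp add: D_def assms)
  ultimately show ?thesis using assms(1) by (auto simp: Enough_def star_free_def not_less mult_2)
qed

lemma updated_Unpack: "updated Unpack = {2}" "assigned Unpack = {8, 9, 19}"
  by (auto simp: Unpack_def)

lemma den_Try:
  assumes s: "fst s 0 = n" "fst s 2 = P" "fst s 3 = L" "fst s 1 = k" "fst s 7 = c"
    and pw: "\<forall>i<L. snd s (cell 4 i) = 2 ^ i" and c: "c < 2 ^ L"
    and E: "rel_of n (snd s) 0 = E" and X: "heavy n (rel_of n (snd s) 1) = X"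
  shows "\<exists>cert pick. (\<forall>l s j. j \<le> n \<and> 7 * (j * P + s) + l < L \<longrightarrow>
        (cert l s j \<longleftrightarrow> (c div 2 ^ (7 * (j * P + s) + l)) mod 2 = 1)) \<and>
      marked_graph.picks n E X P cert pick \<and>
      fst (den (Try t) s) 6 = (if star_free t n E (marked_graph.decode E X P cert pick) \<and>
        2 * k \<le> total n (marked_graph.decode E X P cert pick) then 1 else fst s 6)"
proof -
  define s1 where "s1 = den Unpack s"
  define s2 where "s2 = den Fill s1"
  define M where "M = snd s2"
  have f1: "fst s1 v = fst s v" if "v \<notin> {8, 9, 19}" for v
    unfolding s1_def by (rule den_not_assigned) (use that updated_Unpack in auto)
  have f2: "fst s2 v = fst s1 v" if "v \<noteq> 22" for v
    unfolding s2_def by (rule den_not_assigned) (use that updated_Fill in auto)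
  have M1: "snd s1 (cell a i) = snd s (cell a i)" if "a < 8" "a \<noteq> 2" for a i
    unfolding s1_def by (rule den_not_updated) (use that updated_Unpack in auto)
  have M2: "M (cell a i) = snd s1 (cell a i)" if "a < 8" "a \<noteq> 3" for a i
    unfolding M_def s2_def by (rule den_not_updated) (use that updated_Fill in auto)
  have E': "rel_of n M 0 = E" unfolding E[symmetric] by (rule rel_of_cong) (simp add: M1 M2)
  have "rel_of n M 1 = rel_of n (snd s) 1" by (rule rel_of_cong) (simp add: M1 M2)
  then have X': "heavy n (rel_of n M 1) = X" using X by simp
  have pick: "marked_graph.picks n E X P (certs n P M) (picked M)"
    using den_Fill[of s1 n P] f1 s E' X' unfolding M_def s2_def by simp
  have bits: "M (cell 2 i) = (c div 2 ^ i) mod 2" if "i < L" for i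
    using den_Unpack[of s i] pw c that s M2[of 2 i] unfolding s1_def by simp
  have "certs n P M l u j \<longleftrightarrow> (c div 2 ^ (7 * (j * P + u) + l)) mod 2 = 1"
    if "j \<le> n \<and> 7 * (j * P + u) + l < L" for l u j
  proof -
    have "min j n = j" using that by simp
    then show ?thesis unfolding certs_def using bits that by simp
  qed
  moreover have "fst (den (Try t) s) 6 = (if star_free t n E (marked_graph.decode E X P (certs n P M) (picked M)) \<and>
        2 * k \<le> total n (marked_graph.decode E X P (certs n P M) (picked M)) then 1 else fst s 6)"
  proof -
    have "den (Try t) s = den (Check t) s2" by (simp only: Try_def den.simps(3) s2_def s1_def)
    moreover have "fst s2 0 = n" "fst s2 1 = k" "fst s2 2 = P" "fst s2 6 = fst s 6"
      using f1 f2 s by simp_all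
    ultimately show ?thesis
      unfolding Check_def When_tr using tr_Check[of n "fst s2" P t M] E' X' by (simp add: M_def)
  qed
  ultimately show ?thesis using pick by blast
qed

lemma updated_Try: "updated (Try t) = {2, 3}" "assigned (Try t) = {6, 8, 9, 19, 22}"
  by (auto simp: Try_def updated_Unpack updated_Fill Check_def)

definition solvable :: "nat \<Rightarrow> nat \<Rightarrow> nat \<Rightarrow> (nat \<Rightarrow> nat \<Rightarrow> bool) \<Rightarrow> bool" where
  "solvable t n k E \<longleftrightarrow> (\<exists>R. sym_sub E R \<and> star_free t n E R \<and> 2 * k \<le> total n R)"

lemma valid_star_free: "valid n E R \<Longrightarrow> t \<ge> 3 \<Longrightarrow> star_free t n E R"
  unfolding star_free_def
proof (intro notI, elim exE conjE)
  fix v U assume *: "valid n E R" "t \<ge> 3" "U \<subseteq> {..<n}" "card U = t" "\<forall>u\<in>U. R v u"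
  then have "card U \<le> deg n R v" unfolding deg_def by (intro card_mono) auto
  moreover have "deg n R v \<le> 2" using *(1) by (simp add: valid_def)
  ultimately show False using *(2,4) by linarith
qed

text \<open>Light vertices have degree at most 1 in R, and E-edges between them belong to R by the
  first part of \<open>local_opt\<close>. Two such edges at one light vertex would give it degree
  2.\<close>

lemma near_matching_heavy:
  assumes E: "graph_on n E" and "valid n E R" "local_opt n E R"
  shows "near_matching n E (heavy n R)"
proof
  fix u v w
  assume X: "u \<notin> heavy n R" "v \<notin> heavy n R" "w \<notin> heavy n R" and uv: "E u v" "E u w"
  have lt: "u < n" "v < n" "w < n" using uv E unfolding graph_on_def by blast+
  have d: "deg n R x \<le> 1" if "x \<notin> heavy n R" "x < n" for x
  proof -
    have "deg n R x \<le> 2" "deg n R x \<noteq> 2" using that assms(2) by (simp_all add: heavy_def valid_def)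
    then show ?thesis by linarith
  qed
  have "R u v" "R u w"
    using assms(3) uv lt d[OF X(1) lt(1)] d[OF X(2) lt(2)] d[OF X(3) lt(3)] by (simp_all add: local_opt_def)
  then have "card {v, w} \<le> deg n R u" unfolding deg_def using lt by (intro card_mono) auto
  then have "card {v, w} \<le> 1" using d[OF X(1) lt(1)] by simp
  then show "v = w" by (cases "v = w") auto
qed (use E in \<open>auto simp: graph_on_def heavy_def\<close>)

lemma den_Prepare:
  assumes E: "graph_on n E" and s: "fst s 0 = n" "fst s 1 = k" "rel_of n (snd s) 0 = E"
    "\<And>u v. \<not> rel_of n (snd s) 1 u v" and t: "t \<ge> 1"
  obtains R where "rel_of n (snd (den (Prepare t) s)) 0 = E" "rel_of n (snd (den (Prepare t) s)) 1 = R"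
    "valid n E R" "local_opt n E R"
    "fst (den (Prepare t) s) 0 = n" "fst (den (Prepare t) s) 1 = k"
    "fst (den (Prepare t) s) 2 = (t - 1) * card (heavy n R)"
    "fst (den (Prepare t) s) 3 = (if 2 * k \<le> total n R then 0 else 7 * (card (heavy n R) * ((t - 1) * card (heavy n R))))"
    "fst (den (Prepare t) s) 5 = 2 ^ fst (den (Prepare t) s) 3"
    "fst (den (Prepare t) s) 6 = (if 2 * k \<le> total n R then 1 else 0)"
    "\<And>i. i < fst (den (Prepare t) s) 3 \<Longrightarrow> snd (den (Prepare t) s) (cell 4 i) = 2 ^ i"
proof -
  define s1 where "s1 = den (Assign 4 (Plus (Plus (Var 0) (Var 0)) (Num 1))) s"
  define s2 where "s2 = den Search s1"
  define R where "R = rel_of n (snd s2) 1"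
  define s3 where "s3 = den (Assign 2 (times (t - 1) (Count 24 0 (In_heavy 24)))) s2"
  define s4 where "s4 = den (Assign 3 (Ite (Enough (Cell 1)) (Num 0)
    (times 7 (Mul (Count 24 0 (In_heavy 24)) (Var 2))))) s3"
  define s5 where "s5 = den Powers s4"
  have s6: "den (Prepare t) s = den (Assign 6 (Enough (Cell 1))) s5"
    by (simp only: Prepare_def den.simps(3) s1_def s2_def s3_def s4_def s5_def)
  have empty: "rel_of n (snd s) 1 = (\<lambda>u v. False)" using s(4) by blast
  have "valid n E (rel_of n (snd s1) 1)"
    by (simp add: s1_def empty valid_def sym_sub_def deg_def del: One_nat_def)
  from den_Search[OF E _ _ _ this]
  have R: "rel_of n (snd s2) 0 = E" "valid n E R" "local_opt n E R"
    using s by (simp_all add: s1_def s2_def R_def)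
  have v2: "fst s2 0 = n" "fst s2 1 = k"
    using s den_not_assigned[of 0 Search s1] den_not_assigned[of 1 Search s1]
    by (simp_all add: assigned_Search s1_def s2_def)
  have q: "ev (Count 24 0 (In_heavy 24)) \<sigma> M = card (XM \<sigma> M)" for \<sigma> M
  proof -
    have "{i. i < \<sigma> 0 \<and> tr (In_heavy 24) (\<sigma>(24 := i)) M} = XM \<sigma> M" by (auto simp: heavy_def)
    then show ?thesis by simp
  qed
  have s3: "snd s3 = snd s2" "fst s3 = (fst s2)(2 := (t - 1) * card (heavy n R))"
    using v2 q by (simp_all add: s3_def R_def del: ev_Count)
  have en: "tr (Enough (Cell 1)) \<sigma> M \<longleftrightarrow> 2 * k \<le> total n (rel_of n M 1)" if "\<sigma> 0 = n" "\<sigma> 1 = k" for \<sigma> M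
    unfolding Enough_def using ev_Total[of \<sigma> "Cell 1" M "rel_of n M 1"] that by (auto simp: mult_2)
  have qn: "card (heavy n R) \<le> n" using card_mono[of "{..<n}" "heavy n R"] by (auto simp: heavy_def)
  have mul: "ev (Mul (Count 24 0 (In_heavy 24)) (Var 2)) (fst s3) (snd s3) =
      card (heavy n R) * ((t - 1) * card (heavy n R))"
    using s3 v2 qn by (subst ev_Mul) (simp_all add: q R_def del: ev_Count)
  have s4: "snd s4 = snd s2" "fst s4 = (fst s3)(3 := (if 2 * k \<le> total n R then 0
      else 7 * (card (heavy n R) * ((t - 1) * card (heavy n R)))))"
    using en[of "fst s3" "snd s3"] mul s3 v2 by (simp_all add: s4_def ev_Ite_tr R_def del: ev_Count ev.simps(5))
  have v5: "fst s5 v = fst s4 v" if "v \<noteq> 5" "v \<noteq> 9" for v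
    unfolding s5_def by (rule den_not_assigned) (use that in \<open>simp add: Powers_def\<close>)
  have M5: "snd s5 (cell a i) = snd s2 (cell a i)" if "a < 8" "a \<noteq> 4" for a i
    unfolding s5_def s4(1)[symmetric] by (rule den_not_updated) (use that in \<open>auto simp: Powers_def\<close>)
  have R5: "rel_of n (snd s5) 0 = E" "rel_of n (snd s5) 1 = R"
    unfolding R(1)[symmetric] R_def by (rule rel_of_cong; simp add: M5)+
  have v50: "fst s5 0 = n" "fst s5 1 = k" using v5 s4 s3 v2 by simp_all
  have e6: "ev (Enough (Cell 1)) (fst s5) (snd s5) = (if 2 * k \<le> total n R then 1 else 0)"
  proof -
    have "tr (Less (Total (Cell 1)) (Plus (Var 1) (Var 1))) (fst s5) (snd s5) \<longleftrightarrow> \<not> 2 * k \<le> total n R"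
      using en[OF v50, of "snd s5"] unfolding Enough_def R5 by (simp only: tr_simps(1)) blast
    then show ?thesis by (simp only: Enough_def ev_Neg if_not_P) simp
  qed
  have d6: "fst (den (Prepare t) s) = (fst s5)(6 := (if 2 * k \<le> total n R then 1 else 0))"
    "snd (den (Prepare t) s) = snd s5" unfolding s6 using e6 by simp_all
  show thesis
    by (rule that[of R])
      (use d6 R5 R v50 v5 s4 s3 den_Powers[where s=s4] in \<open>simp_all add: s5_def[symmetric]\<close>)
qed

lemma den_Main:
  assumes E: "graph_on n E" and s: "fst s 0 = n" "fst s 1 = k" "rel_of n (snd s) 0 = E"
    "\<And>u v. \<not> rel_of n (snd s) 1 u v" and t: "t \<ge> 3"
  shows "fst (den (Main t) s) 6 = (if solvable t n k E then 1 else 0)"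
proof -
  have t1: "1 \<le> t" using t by simp
  define s1 where "s1 = den (Prepare t) s"
  obtain R where p: "rel_of n (snd s1) 0 = E" "rel_of n (snd s1) 1 = R"
    "valid n E R" "local_opt n E R" "fst s1 0 = n" "fst s1 1 = k"
    "fst s1 2 = (t - 1) * card (heavy n R)"
    "fst s1 3 = (if 2 * k \<le> total n R then 0 else 7 * (card (heavy n R) * ((t - 1) * card (heavy n R))))"
    "fst s1 5 = 2 ^ fst s1 3"
    "fst s1 6 = (if 2 * k \<le> total n R then 1 else 0)"
    "\<And>i. i < fst s1 3 \<Longrightarrow> snd s1 (cell 4 i) = 2 ^ i"
    by (rule den_Prepare[OF E s t1, folded s1_def]) (rule that; assumption)
  define X P L where "X = heavy n R" and "P = (t - 1) * card X" and "L = fst s1 3"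
  interpret near_matching n E X unfolding X_def using near_matching_heavy[OF E p(3,4)] .
  define match where "match c cert \<longleftrightarrow> (\<forall>l s j. j \<le> n \<and> 7 * (j * P + s) + l < L \<longrightarrow>
      (cert l s j \<longleftrightarrow> (c div 2 ^ (7 * (j * P + s) + l)) mod 2 = 1))"
    for c :: nat and cert :: "nat \<Rightarrow> nat \<Rightarrow> nat \<Rightarrow> bool"
  \<comment> \<open>Universal in cert and pick, because \<open>den_Try\<close> yields some pair
    matching c without identifying it.\<close>
  define acc where "acc c \<longleftrightarrow> (\<forall>cert pick. match c cert \<and> picks P cert pick \<longrightarrow>
      star_free t n E (decode P cert pick) \<and> 2 * k \<le> total n (decode P cert pick))" for c
  \<comment> \<open>Soundness holds for every number, since each decoding is a subgraph whose
    star-freeness and size are checked. Completeness only needs that a number with property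
    \<open>acc\<close> sets the answer and that no later one resets it.\<close>
  define I where "I i s' \<longleftrightarrow> (\<forall>v\<in>{0, 1, 2, 3}. fst s' v = fst s1 v) \<and>
      (\<forall>a\<in>{0, 1, 4}. \<forall>i. snd s' (cell a i) = snd s1 (cell a i)) \<and>
      fst s' 6 \<in> {0, 1} \<and> (fst s' 6 = 1 \<longrightarrow> solvable t n k E) \<and>
      (2 * k \<le> total n R \<or> (\<exists>c<i. acc c) \<longrightarrow> fst s' 6 = 1)" for i and s' :: store
  have I_end: "I (2 ^ L) (den (For 7 5 (Try t)) s1)"
  proof (rule den_For_induct[where I=I])
    show "2 ^ L = fst s1 5" using p(9) by (simp add: L_def)
    have "solvable t n k E" if "2 * k \<le> total n R"
      unfolding solvable_def using that p(3) valid_star_free[OF p(3) t]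
      by (intro exI[of _ R]) (simp add: valid_def)
    then show "I 0 s1" using p by (simp add: I_def)
    fix c s' assume c: "c < 2 ^ L" and I: "I c s'"
    let ?s = "setv 7 c s'"
    have M: "snd s' (cell a i) = snd s1 (cell a i)" if "a \<in> {0, 1, 4}" for a i
      using I that unfolding I_def by blast
    have rels: "rel_of n (snd ?s) 0 = E" "rel_of n (snd ?s) 1 = R"
      unfolding p(1,2)[symmetric] by (rule rel_of_cong; simp add: M)+
    have vars: "fst ?s 0 = n" "fst ?s 2 = P" "fst ?s 3 = L" "fst ?s 1 = k" "fst ?s 7 = c"
      using I p by (simp_all add: I_def P_def X_def L_def)
    have pows: "\<forall>i<L. snd ?s (cell 4 i) = 2 ^ i" using M p(11) by (simp add: L_def)
    have hX: "heavy n (rel_of n (snd ?s) 1) = X" by (simp only: rels X_def)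
    from den_Try[OF vars pows c rels(1) hX, of t, folded match_def]
    obtain cert pick where cp: "match c cert" "picks P cert pick"
      "fst (den (Try t) ?s) 6 = (if star_free t n E (decode P cert pick) \<and>
        2 * k \<le> total n (decode P cert pick) then 1 else fst ?s 6)" by (elim exE conjE)
    have sol: "solvable t n k E" if "star_free t n E (decode P cert pick) \<and> 2 * k \<le> total n (decode P cert pick)"
      unfolding solvable_def by (intro exI[of _ "decode P cert pick"] conjI decode_sym_sub) (use that in simp_all)
    have acc: "star_free t n E (decode P cert pick) \<and> 2 * k \<le> total n (decode P cert pick)" if "acc c"
      using that cp(1,2) by (simp add: acc_def)
    have v': "fst (den (Try t) ?s) v = fst s' v" if "v \<in> {0, 1, 2, 3}" for v
      using den_not_assigned[of v "Try t" ?s] that by (auto simp: updated_Try)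
    have M': "snd (den (Try t) ?s) (cell a i) = snd s' (cell a i)" if "a \<in> {0, 1, 4}" for a i
      using den_not_updated[of a "Try t" ?s i] that by (auto simp: updated_Try)
    have ans: "fst (den (Try t) ?s) 6 \<in> {0, 1}" "fst (den (Try t) ?s) 6 = 1 \<Longrightarrow> solvable t n k E"
      "2 * k \<le> total n R \<or> (\<exists>c'<c. acc c') \<or> acc c \<Longrightarrow> fst (den (Try t) ?s) 6 = 1"
    proof -
      have old: "fst s' 6 \<in> {0, 1}" "fst s' 6 = 1 \<longrightarrow> solvable t n k E"
        "2 * k \<le> total n R \<or> (\<exists>c'<c. acc c') \<longrightarrow> fst s' 6 = 1"
        using I unfolding I_def by iprover+
      show "fst (den (Try t) ?s) 6 \<in> {0, 1}" using cp(3) old(1) by simp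
      show "solvable t n k E" if "fst (den (Try t) ?s) 6 = 1"
      proof (cases "star_free t n E (decode P cert pick) \<and> 2 * k \<le> total n (decode P cert pick)")
        case False
        then show ?thesis using that cp(3) old(2) by (simp only: if_False setv_simps) simp
      qed (rule sol)
      assume a: "2 * k \<le> total n R \<or> (\<exists>c'<c. acc c') \<or> acc c"
      show "fst (den (Try t) ?s) 6 = 1"
      proof (cases "star_free t n E (decode P cert pick) \<and> 2 * k \<le> total n (decode P cert pick)")
        case False
        then have "fst s' 6 = 1" using a acc old(3) by blast
        then show ?thesis using False cp(3) by (simp only: if_False setv_simps) simp
      qed (use cp(3) in simp)
    qed
    show "I (Suc c) (den (Try t) ?s)" unfolding I_def
    proof (intro conjI ballI allI impI)
      show "fst (den (Try t) ?s) v = fst s1 v" if "v \<in> {0, 1, 2, 3}" for v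
        using v'[OF that] I that by (simp only: I_def)
      show "snd (den (Try t) ?s) (cell a i) = snd s1 (cell a i)" if "a \<in> {0, 1, 4}" for a i
        using M'[OF that] M[OF that] by simp
      show "fst (den (Try t) ?s) 6 = 1" if "2 * k \<le> total n R \<or> (\<exists>ca<Suc c. acc ca)"
        using that ans(3) by (auto simp: less_Suc_eq)
    qed (use ans in simp_all)
  qed
  have main: "den (Main t) s = den (For 7 5 (Try t)) s1"
    by (simp only: Main_def den.simps(3) s1_def)
  have ans: "fst (den (Main t) s) 6 \<in> {0, 1}" "fst (den (Main t) s) 6 = 1 \<Longrightarrow> solvable t n k E"
    "2 * k \<le> total n R \<or> (\<exists>c<2 ^ L. acc c) \<Longrightarrow> fst (den (Main t) s) 6 = 1"
    using I_end unfolding I_def main by iprover+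
  have "2 * k \<le> total n R \<or> (\<exists>c<2 ^ L. acc c)" if solvable: "solvable t n k E"
  proof (cases "2 * k \<le> total n R")
    case False
    obtain Q where Q: "sym_sub E Q" "star_free t n E Q" "2 * k \<le> total n Q"
      using solvable unfolding solvable_def by blast
    have L: "L = 7 * (card X * P)" using p(8) False by (simp add: L_def X_def P_def)
    have "2 \<le> t" using t by simp
    from exists_certificate[OF Q(1,2) this P_def, folded L]
    obtain c :: nat where c: "c < 2 ^ L" and c': "\<forall>cert pick. (\<forall>l<7. \<forall>s<P. \<forall>j<card X. cert l s j \<longleftrightarrow>
        (c div 2 ^ (7 * (j * P + s) + l)) mod 2 = 1) \<and> picks P cert pick \<longrightarrow>
        star_free t n E (decode P cert pick) \<and> total n Q \<le> total n (decode P cert pick)"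
      by (elim exE conjE)
    have Xn: "card X \<le> n" using card_mono[of "{..<n}" X] X_less by auto
    have "acc c" unfolding acc_def
    proof (intro allI impI, elim conjE)
      fix cert pick assume m: "match c cert" and pk: "picks P cert pick"
      have "\<forall>l<7. \<forall>s<P. \<forall>j<card X. cert l s j \<longleftrightarrow> (c div 2 ^ (7 * (j * P + s) + l)) mod 2 = 1"
      proof (intro allI impI)
        fix l s j :: nat assume lsj: "l < 7" "s < P" "j < card X"
        have "j * P + s < (j + 1) * P" using lsj by simp
        also have "\<dots> \<le> card X * P" using lsj by (intro mult_le_mono1) simp
        finally have "7 * Suc (j * P + s) \<le> 7 * (card X * P)" by (intro mult_le_mono2) simp
        then have "7 * (j * P + s) + l < L" using lsj(1) L by simp
        then show "cert l s j \<longleftrightarrow> (c div 2 ^ (7 * (j * P + s) + l)) mod 2 = 1"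
          using m lsj Xn unfolding match_def by simp
      qed
      from c'[rule_format, OF conjI, OF this pk] Q(3) show "star_free t n E (decode P cert pick) \<and> 2 * k \<le> total n (decode P cert pick)"
        by simp
    qed
    then show ?thesis using c by blast
  qed simp
  then show ?thesis using ans by auto
qed

section \<open>Running time of the program\<close>

definition poly_cost :: "cmd \<Rightarrow> bool" where
  "poly_cost c \<longleftrightarrow> (\<exists>K d. \<forall>s W. sizes_le (fst s) W \<longrightarrow> cost c s \<le> K * (W + 1) ^ d)"

lemma poly_cost_Assign: "wf_exp e \<Longrightarrow> poly_cost (Assign v e)"
  \<comment> \<open>The cost does not depend on the target, so a harmless target may be substituted
    for a size variable.\<close>
  using cost_poly[of "Assign 5 e"] by (simp add: poly_cost_def size_vars_def)

lemma poly_cost_wf: "wf_cmd c \<Longrightarrow> poly_cost c"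
  unfolding poly_cost_def by (rule cost_poly)

lemma wf_Total [simp]: "wf_exp (R 24 25) \<Longrightarrow> wf_exp (Total R)"
  by (simp add: Total_def size_vars_def)

lemma wf_Enough [simp]: "wf_exp (R 24 25) \<Longrightarrow> wf_exp (Enough R)"
  by (simp add: Enough_def)

lemma wf_Try: "wf_cmd (Try t)"
  by (simp add: Try_def Unpack_def Fill_def Check_def size_vars_def)

lemma wf_Powers: "wf_cmd Powers"
  by (simp add: Powers_def size_vars_def)

lemma poly_costD:
  "poly_cost c \<Longrightarrow> \<exists>K d. \<forall>s W. sizes_le (fst s) W \<longrightarrow> cost c s \<le> K * (W + 1) ^ d"
  by (simp add: poly_cost_def)

text \<open>\<open>Prepare\<close> assigns the size variables 2, 3 and 4, so it is not well-formed
  as a whole. Its six parts are bounded one by one with a W that dominates the sizes before and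
  after; the final values of variables 2 and 3 are those they receive on assignment.\<close>

lemma cost_Prepare:
  "\<exists>K d. \<forall>s W. sizes_le (fst s) W \<and> fst s 2 = 0 \<and> fst s 3 = 0 \<and> fst s 4 = 0 \<and>
     2 * fst s 0 + 1 \<le> W \<and> fst (den (Prepare t) s) 2 \<le> W \<and> fst (den (Prepare t) s) 3 \<le> W \<longrightarrow>
     cost (Prepare t) s \<le> K * (W + 1) ^ d"
proof -
  define c1 where "c1 = Assign 4 (Plus (Plus (Var 0) (Var 0)) (Num 1))"
  define c3 where "c3 = Assign 2 (times (t - 1) (Count 24 0 (In_heavy 24)))"
  define c4 where "c4 = Assign 3 (Ite (Enough (Cell 1)) (Num 0) (times 7 (Mul (Count 24 0 (In_heavy 24)) (Var 2))))"
  define c6 where "c6 = Assign 6 (Enough (Cell 1))"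
  have P: "Prepare t = (c1 ;; Search ;; c3 ;; c4 ;; Powers ;; c6)"
    by (simp only: Prepare_def c1_def c3_def c4_def c6_def)
  have pc: "poly_cost c1" "poly_cost c3" "poly_cost c4" "poly_cost c6"
    unfolding c1_def c3_def c4_def c6_def by (rule poly_cost_Assign; simp add: size_vars_def)+
  obtain K1 d1 where 1: "\<And>s W. sizes_le (fst s) W \<Longrightarrow> cost c1 s \<le> K1 * (W + 1) ^ d1"
    using poly_costD[OF pc(1)] by blast
  obtain K2 d2 where 2: "\<And>s W. sizes_le (fst s) W \<Longrightarrow> cost Search s \<le> K2 * (W + 1) ^ d2"
    using poly_costD[OF poly_cost_wf[OF wf_Search]] by blast
  obtain K3 d3 where 3: "\<And>s W. sizes_le (fst s) W \<Longrightarrow> cost c3 s \<le> K3 * (W + 1) ^ d3"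
    using poly_costD[OF pc(2)] by blast
  obtain K4 d4 where 4: "\<And>s W. sizes_le (fst s) W \<Longrightarrow> cost c4 s \<le> K4 * (W + 1) ^ d4"
    using poly_costD[OF pc(3)] by blast
  obtain K5 d5 where 5: "\<And>s W. sizes_le (fst s) W \<Longrightarrow> cost Powers s \<le> K5 * (W + 1) ^ d5"
    using poly_costD[OF poly_cost_wf[OF wf_Powers]] by blast
  obtain K6 d6 where 6: "\<And>s W. sizes_le (fst s) W \<Longrightarrow> cost c6 s \<le> K6 * (W + 1) ^ d6"
    using poly_costD[OF pc(4)] by blast
  have "cost (Prepare t) s \<le> (K1 + (K2 + (K3 + (K4 + (K5 + K6))))) *
      (W + 1) ^ (d1 + (d2 + (d3 + (d4 + (d5 + d6)))))"
    if s: "sizes_le (fst s) W" "fst s 2 = 0" "fst s 3 = 0" "fst s 4 = 0" "2 * fst s 0 + 1 \<le> W"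
      "fst (den (Prepare t) s) 2 \<le> W" "fst (den (Prepare t) s) 3 \<le> W" for s W
  proof -
    define s1 where "s1 = den c1 s"
    define s2 where "s2 = den Search s1"
    define s3 where "s3 = den c3 s2"
    define s4 where "s4 = den c4 s3"
    define s5 where "s5 = den Powers s4"
    have s6: "den (Prepare t) s = den c6 s5"
      by (simp only: P den.simps(3) s1_def s2_def s3_def s4_def s5_def)
    have z1: "fst s1 = (fst s)(4 := 2 * fst s 0 + 1)" by (simp add: s1_def c1_def mult_2)
    then have w1: "sizes_le (fst s1) W" using s by (auto simp: sizes_le_def size_vars_def)
    then have w2: "sizes_le (fst s2) W" unfolding s2_def by (simp add: den_sizes_le[OF wf_Search])
    have z3: "fst s3 v = fst s2 v" if "v \<noteq> 2" for v using that by (simp add: s3_def c3_def)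
    have z4: "fst s4 v = fst s3 v" if "v \<noteq> 3" for v using that by (simp add: s4_def c4_def)
    have z5: "fst s5 v = fst s4 v" if "v \<in> size_vars" for v
      unfolding s5_def by (rule den_size_vars[OF wf_Powers that])
    have z6: "fst (den (Prepare t) s) v = fst s5 v" if "v \<noteq> 6" for v
      using that by (simp add: s6 c6_def)
    have e2: "fst s3 2 \<le> W" using s(6) z6[of 2] z5[of 2] z4[of 2] by (simp add: size_vars_def)
    have e3: "fst s4 3 \<le> W" using s(7) z6[of 3] z5[of 3] by (simp add: size_vars_def)
    have w3: "sizes_le (fst s3) W" using w2 e2 z3 by (auto simp: sizes_le_def size_vars_def)
    have w4: "sizes_le (fst s4) W" using w3 e3 z4 by (auto simp: sizes_le_def size_vars_def)
    have w5: "sizes_le (fst s5) W" using w4 z5 by (auto simp: sizes_le_def)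
    have "cost (Prepare t) s = cost c1 s + (cost Search s1 + (cost c3 s2 + (cost c4 s3 + (cost Powers s4 + cost c6 s5))))"
      by (simp only: P cost.simps(3) s1_def s2_def s3_def s4_def s5_def)
    then show ?thesis
      using poly_add[OF 1[OF s(1)] poly_add[OF 2[OF w1] poly_add[OF 3[OF w2] poly_add[OF 4[OF w3]
        poly_add[OF 5[OF w4] 6[OF w5]]]]]] by (simp only:)
  qed
  then show ?thesis by blast
qed

text \<open>The loop over certificates is bounded by variable 5, which is not a size variable. It
  contributes the only factor that is not polynomial in W.\<close>

lemma cost_Main:
  "\<exists>K d. \<forall>s W. sizes_le (fst s) W \<and> fst s 2 = 0 \<and> fst s 3 = 0 \<and> fst s 4 = 0 \<and>
     2 * fst s 0 + 1 \<le> W \<and> fst (den (Prepare t) s) 2 \<le> W \<and> fst (den (Prepare t) s) 3 \<le> W \<longrightarrow>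
     cost (Main t) s \<le> max 1 (fst (den (Prepare t) s) 5) * (K * (W + 1) ^ d)"
proof -
  obtain K1 d1 where 1: "\<And>s W. sizes_le (fst s) W \<and> fst s 2 = 0 \<and> fst s 3 = 0 \<and> fst s 4 = 0 \<and>
     2 * fst s 0 + 1 \<le> W \<and> fst (den (Prepare t) s) 2 \<le> W \<and> fst (den (Prepare t) s) 3 \<le> W \<Longrightarrow>
     cost (Prepare t) s \<le> K1 * (W + 1) ^ d1" using cost_Prepare[of t] by blast
  obtain K2 d2 where 2: "\<And>s W. sizes_le (fst s) W \<Longrightarrow> cost (Try t) s \<le> K2 * (W + 1) ^ d2"
    using cost_poly[OF wf_Try[of t]] by blast
  have "cost (Main t) s \<le> max 1 (fst (den (Prepare t) s) 5) * ((K1 + 4 + (K2 + 6)) * (W + 1) ^ (d1 + d2))"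
    if s: "sizes_le (fst s) W \<and> fst s 2 = 0 \<and> fst s 3 = 0 \<and> fst s 4 = 0 \<and>
     2 * fst s 0 + 1 \<le> W \<and> fst (den (Prepare t) s) 2 \<le> W \<and> fst (den (Prepare t) s) 3 \<le> W" for s W
  proof -
    define s1 where "s1 = den (Prepare t) s"
    define N where "N = fst s1 5"
    define B where "B = (W + 1) ^ (d1 + d2)"
    have B1: "1 \<le> B" by (simp add: B_def)
    have v: "fst s1 0 = fst s 0"
      unfolding s1_def by (rule den_not_assigned) (simp add: Prepare_def assigned_Search Powers_def)
    have v4: "fst s1 4 = 2 * fst s 0 + 1"
    proof -
      have "fst (den Search s') 4 = fst s' 4" for s' by (rule den_not_assigned) (simp add: assigned_Search)
      moreover have "fst (den Powers s') 4 = fst s' 4" for s' by (rule den_not_assigned) (simp add: Powers_def)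
      ultimately show ?thesis unfolding s1_def Prepare_def by simp
    qed
    have w: "sizes_le (fst s1) W"
      using s v v4 unfolding s1_def[symmetric] by (auto simp: sizes_le_def size_vars_def)
    have setv: "sizes_le (fst (setv 7 i s')) W \<longleftrightarrow> sizes_le (fst s') W" for i s'
      by (simp add: sizes_le_def size_vars_def)
    have step: "sizes_le (fst (den (Try t) (setv 7 i s'))) W \<longleftrightarrow> sizes_le (fst s') W" for i s'
      by (simp only: den_sizes_le[OF wf_Try] setv)
    have fold: "sizes_le (fst (fold (\<lambda>i s. den (Try t) (setv 7 i s)) xs s')) W \<longleftrightarrow> sizes_le (fst s') W" for xs s'
      by (induction xs arbitrary: s') (simp_all add: step)
    have it: "cost (Try t) (setv 7 i (fold (\<lambda>i s. den (Try t) (setv 7 i s)) [0..<i] s1)) + 6 \<le> (K2 + 6) * B" for i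
    proof -
      have "sizes_le (fst (setv 7 i (fold (\<lambda>i s. den (Try t) (setv 7 i s)) [0..<i] s1))) W"
        by (simp only: setv fold w)
      from poly_add[OF 2[OF this], of 6 6 0]
      show ?thesis unfolding B_def by (rule poly_weaken) auto
    qed
    have "cost (For 7 5 (Try t)) s1 \<le> 4 + N * ((K2 + 6) * B)"
      unfolding cost.simps N_def[symmetric]
      using sum_bounded_above[of "{..<N}", OF it] by simp
    moreover have "cost (Prepare t) s \<le> K1 * B"
      unfolding B_def by (rule poly_weaken[OF 1[OF s]]) auto
    moreover have "cost (Main t) s = cost (Prepare t) s + cost (For 7 5 (Try t)) s1"
      by (simp only: Main_def cost.simps(3) s1_def)
    moreover have "4 + K1 * B \<le> max 1 N * ((K1 + 4) * B)"
    proof -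
      have "4 + K1 * B \<le> (K1 + 4) * B" using B1 by (simp add: distrib_right)
      also have "\<dots> \<le> max 1 N * ((K1 + 4) * B)" by simp
      finally show ?thesis .
    qed
    moreover have "N * ((K2 + 6) * B) \<le> max 1 N * ((K2 + 6) * B)" by (intro mult_right_mono) auto
    moreover have "max 1 N * ((K1 + 4 + (K2 + 6)) * B) = max 1 N * ((K1 + 4) * B) + max 1 N * ((K2 + 6) * B)"
      by (simp only: distrib_left distrib_right add.assoc)
    ultimately show ?thesis unfolding B_def N_def s1_def by linarith
  qed
  then show ?thesis by blast
qed

section \<open>Loading the instance\<close>

text \<open>Variable 1 lives in register 2 and receives k, because register 1 is wanted for the base
  address. The base \<open>n * n\<close>, the first cell behind the input, is obtained by adding n
  repeatedly.\<close>

definition Spread :: prog where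
  "Spread = Seq (Seq (Add 2 1 2) (Seq (Const 1 0) (copy 3 0)))
     (Seq (WhileNZ 3 (Seq (Add 1 1 0) (Seq (Const 5 1) (Sub 3 3 5))))
     (Seq (copy 3 1)
       (WhileNZ 3 (Seq (Const 5 1) (Seq (Sub 3 3 5) (Seq (Load 7 3) (Seq (Add 9 3 3)
         (Seq (Add 9 9 9) (Seq (Add 9 9 9) (Seq (Add 9 9 1) (Store 9 7)))))))))))"

text \<open>The adjacency matrix is spread out from its end, so that no entry is overwritten before it
  has been read.\<close>

definition spread :: "nat \<Rightarrow> nat \<Rightarrow> (nat \<Rightarrow> nat) \<Rightarrow> nat \<Rightarrow> nat" where
  "spread N i h x = (if x mod 8 = 0 \<and> i \<le> x div 8 \<and> x div 8 < N then h (x div 8) else h (N + x))"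

lemma runs_Spread:
  fixes n k :: nat
  defines "\<sigma> \<equiv> (\<lambda>_. 0)(0 := n, Suc 0 := k)"
  shows "runs Spread (\<sigma>, h) (10 + 4 * n + 9 * (n * n)) (rel (\<sigma>, spread (n * n) 0 h))"
proof -
  define N where "N = n * n"
  have even: "\<sigma> v = (if v = 0 then n else if v = 1 then k else 0)" for v by (simp add: \<sigma>_def)
  define J where "J i q \<longleftrightarrow> (\<forall>v. fst q (2 * v) = \<sigma> v) \<and> fst q 1 = i * n \<and> fst q 3 = n - i \<and> snd q = h"
    for i and q :: state
  define I where "I i q \<longleftrightarrow> (\<forall>v. fst q (2 * v) = \<sigma> v) \<and> fst q 1 = N \<and> fst q 3 = N - i \<and>
      (\<forall>x<N. snd q x = h x) \<and> (\<forall>x. snd q (N + x) = spread N (N - i) h x)" for i and q :: state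
  have odd: "2 * v \<noteq> Suc 0" "2 * v \<noteq> 3" "2 * v \<noteq> 5" "2 * v \<noteq> 7" "2 * v \<noteq> 9" for v :: nat by presburger+
  have start: "runs (Seq (Add 2 1 2) (Seq (Const 1 0) (copy 3 0))) (\<sigma>, h) 4 (J 0)"
    by (rule runs_straight) (auto simp: J_def copy_def even odd)
  have square: "runs (WhileNZ 3 (Seq (Add 1 1 0) (Seq (Const 5 1) (Sub 3 3 5)))) q (1 + (\<Sum>i<n. 3 + 1)) (J n)"
    if "J 0 q" for q
  proof (rule runs_WhileNZ[where I=J])
    fix i q' assume i: "i < n" and J: "J i q'"
    have "fst q' 0 = n" using J[unfolded J_def, THEN conjunct1, rule_format, of 0] by (simp add: even)
    then show "fst q' 3 \<noteq> 0 \<and> runs (Seq (Add 1 1 0) (Seq (Const 5 1) (Sub 3 3 5))) q' 3 (J (Suc i))"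
      using i J by (auto intro!: runs_straight simp: J_def odd)
  qed (use that in \<open>auto simp: J_def\<close>)
  have second: "runs (copy 3 1) q 2 (I 0)" if "J n q" for q
    by (rule runs_straight) (use that in \<open>auto simp: J_def I_def copy_def odd spread_def N_def\<close>)
  have spreading: "runs (WhileNZ 3 (Seq (Const 5 1) (Seq (Sub 3 3 5) (Seq (Load 7 3) (Seq (Add 9 3 3)
         (Seq (Add 9 9 9) (Seq (Add 9 9 9) (Seq (Add 9 9 1) (Store 9 7))))))))) q (1 + (\<Sum>i<N. 8 + 1)) (I N)"
    if "I 0 q" for q
  proof (rule runs_WhileNZ[where I=I])
    fix i q' assume i: "i < N" and I: "I i q'"
    define j where "j = N - Suc i"
    have j: "N - i = Suc j" "N - Suc i = j" "j < N" "Suc j - 1 = j" using i by (auto simp: j_def)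
    have sp: "spread N j h x = (if x = 8 * j then h j else spread N (Suc j) h x)" for x
      using j(3) by (auto simp: spread_def not_less_eq_eq le_Suc_eq)
    have far: "x < N \<Longrightarrow> x \<noteq> 8 * j + N" for x by simp
    have "final (Seq (Const 5 1) (Seq (Sub 3 3 5) (Seq (Load 7 3) (Seq (Add 9 3 3)
         (Seq (Add 9 9 9) (Seq (Add 9 9 9) (Seq (Add 9 9 1) (Store 9 7)))))))) q' =
      ((fst q')(5 := 1, 3 := j, 7 := h j, 9 := 8 * j + N), (snd q')(8 * j + N := h j))"
      using I j by (auto simp: I_def fun_eq_iff)
    then have "I (Suc i) (final (Seq (Const 5 1) (Seq (Sub 3 3 5) (Seq (Load 7 3) (Seq (Add 9 3 3)
         (Seq (Add 9 9 9) (Seq (Add 9 9 9) (Seq (Add 9 9 1) (Store 9 7)))))))) q')"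
      using I j far by (auto simp: I_def odd sp)
    moreover have "fst q' 3 \<noteq> 0" using I j by (simp add: I_def)
    ultimately show "fst q' 3 \<noteq> 0 \<and> runs (Seq (Const 5 1) (Seq (Sub 3 3 5) (Seq (Load 7 3) (Seq (Add 9 3 3)
         (Seq (Add 9 9 9) (Seq (Add 9 9 9) (Seq (Add 9 9 1) (Store 9 7)))))))) q' 8 (I (Suc i))"
      by (auto intro!: runs_straight)
  qed (use that in \<open>auto simp: I_def\<close>)
  show ?thesis unfolding Spread_def
  proof (rule runs_Seq[OF start], rule runs_Seq[OF square], assumption, rule runs_Seq[OF second], assumption,
      rule runs_mono[OF spreading], assumption, rule order_refl)
    show "rel (\<sigma>, spread (n * n) 0 h) q" if "I N q" for q
      using that by (simp add: I_def rel_def N_def)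
  qed (auto simp: N_def)
qed

section \<open>Solutions and the matching number\<close>

lemma strong_closure_iff:
  assumes G: "simple_graph G" "verts G = {0..<n}" and t: "t \<ge> 2"
  shows "strong_closure (star t) G k \<longleftrightarrow> solvable t n k (adj G)"
proof -
  have e2: "card e = 2" "e \<subseteq> {0..<n}" if "e \<in> edges G" for e using G that by (auto simp: simple_graph_def)
  show ?thesis
  proof
    assume "strong_closure (star t) G k"
    then obtain H where "spanning_subgraph H G" and H4: "satisfies_closure (star t) G H" "k \<le> card (edges H)"
      unfolding strong_closure_def by (elim exE conjE)
    then have H: "verts H = {0..<n}" "edges H \<subseteq> edges G"
      using G(2) by (simp_all add: spanning_subgraph_def)
    define R where "R u v \<longleftrightarrow> {u, v} \<in> edges H" for u v
    have "edges H = {{u, v} |u v. u < n \<and> v < n \<and> R u v}"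
    proof (rule set_eqI, rule iffI)
      fix e assume e: "e \<in> edges H"
      then have "card e = 2" using e2(1) H(2) by blast
      then obtain u v where "e = {u, v}" by (auto simp: card_2_iff)
      moreover have "e \<subseteq> {0..<n}" using e e2(2) H(2) by blast
      ultimately have uv: "e = {u, v}" "u < n" "v < n" by auto
      then show "e \<in> {{u, v} |u v. u < n \<and> v < n \<and> R u v}"
        by (intro CollectI exI[of _ u] exI[of _ v]) (use e in \<open>simp add: R_def\<close>)
    qed (auto simp: R_def)
    then have HR: "H = rel_graph n R" using H(1) by (simp add: rel_graph_def prod_eq_iff)
    have R: "R u v \<Longrightarrow> R v u" "R u v \<Longrightarrow> adj G u v" for u v
      using H(2) by (auto simp: R_def adj_def insert_commute[of u v])
    have irr: "\<not> R u u" for u using e2(1)[of "{u}"] H(2) by (auto simp: R_def)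
    have "satisfies_closure (star t) G (rel_graph n R) \<longleftrightarrow> star_free t n (adj G) R"
      by (rule closure_iff[OF G(1) t]) (erule R)+
    then have "star_free t n (adj G) R" using H4(1) unfolding HR by iprover
    moreover have "2 * card (edges (rel_graph n R)) = total n R"
      by (rule card_rel_graph) (erule R, rule irr)
    then have "2 * k \<le> total n R" using H4(2) unfolding HR by linarith
    moreover have "sym_sub (adj G) R" unfolding sym_sub_def using R by blast
    ultimately have "sym_sub (adj G) R" "star_free t n (adj G) R" "2 * k \<le> total n R" by iprover+
    then show "solvable t n k (adj G)" unfolding solvable_def by (intro exI[of _ R] conjI)
  next
    assume "solvable t n k (adj G)"
    then obtain R where R: "sym_sub (adj G) R" "star_free t n (adj G) R" "2 * k \<le> total n R"
      unfolding solvable_def by (elim exE conjE)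
    have sub: "R u v \<Longrightarrow> R v u" "R u v \<Longrightarrow> adj G u v" for u v using R(1) by (auto simp: sym_sub_def)
    have irr: "\<not> R u u" for u using sub(2)[of u u] e2(1)[of "{u}"] by (auto simp: adj_def)
    have sg: "edges (rel_graph n R) \<subseteq> edges G" using sub(2) by (auto simp: rel_graph_def adj_def)
    have "spanning_subgraph (rel_graph n R) G"
      using sg e2 G(2) unfolding spanning_subgraph_def simple_graph_def
      by (auto simp: rel_graph_def)
    moreover have "satisfies_closure (star t) G (rel_graph n R)"
    proof -
      have "satisfies_closure (star t) G (rel_graph n R) \<longleftrightarrow> star_free t n (adj G) R"
        by (rule closure_iff[OF G(1) t]) (erule sub)+
      then show ?thesis using R(2) by iprover
    qed
    moreover have "k \<le> card (edges (rel_graph n R))"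
    proof -
      have "2 * card (edges (rel_graph n R)) = total n R"
        by (rule card_rel_graph) (erule sub, rule irr)
      then show ?thesis using R(3) by linarith
    qed
    ultimately show "strong_closure (star t) G k"
      unfolding strong_closure_def by (intro exI[of _ "rel_graph n R"] conjI)
  qed
qed

text \<open>\<open>local_opt_bound\<close> is applied to the vertices covered by a maximum matching,
  which exists in the analysis only. Since the matching covers two vertices per edge, the factor 5
  becomes 10.\<close>

lemma heavy_bound:
  assumes G: "simple_graph G" "verts G = {0..<n}"
    and R: "valid n (adj G) R" "local_opt n (adj G) R"
  shows "card (heavy n R) * 2 + 10 * matching_number G \<le> 5 * total n R"
proof -
  have e2: "card e = 2" "e \<subseteq> {0..<n}" if "e \<in> edges G" for e using G that by (auto simp: simple_graph_def)
  have "edges G \<subseteq> Pow {0..<n}" using e2(2) by blast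
  then have "finite (edges G)" by (rule finite_subset) simp
  then have "finite (Pow (edges G))" by simp
  moreover have "{M. matching G M} \<subseteq> Pow (edges G)" unfolding matching_def by blast
  ultimately have fin: "finite {M. matching G M}" by (rule rev_finite_subset)
  have "matching G {}" by (simp add: matching_def)
  then have "matching_number G \<in> card ` {M. matching G M}"
    unfolding matching_number_def using fin by (intro Max_in) auto
  then obtain M where M: "matching G M" "card M = matching_number G" by auto
  have Me: "M \<subseteq> edges G" and dis: "\<And>e e'. e \<in> M \<Longrightarrow> e' \<in> M \<Longrightarrow> e \<noteq> e' \<Longrightarrow> e \<inter> e' = {}"
    using M(1) unfolding matching_def by blast+
  have cM: "card e = 2" if "e \<in> M" for e using that e2(1) Me by blast
  define B where "B = \<Union>M"
  have "card B = (\<Sum>e\<in>M. card e)" unfolding B_def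
  proof (rule card_Union_disjoint)
    show "pairwise disjnt M" using dis by (auto simp: pairwise_def disjnt_def)
    show "finite e" if "e \<in> M" for e using cM[OF that] by (cases "finite e") simp_all
  qed
  also have "\<dots> = 2 * card M" by (simp add: cM)
  finally have cB: "card B = 2 * matching_number G" using M(2) by simp
  have "\<exists>w. {v, w} \<in> M \<and> w \<noteq> v" if v: "v \<in> B" for v
  proof -
    obtain e where e: "e \<in> M" "v \<in> e" using v unfolding B_def by (elim UnionE)
    then have "card e = 2" by (intro cM)
    then obtain x y where "e = {x, y}" "x \<noteq> y" by (auto simp: card_2_iff)
    then consider "v = x" | "v = y" using e by auto
    then show ?thesis
    proof cases
      case 1
      then show ?thesis using e \<open>e = {x, y}\<close> \<open>x \<noteq> y\<close> by (intro exI[of _ y]) simp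
    next
      case 2
      then show ?thesis using e \<open>e = {x, y}\<close> \<open>x \<noteq> y\<close> by (intro exI[of _ x]) (simp add: insert_commute)
    qed
  qed
  then have "\<forall>v\<in>B. \<exists>w. {v, w} \<in> M \<and> w \<noteq> v" by blast
  from bchoice[OF this] obtain p where p: "\<And>v. v \<in> B \<Longrightarrow> {v, p v} \<in> M \<and> p v \<noteq> v" by blast
  have pB: "p v \<in> B" if "v \<in> B" for v using p[OF that] by (auto simp: B_def)
  have pp: "p (p v) = v" if "v \<in> B" for v
  proof -
    have "{v, p v} = {p v, p (p v)}"
    proof (rule ccontr)
      assume "{v, p v} \<noteq> {p v, p (p v)}"
      then have "{v, p v} \<inter> {p v, p (p v)} = {}"
        using p[OF that] p[OF pB[OF that]] by (intro dis) simp_all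
      then show False by simp
    qed
    then show ?thesis using p[OF that] by (auto simp: doubleton_eq_iff)
  qed
  have "card {v. v < n \<and> deg n R v = 2} * 2 + 5 * card B \<le> 5 * total n R"
  proof (rule local_opt_bound[where E="adj G" and p=p])
    show "adj G u v \<Longrightarrow> adj G v u" for u v by (simp add: adj_def insert_commute)
    show "R u v \<Longrightarrow> R v u" for u v using R(1) unfolding valid_def sym_sub_def by blast
    show "\<not> R u u" for u
    proof
      assume "R u u"
      then have "adj G u u" using R(1) unfolding valid_def sym_sub_def by blast
      then show False using e2(1)[of "{u}"] by (simp add: adj_def)
    qed
    show "deg n R v \<le> 2" for v using R(1) by (simp add: valid_def)
    show "B \<subseteq> {..<n}" using Me e2(2) by (fastforce simp: B_def)
    show "p v \<in> B \<and> p (p v) = v \<and> p v \<noteq> v \<and> adj G v (p v)" if "v \<in> B" for v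
      using p[OF that] pB[OF that] pp[OF that] Me by (auto simp: adj_def)
  qed (rule R(2))
  then show ?thesis using cB by (simp add: heavy_def)
qed

lemma initial_store:
  fixes k :: nat
  assumes G: "simple_graph G" "verts G = {0..<n}"
  defines "M \<equiv> spread (n * n) 0 (snd (initial_state G k))"
  shows "initial_state G k = ((\<lambda>_. 0)(0 := n, Suc 0 := k), snd (initial_state G k))"
    "rel_of n M 0 = adj G" "\<not> rel_of n M 1 u v" "graph_on n (adj G)"
proof -
  let ?h = "\<lambda>a. if a < n * n \<and> {a div n, a mod n} \<in> edges G then 1 else 0 :: nat"
  have n: "card (verts G) = n" using G(2) by simp
  have h: "snd (initial_state G k) = ?h" by (simp add: initial_state_def Let_def n)
  show "initial_state G k = ((\<lambda>_. 0)(0 := n, Suc 0 := k), snd (initial_state G k))"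
    by (simp add: initial_state_def Let_def n)
  have lt: "u < n" "v < n" "u \<noteq> v" if "{u, v} \<in> edges G" for u v
    using G that unfolding simple_graph_def by fastforce+
  show "graph_on n (adj G)"
    using lt by (auto simp: graph_on_def adj_def insert_commute)
  have "rel_of n M 0 u v = adj G u v" for u v
  proof (cases "u < n \<and> v < n")
    case True
    then have "u * n + v < (u + 1) * n" by simp
    also have "\<dots> \<le> n * n" using True by (intro mult_le_mono1) simp
    finally have i: "u * n + v < n * n" .
    have "M (cell 0 (u * n + v)) = ?h (u * n + v)"
      using i unfolding M_def h by (simp add: spread_def cell_def del: distrib_left_numeral)
    also have "\<dots> = (if {u, v} \<in> edges G then 1 else 0)" using i True by simp
    finally show ?thesis using True by (simp add: rel_of_def adj_def)
  next
    case False
    then show ?thesis using lt by (auto simp: rel_of_def adj_def)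
  qed
  then show "rel_of n M 0 = adj G" by blast
  have "M (cell 1 i) = 0" for i
  proof -
    have "(8 * i + 1) mod 8 \<noteq> 0" by presburger
    then have "spread (n * n) 0 ?h (8 * i + 1) = ?h (n * n + (8 * i + 1))" unfolding spread_def by (simp only: simp_thms if_False)
    then show ?thesis unfolding M_def h cell_def by simp
  qed
  then show "\<not> rel_of n M 1 u v" by (simp add: rel_of_def)
qed

theorem theorem18:
  fixes t :: nat
  assumes "t \<ge> 3"
  shows "solvable_in_time_exp_square_poly (strong_closure (star t))
           (\<lambda>G k. int k - int (matching_number G))"
proof -
  \<comment> \<open>The answer is variable 6, that is register 12, and has to end up in register
    0.\<close>
  define p where "p = Seq Spread (Seq (ccomp (Main t) 0) (copy 0 12))"
  obtain K d where cost: "\<And>s W. sizes_le (fst s) W \<and> fst s 2 = 0 \<and> fst s 3 = 0 \<and> fst s 4 = 0 \<and>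
     2 * fst s 0 + 1 \<le> W \<and> fst (den (Prepare t) s) 2 \<le> W \<and> fst (den (Prepare t) s) 3 \<le> W \<Longrightarrow>
     cost (Main t) s \<le> max 1 (fst (den (Prepare t) s) 5) * (K * (W + 1) ^ d)"
    using cost_Main[of t] by blast
  \<comment> \<open>The 25 pays for loading the input and for the final copy; \<open>32 * t\<close>
    comes from \<open>W + 1 \<le> 32 * t * b\<^sup>2\<close> below.\<close>
  define A where "A = (25 + K) * (32 * t) ^ (1 + d)"
  have "decides_in_time p (strong_closure (star t)) (\<lambda>G k. real A *
      2 powr (real (175 * t) * (real_of_int (int k - int (matching_number G)))\<^sup>2) *
      real (max 1 (card (verts G))) ^ (2 * (1 + d)))"
    unfolding decides_in_time_def
  proof (intro allI impI, elim conjE)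
    fix G :: "nat graph" and k
    define n where "n = card (verts G)"
    define r where "r = real_of_int (int k - int (matching_number G))"
    define h where "h = snd (initial_state G k)"
    define \<sigma> :: "nat \<Rightarrow> nat" where "\<sigma> = (\<lambda>_. 0)(0 := n, Suc 0 := k)"
    define s where "s = (\<sigma>, spread (n * n) 0 h)"
    assume G: "simple_graph G" and "verts G = {0..<card (verts G)}"
    then have vG: "verts G = {0..<n}" by (simp add: n_def)
    note init = initial_store(1-3)[OF G vG, where k=k, folded h_def, folded \<sigma>_def]
      initial_store(4)[OF G vG]
    have s0: "fst s 0 = n" "fst s 1 = k" "fst s 2 = 0" "fst s 3 = 0" "fst s 4 = 0"
      by (simp_all add: s_def \<sigma>_def)
    have sr: "rel_of n (snd s) 0 = adj G" "\<And>u v. \<not> rel_of n (snd s) 1 u v"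
      using init(2,3) by (simp_all add: s_def)
    have ans: "fst (den (Main t) s) 6 = (if strong_closure (star t) G k then 1 else 0)"
      using den_Main[OF init(4) s0(1,2) sr assms] strong_closure_iff[OF G vG, of t k] assms by simp
    have "1 \<le> t" using assms by simp
    from den_Prepare[OF init(4) s0(1,2) sr this]
    obtain R where R: "valid n (adj G) R" "local_opt n (adj G) R"
      "fst (den (Prepare t) s) 2 = (t - 1) * card (heavy n R)"
      "fst (den (Prepare t) s) 3 = (if 2 * k \<le> total n R then 0 else 7 * (card (heavy n R) * ((t - 1) * card (heavy n R))))"
      "fst (den (Prepare t) s) 5 = 2 ^ fst (den (Prepare t) s) 3" by metis
    \<comment> \<open>W dominates the number of slots, the length of a certificate and the number of
      sweeps.\<close>
    define q L W where "q = card (heavy n R)" and "L = fst (den (Prepare t) s) 3" and "W = 7 * t * (n + 1)\<^sup>2"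
    have qn: "q \<le> n" using card_mono[of "{..<n}" "heavy n R"] by (auto simp: heavy_def q_def)
    have L: "L = (if 2 * k \<le> total n R then 0 else 7 * (q * ((t - 1) * q)))" using R(4) by (simp add: L_def q_def)
    have Lq: "L \<le> 7 * t * q\<^sup>2"
    proof -
      have "(t - 1) * (q * q) \<le> t * (q * q)" by (intro mult_le_mono1) simp
      then show ?thesis by (simp add: L power2_eq_square algebra_simps)
    qed
    have sq: "q\<^sup>2 \<le> (n + 1)\<^sup>2" using qn by (intro power_mono) auto
    have n1: "n + 1 \<le> (n + 1)\<^sup>2" by (simp add: power2_eq_square)
    have W: "7 * (n + 1)\<^sup>2 \<le> W" "t * (n + 1)\<^sup>2 \<le> W" using assms by (simp_all add: W_def)
    have LW: "L \<le> W" using Lq mult_le_mono2[OF sq, of "7 * t"] unfolding W_def by linarith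
    have PW: "(t - 1) * q \<le> W"
    proof -
      have "(t - 1) * q \<le> t * (n + 1)\<^sup>2" using qn n1 by (intro mult_le_mono) auto
      then show ?thesis using W(2) by linarith
    qed
    have nW: "2 * n + 1 \<le> W" using n1 W(1) by linarith
    have "sizes_le (fst s) W" using nW by (simp add: sizes_le_def size_vars_def s_def \<sigma>_def)
    then have c: "cost (Main t) s \<le> 2 ^ L * (K * (W + 1) ^ d)"
      using cost[of s W] s0 R(3,5) PW LW nW by (simp add: L_def[symmetric] q_def[symmetric] max_def)
    define T where "T = (10 + 4 * n + 9 * (n * n)) + (cost (Main t) s + 2)"
    have loaded: "runs Spread (\<sigma>, h) (10 + 4 * n + 9 * (n * n)) (rel (\<sigma>, spread (n * n) 0 h))"
      unfolding \<sigma>_def by (rule runs_Spread)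
    have "runs p (initial_state G k) T (\<lambda>q. fst q 0 = fst (den (Main t) s) 6)"
      unfolding p_def init(1)
    proof (rule runs_Seq[OF loaded])
      fix q assume "rel (\<sigma>, spread (n * n) 0 h) q"
      then have "rel s q" by (simp add: s_def)
      from runs_ccomp[OF this]
      show "runs (Seq (ccomp (Main t) 0) (copy 0 12)) q (cost (Main t) s + 2) (\<lambda>q. fst q 0 = fst (den (Main t) s) 6)"
      proof (rule runs_Seq)
        fix q' assume "rel (den (Main t) s) q' \<and> keeps 0 q q'"
        then have "fst q' (2 * 6) = fst (den (Main t) s) 6" unfolding rel_def by blast
        then show "runs (copy 0 12) q' 2 (\<lambda>q. fst q 0 = fst (den (Main t) s) 6)"
          by (intro runs_straight) (simp_all add: copy_def)
      qed simp
    qed (simp add: T_def)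
    then obtain m r' h' where run: "exec p (initial_state G k) m (r', h')" "m \<le> T"
      "r' 0 = (if strong_closure (star t) G k then 1 else 0)"
      unfolding runs_def using ans by auto
    have T: "T \<le> 2 ^ L * ((25 + K) * (W + 1) ^ (1 + d))"
    proof -
      have "10 + 4 * n + 9 * (n * n) + 2 \<le> 25 * (n + 1)\<^sup>2" by (simp add: power2_eq_square algebra_simps)
      also have "\<dots> \<le> 25 * (W + 1) ^ 1" using W(1) by simp
      finally have 1: "10 + 4 * n + 9 * (n * n) + 2 \<le> 25 * (W + 1) ^ 1" .
      have "1 * (25 * (W + 1) ^ 1) \<le> 2 ^ L * (25 * (W + 1) ^ 1)" by (rule mult_le_mono1) simp
      then have "10 + 4 * n + 9 * (n * n) + 2 \<le> 2 ^ L * (25 * (W + 1) ^ 1)"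
        using 1 unfolding mult_1_left by (rule order_trans[rotated])
      then have "T \<le> 2 ^ L * (25 * (W + 1) ^ 1 + K * (W + 1) ^ d)"
        using c unfolding T_def distrib_left by linarith
      also have "\<dots> \<le> 2 ^ L * ((25 + K) * (W + 1) ^ (1 + d))"
        by (intro mult_le_mono2 poly_add) auto
      finally show ?thesis .
    qed
    define b where "b = max 1 n"
    have "W + 1 \<le> 32 * t * b\<^sup>2"
    proof -
      have "(n + 1)\<^sup>2 \<le> (2 * b)\<^sup>2" by (intro power_mono) (auto simp: b_def)
      then have "(n + 1)\<^sup>2 \<le> 4 * b\<^sup>2" by (simp add: power_mult_distrib)
      then have "t * (n + 1)\<^sup>2 \<le> t * (4 * b\<^sup>2)" by (rule mult_le_mono2)
      moreover have "1 \<le> t * (n + 1)\<^sup>2" using assms by simp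
      ultimately have "7 * (t * (n + 1)\<^sup>2) + 1 \<le> 8 * (t * (4 * b\<^sup>2))" by linarith
      also have "\<dots> = 32 * t * b\<^sup>2" by simp
      finally show ?thesis unfolding W_def by (simp only: mult.assoc)
    qed
    then have "(W + 1) ^ (1 + d) \<le> (32 * t * b\<^sup>2) ^ (1 + d)" by (rule power_mono) simp
    also have "\<dots> = (32 * t) ^ (1 + d) * b ^ (2 * (1 + d))" by (simp only: power_mult_distrib power_mult)
    finally have "(25 + K) * (W + 1) ^ (1 + d) \<le> (25 + K) * ((32 * t) ^ (1 + d) * b ^ (2 * (1 + d)))"
      by (rule mult_le_mono2)
    also have "\<dots> = A * b ^ (2 * (1 + d))" by (simp only: A_def mult.assoc)
    finally have "2 ^ L * ((25 + K) * (W + 1) ^ (1 + d)) \<le> 2 ^ L * (A * b ^ (2 * (1 + d)))"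
      by (rule mult_le_mono2)
    then have "m \<le> 2 ^ L * (A * b ^ (2 * (1 + d)))" using T run(2) by linarith
    then have "real m \<le> real (2 ^ L * (A * b ^ (2 * (1 + d))))" by (rule of_nat_mono)
    also have "\<dots> = 2 ^ L * (real A * real b ^ (2 * (1 + d)))" by simp
    also have "\<dots> \<le> 2 powr (real (175 * t) * r\<^sup>2) * (real A * real b ^ (2 * (1 + d)))"
    proof (rule mult_right_mono)
      \<comment> \<open>Here 175 is 7 layers times the square of 5, from
        \<open>q \<le> 5 * r\<close>. That inequality needs the local search to stay below k edges;
        otherwise L is 0 and the bound holds even for negative r.\<close>
      have "real L \<le> real (175 * t) * r\<^sup>2"
      proof (cases "2 * k \<le> total n R")
        case True
        then show ?thesis using L by simp
      next
        case False
        have "q * 2 + 10 * matching_number G \<le> 5 * total n R"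
          using heavy_bound[OF G vG R(1,2)] by (simp add: q_def)
        then have "q + 5 * matching_number G \<le> 5 * k" using False by linarith
        then have "real q \<le> 5 * r" unfolding r_def by simp
        then have "(real q)\<^sup>2 \<le> (5 * r)\<^sup>2" by (intro power_mono) auto
        then have "real (7 * t) * (real q)\<^sup>2 \<le> real (7 * t) * (25 * r\<^sup>2)"
          by (intro mult_left_mono) (simp_all add: power_mult_distrib)
        moreover have "real L \<le> real (7 * t * q\<^sup>2)" using Lq by (rule of_nat_mono)
        ultimately show ?thesis by simp
      qed
      then have "2 powr real L \<le> 2 powr (real (175 * t) * r\<^sup>2)" by (intro powr_mono) auto
      then show "2 ^ L \<le> 2 powr (real (175 * t) * r\<^sup>2)" by (simp add: powr_realpow)
    qed simp
    finally have "real m \<le> real A * 2 powr (real (175 * t) * r\<^sup>2) * real b ^ (2 * (1 + d))"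
      by (simp only: mult_ac)
    then show "\<exists>m r' h'. exec p (initial_state G k) m (r', h') \<and>
        r' 0 = (if strong_closure (star t) G k then 1 else 0) \<and>
        real m \<le> real A * 2 powr (real (175 * t) * (real_of_int (int k - int (matching_number G)))\<^sup>2) *
          real (max 1 (card (verts G))) ^ (2 * (1 + d))"
      using run(1,3) unfolding r_def b_def n_def by (intro exI[of _ m] exI[of _ r'] exI[of _ h'] conjI)
  qed
  then show ?thesis unfolding solvable_in_time_exp_square_poly_def by blast
qed

end
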